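(* In the independent action model of the sequential contract problem with $n$ actions and $m$ outcomes, there are $O(n^2m)$ critical values of $\alpha$, and they are computable in polynomial time.
   Context: Sequential contract problem. An instance consists of a set $A$ of $n$ actions with costs $c_i\ge 0$ ($i\in A$), a set $[m]=\{1,\dots,m\}$ of outcomes with principal rewards $0=r(1)\le r(2)\le\dots\le r(m)$, and random variables $X_i$ with values in $[m]$ ($i\in A$), where $X_i$ is the outcome of action $i$. In the independent action model the $X_i$ are independent and $p_{ij}=\Pr[X_i=j]$; the input is the costs, the rewards and the probabilities $p_{ij}$. A contract is a function $t:[m]\to\mathbb{R}_{\ge 0}$. Given $t$, the agent acts sequentially: at each point he either takes a not-yet-taken action $i$, pays $c_i$ and observes the realization of $X_i$, or halts. On halting he selects one revealed outcome as the final outcome; outcome $1$ (the zero outcome) is always considered revealed. A (deterministic) strategy $\pi$ specifies all these decisions as a function of the history; there are finitely many strategies. $S(\pi)$ is the random set of actions taken, $\omega(\pi)$ the random final outcome. Utilities: $u_A(t,\pi)=\mathbb{E}[t(\omega(\pi))-\sum_{i\in S(\pi)}c_i]$ and $u_P(t,\pi)=\mathbb{E}[r(\omega(\pi))-t(\omega(\pi))]$. The best response $\pi^\star(t)$ is a strategy maximizing $u_A(t,\cdot)$, with ties broken in favour of larger $u_P(t,\cdot)$ and remaining ties broken consistently by a fixed total order on strategies. A linear contract with parameter $\alpha\in[0,1]$ is $t_\alpha(j)=\alpha\cdot r(j)$. As $\alpha$ increases from $0$ to $1$, the best response $\pi^\star(t_\alpha)$ changes only finitely many times; the critical values are the values of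 $\alpha$ at which the best response $\pi^\star(t_\alpha)$ changes (i.e. $\pi^\star(t_{\alpha})$ differs from the best response immediately to the left of $\alpha$).
   Formalization: At α=1 all principal utilities are 0, so whether 1 is critical depends on the tie-breaking order, which is not in the input; the computed list is exact on (0,1) and contains 1 iff 1 is critical for some tie-breaking order. *)

theory Defs
  imports
    "HOL-Probability.Probability"
    "HOL-Computational_Algebra.Polynomial"
    "HOL-Library.Log_Nat"
begin

section \<open>The sequential contract problem\<close>

text \<open>
  The actions are labelled \<open>0, \<dots>, n - 1\<close>, the outcomes \<open>1, \<dots>, m\<close>. The field \<open>law\<close> is the joint
  distribution of the vector of outcomes; the random variable \<open>X i\<close> is the coordinate
  \<open>\<lambda>x. x i\<close>, and coordinates outside the set of actions play no role.
\<close>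

record contract_instance =
  num_actions :: nat
  num_outcomes :: nat
  cost :: "nat \<Rightarrow> real"
  reward :: "nat \<Rightarrow> real"
  law :: "(nat \<Rightarrow> nat) pmf"

definition actions :: "contract_instance \<Rightarrow> nat set" where
  "actions I = {..<num_actions I}"

definition outcomes :: "contract_instance \<Rightarrow> nat set" where
  "outcomes I = {1..num_outcomes I}"

definition outcome_prob :: "contract_instance \<Rightarrow> nat \<Rightarrow> nat \<Rightarrow> real" where
  "outcome_prob I i j = measure_pmf.prob (law I) {x. x i = j}"

definition is_instance :: "contract_instance \<Rightarrow> bool" where
  "is_instance I \<longleftrightarrow>
     1 \<le> num_outcomes I \<and>
     (\<forall>i\<in>actions I. 0 \<le> cost I i) \<and>
     reward I 1 = 0 \<and> mono_on (outcomes I) (reward I) \<and>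
     (\<forall>x\<in>set_pmf (law I). \<forall>i\<in>actions I. x i \<in> outcomes I)"

definition independent_action_model :: "contract_instance \<Rightarrow> bool" where
  "independent_action_model I \<longleftrightarrow>
     is_instance I \<and>
     prob_space.indep_vars (measure_pmf (law I)) (\<lambda>_. count_space UNIV) (\<lambda>i x. x i) (actions I)"


subsection \<open>Strategies\<close>

text \<open>
  A history is the chronological list of the actions taken so far, each with its observed outcome.
  Strategies are extensional functions on the finite set of histories, so that there are finitely
  many of them.
\<close>

type_synonym history = "(nat \<times> nat) list"

datatype decision = Take nat | Halt (final: nat)

type_synonym strategy = "history \<Rightarrow> decision"

definition histories :: "contract_instance \<Rightarrow> history set" where
  "histories I = {h. set h \<subseteq> actions I \<times> outcomes I \<and> distinct (map fst h)}"

definition legal_decisions :: "contract_instance \<Rightarrow> history \<Rightarrow> decision set" where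
  "legal_decisions I h = Take ` (actions I - fst ` set h) \<union> Halt ` insert 1 (snd ` set h)"

definition strategies :: "contract_instance \<Rightarrow> strategy set" where
  "strategies I = (\<Pi>\<^sub>E h\<in>histories I. legal_decisions I h)"

primrec play :: "strategy \<Rightarrow> (nat \<Rightarrow> nat) \<Rightarrow> nat \<Rightarrow> history" where
  "play \<pi> x 0 = []"
| "play \<pi> x (Suc k) =
     (case \<pi> (play \<pi> x k) of
        Take i \<Rightarrow> play \<pi> x k @ [(i, x i)]
      | Halt j \<Rightarrow> play \<pi> x k)"

text \<open>
  After \<open>n\<close> rounds the agent has halted or has taken all \<open>n\<close> actions. In the latter case halting
  is his only legal decision, so \<open>final\<close> is always applied to a decision of the form \<open>Halt j\<close>.
\<close>

definition final_history :: "contract_instance \<Rightarrow> strategy \<Rightarrow> (nat \<Rightarrow> nat) \<Rightarrow> history" where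
  "final_history I \<pi> x = play \<pi> x (num_actions I)"

definition actions_taken :: "contract_instance \<Rightarrow> strategy \<Rightarrow> (nat \<Rightarrow> nat) \<Rightarrow> nat set" where
  "actions_taken I \<pi> x = fst ` set (final_history I \<pi> x)"

definition final_outcome :: "contract_instance \<Rightarrow> strategy \<Rightarrow> (nat \<Rightarrow> nat) \<Rightarrow> nat" where
  "final_outcome I \<pi> x = final (\<pi> (final_history I \<pi> x))"


subsection \<open>Utilities, best responses and critical values\<close>

definition agent_utility :: "contract_instance \<Rightarrow> (nat \<Rightarrow> real) \<Rightarrow> strategy \<Rightarrow> real" where
  "agent_utility I t \<pi> = measure_pmf.expectation (law I)
     (\<lambda>x. t (final_outcome I \<pi> x) - (\<Sum>i\<in>actions_taken I \<pi> x. cost I i))"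

definition principal_utility :: "contract_instance \<Rightarrow> (nat \<Rightarrow> real) \<Rightarrow> strategy \<Rightarrow> real" where
  "principal_utility I t \<pi> = measure_pmf.expectation (law I)
     (\<lambda>x. reward I (final_outcome I \<pi> x) - t (final_outcome I \<pi> x))"

definition agent_optimal :: "contract_instance \<Rightarrow> (nat \<Rightarrow> real) \<Rightarrow> strategy set" where
  "agent_optimal I t =
     {\<pi> \<in> strategies I. \<forall>\<sigma>\<in>strategies I. agent_utility I t \<sigma> \<le> agent_utility I t \<pi>}"

definition principal_preferred :: "contract_instance \<Rightarrow> (nat \<Rightarrow> real) \<Rightarrow> strategy set" where
  "principal_preferred I t =
     {\<pi> \<in> agent_optimal I t. \<forall>\<sigma>\<in>agent_optimal I t. principal_utility I t \<sigma> \<le> principal_utility I t \<pi>}"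

definition tie_breaking_order :: "contract_instance \<Rightarrow> strategy rel \<Rightarrow> bool" where
  "tie_breaking_order I T \<longleftrightarrow> linear_order_on (strategies I) T"

definition best_response ::
    "contract_instance \<Rightarrow> strategy rel \<Rightarrow> (nat \<Rightarrow> real) \<Rightarrow> strategy" where
  "best_response I T t =
     (THE \<pi>. \<pi> \<in> principal_preferred I t \<and> (\<forall>\<sigma>\<in>principal_preferred I t. (\<pi>, \<sigma>) \<in> T))"

definition linear_contract :: "contract_instance \<Rightarrow> real \<Rightarrow> nat \<Rightarrow> real" where
  "linear_contract I \<alpha> j = \<alpha> * reward I j"

text \<open>
  The condition is that the best response is not constantly \<open>\<pi>\<^sup>\<star>(t\<^sub>\<alpha>)\<close> on some interval
  \<open>(\<alpha> - \<epsilon>, \<alpha>]\<close>. An \<open>\<alpha>\<close> to the left of which the best response did not settle at all would also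
  count, so that finiteness of this set includes that there are finitely many changes.
\<close>

definition critical_values :: "contract_instance \<Rightarrow> strategy rel \<Rightarrow> real set" where
  "critical_values I T =
     {\<alpha>. 0 < \<alpha> \<and> \<alpha> \<le> 1 \<and>
        \<not> (\<forall>\<^sub>F \<beta> in at_left \<alpha>.
              best_response I T (linear_contract I \<beta>) = best_response I T (linear_contract I \<alpha>))}"


section \<open>Polynomial time\<close>

text \<open>
  A small deterministic While language over binary trees with integer leaves, in the style of
  Jones's WHILE, with logarithmic costs: every step is charged the bit size of all the data it
  handles. A Turing machine performs each single step in time polynomial in its charge (the most
  expensive ones being multiplication and division of binary numbers), and conversely the
  language simulates Turing machines with polynomial overhead, so that polynomial running time
  means the same in both models.
\<close>

datatype val = Atom int | Node val val

primrec vsize :: "val \<Rightarrow> nat" where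
  "vsize (Atom k) = Suc (floorlog 2 (nat \<bar>k\<bar>))"
| "vsize (Node v w) = Suc (vsize v + vsize w)"

datatype prim = Ident | Quote val | Left | Right | IsNode | Plus | Minus | Times | Quot | Leq

fun arith :: "(int \<Rightarrow> int \<Rightarrow> int) \<Rightarrow> val \<Rightarrow> val" where
  "arith f (Node (Atom a) (Atom b)) = Atom (f a b)"
| "arith f _ = Atom 0"

fun apply_prim :: "prim \<Rightarrow> val \<Rightarrow> val" where
  "apply_prim Ident x = x"
| "apply_prim (Quote v) x = v"
| "apply_prim Left x = (case x of Node v w \<Rightarrow> v | Atom k \<Rightarrow> Atom 0)"
| "apply_prim Right x = (case x of Node v w \<Rightarrow> w | Atom k \<Rightarrow> Atom 0)"
| "apply_prim IsNode x = (case x of Node v w \<Rightarrow> Atom 1 | Atom k \<Rightarrow> Atom 0)"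
| "apply_prim Plus x = arith (+) x"
| "apply_prim Minus x = arith (-) x"
| "apply_prim Times x = arith (*) x"
| "apply_prim Quot x = arith (div) x"
| "apply_prim Leq x = arith (\<lambda>a b. if a \<le> b then 1 else 0) x"

datatype prog =
    Prim prim
  | Fork prog prog
  | Then prog prog
  | Cond prog prog prog
  | Loop prog prog

text \<open>
  \<open>runs p x y t\<close>: program \<open>p\<close> on input \<open>x\<close> terminates with output \<open>y\<close> at cost \<open>t\<close>. A test fails iff
  it yields \<open>Atom 0\<close>.
\<close>

inductive runs :: "prog \<Rightarrow> val \<Rightarrow> val \<Rightarrow> nat \<Rightarrow> bool" where
  prim: "runs (Prim f) x (apply_prim f x) (vsize x + vsize (apply_prim f x))"
| fork: "runs p x y s \<Longrightarrow> runs q x z t \<Longrightarrow> runs (Fork p q) x (Node y z) (Suc (vsize x + s + t))"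
| seq: "runs p x y s \<Longrightarrow> runs q y z t \<Longrightarrow> runs (Then p q) x z (Suc (s + t))"
| cond_true: "runs b x v s \<Longrightarrow> v \<noteq> Atom 0 \<Longrightarrow> runs p x y t \<Longrightarrow>
    runs (Cond b p q) x y (Suc (vsize x + s + t))"
| cond_false: "runs b x (Atom 0) s \<Longrightarrow> runs q x y t \<Longrightarrow>
    runs (Cond b p q) x y (Suc (vsize x + s + t))"
| loop_stop: "runs b x (Atom 0) s \<Longrightarrow> runs (Loop b p) x x (Suc (vsize x + s))"
| loop_step: "runs b x v s \<Longrightarrow> v \<noteq> Atom 0 \<Longrightarrow> runs p x y t \<Longrightarrow> runs (Loop b p) y z u \<Longrightarrow>
    runs (Loop b p) x z (Suc (vsize x + s + t + u))"

inductive_cases runs_primE: "runs (Prim f) x y t"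
inductive_cases runs_forkE: "runs (Fork p q) x y t"
inductive_cases runs_thenE: "runs (Then p q) x y t"
inductive_cases runs_condE: "runs (Cond b p q) x y t"
inductive_cases runs_loopE: "runs (Loop b p) x y t"

lemma runs_deterministic:
  "runs p x y t \<Longrightarrow> runs p x y' t' \<Longrightarrow> y' = y \<and> t' = t"
proof (induction arbitrary: y' t' rule: runs.induct)
  case (prim f x)
  from prim.prems show ?case by (rule runs_primE) simp
next
  case (fork p x y s q z t)
  from fork.prems show ?case by (rule runs_forkE) (auto dest: fork.IH)
next
  case (seq p x y s q z t)
  from seq.prems show ?case by (rule runs_thenE) (auto dest!: seq.IH(1) seq.IH(2))
next
  case (cond_true b x v s p y t q)
  from cond_true.prems show ?case
    by (rule runs_condE) (use cond_true.hyps in \<open>auto dest: cond_true.IH\<close>)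
next
  case (cond_false b x s q y t p)
  from cond_false.prems show ?case by (rule runs_condE) (auto dest: cond_false.IH)
next
  case (loop_stop b x s p)
  from loop_stop.prems show ?case by (rule runs_loopE) (auto dest: loop_stop.IH)
next
  case (loop_step b x v s p y t z u)
  from loop_step.prems show ?case
  proof (rule runs_loopE)
    fix s' assume "runs b x (Atom 0) s'"
    with loop_step.IH(1) loop_step.hyps show ?thesis by metis
  next
    fix v' s1 w t1 u1
    assume a: "t' = Suc (vsize x + s1 + t1 + u1)"
      and b: "runs b x v' s1" and p: "runs p x w t1" and l: "runs (Loop b p) w y' u1"
    have "s1 = s" using loop_step.IH(1)[OF b] by simp
    moreover have w: "w = y" "t1 = t" using loop_step.IH(2)[OF p] by simp_all
    moreover have "y' = z \<and> u1 = u" using loop_step.IH(3) l w by simp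
    ultimately show ?thesis using a by simp
  qed
qed

lemma runs_output_size: "runs p x y t \<Longrightarrow> vsize y \<le> vsize x + t"
  by (induction rule: runs.induct) auto

definition poly_time_solvable ::
    "('a \<Rightarrow> val) \<Rightarrow> ('b \<Rightarrow> val) \<Rightarrow> 'a set \<Rightarrow> ('a \<Rightarrow> 'b \<Rightarrow> bool) \<Rightarrow> bool" where
  "poly_time_solvable enc_in enc_out D R \<longleftrightarrow>
     (\<exists>(p :: prog) (q :: nat poly). \<forall>x\<in>D. \<exists>y t.
        R x y \<and> runs p (enc_in x) (enc_out y) t \<and> t \<le> poly q (vsize (enc_in x)))"


subsection \<open>Inputs and outputs\<close>

text \<open>A rational number is given by any fraction with positive denominator, reduced or not.\<close>

type_synonym frac = "int \<times> int"

definition proper :: "frac \<Rightarrow> bool" where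
  "proper q \<longleftrightarrow> 0 < snd q"

definition frac_val :: "frac \<Rightarrow> real" where
  "frac_val q = real_of_int (fst q) / real_of_int (snd q)"

fun enc_frac :: "frac \<Rightarrow> val" where
  "enc_frac (a, b) = Node (Atom a) (Atom b)"

fun enc_list :: "('a \<Rightarrow> val) \<Rightarrow> 'a list \<Rightarrow> val" where
  "enc_list e [] = Atom 0"
| "enc_list e (x # xs) = Node (e x) (enc_list e xs)"

text \<open>The list of costs, the list of rewards, and the matrix of probabilities (one row per action).\<close>

type_synonym input = "frac list \<times> frac list \<times> frac list list"

fun enc_input :: "input \<Rightarrow> val" where
  "enc_input (cs, rs, ps) =
     Node (enc_list enc_frac cs) (Node (enc_list enc_frac rs) (enc_list (enc_list enc_frac) ps))"

fun describes :: "input \<Rightarrow> contract_instance \<Rightarrow> bool" where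
  "describes (cs, rs, ps) I \<longleftrightarrow>
     list_all proper cs \<and> list_all proper rs \<and> list_all (list_all proper) ps \<and>
     map frac_val cs = map (cost I) [0..<num_actions I] \<and>
     map frac_val rs = map (reward I) [1..<Suc (num_outcomes I)] \<and>
     map (map frac_val) ps =
       map (\<lambda>i. map (outcome_prob I i) [1..<Suc (num_outcomes I)]) [0..<num_actions I]"

definition valid_inputs :: "input set" where
  "valid_inputs = {inp. \<exists>I. independent_action_model I \<and> describes inp I}"

text \<open>
  For \<open>\<alpha> = 1\<close> the principal's utility is \<open>0\<close> under every strategy, so the best response to \<open>t\<^sub>1\<close> is
  chosen among all agent-optimal strategies by the tie-breaking order alone. Whether \<open>1\<close> is critical
  may hence depend on this order, which is not part of the input. The output is therefore
  required to contain \<open>1\<close> exactly if \<open>1\<close> is critical for some tie-breaking order; all other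
  critical values have to be listed exactly, for every tie-breaking order.
\<close>

definition lists_critical_values :: "contract_instance \<Rightarrow> frac list \<Rightarrow> bool" where
  "lists_critical_values I L \<longleftrightarrow>
     list_all proper L \<and>
     (\<forall>T. tie_breaking_order I T \<longrightarrow>
        frac_val ` set L - {1} = critical_values I T - {1}) \<and>
     (1 \<in> frac_val ` set L \<longleftrightarrow> (\<exists>T. tie_breaking_order I T \<and> 1 \<in> critical_values I T))"

end

theory Submission
  imports Defs
begin

text \<open>
  For linear contracts the agent maximizes \<open>\<alpha> R(\<pi>) - C(\<pi>)\<close>, the expected reward and cost of \<open>\<pi>\<close>, so his optimal
  utility \<open>U\<close> is the upper envelope of finitely many lines, and the critical values are the kinks of \<open>U\<close>, i.e.
  the points at which optimal strategies with different \<open>R\<close> coexist (at \<open>1\<close>, for a suitable tie-breaking order).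
  The agent's problem is Pandora's box problem, and Weitzman's theorem gives
  \<open>U(\<alpha>) = E max(0, max\<^sub>i min(\<alpha> r(X\<^sub>i), \<sigma>\<^sub>i(\<alpha>)))\<close> with reservation values \<open>\<sigma>\<^sub>i\<close> determined by
  \<open>E max(0, \<alpha> r(X\<^sub>i) - \<sigma>\<^sub>i(\<alpha>)) = c\<^sub>i\<close>. Hence \<open>U\<close> is affine near \<open>\<alpha>\<close> unless the order of the functions
  \<open>\<alpha> r\<^sub>j\<close> and \<open>\<sigma>\<^sub>i(\<alpha>)\<close> changes there. A change between \<open>\<sigma>\<^sub>i\<close> and \<open>\<alpha> r\<^sub>j\<close> happens at most once for each
  \<open>(i, j)\<close>, and between these changes \<open>\<sigma>\<^sub>i\<close> and \<open>\<sigma>\<^sub>k\<close> are affine, so that they cross \<open>O(m)\<close> times.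

  For the algorithm, \<open>\<sigma>\<^sub>i\<close> is written as the maximum of \<open>0\<close> and at most \<open>m\<close> explicit lines. All kinks are
  among the polynomially many crossings of these lines and the lines \<open>\<alpha> r\<^sub>j\<close>. Since \<open>U\<close> is affine between
  neighbouring crossings, a crossing is a kink iff \<open>U\<close> lies there strictly below all chords between the
  other crossings, and \<open>U\<close> is evaluated through the product formula for the distribution function of a
  maximum of independent random variables.
\<close>

section \<open>Polynomial-time computable functions\<close>

text \<open>The two claims use different decompositions of U. The explicit lines behind the
  reservation values number O(n m) and may have O(n^2 m^2) crossings: harmless for a polynomial
  algorithm, too many for the count. The count therefore follows the functions \<sigma>_i
  themselves, whose affine pieces are labelled by the growing sets of rewards that they exceed. One
  lemma, stated for an arbitrary filter, turns either decomposition into affinity of U. Actions of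
  cost 0 need separate care, since their defining equation does not determine \<sigma>_i. Taking the
  least s \<ge> 0 with E max(0, \<alpha> r - s) \<le> c makes \<sigma>_i a reward line in this case,
  so that such actions cause no switching points. Weitzman's theorem is proved by verification: the
  formula, read as a function of the untaken actions and the best revealed value, satisfies the
  Bellman equation. Programs are never written out for the algorithm itself; closure rules produce
  them from the shape of the definitions.\<close>

class encodable = fixes encode :: "'a \<Rightarrow> val"

instantiation int :: encodable begin
definition encode_int :: "int \<Rightarrow> val" where "encode_int = Atom"
instance ..
end

text \<open>Tests of the language fail exactly on \<open>Atom 0\<close>, so a program for a Boolean
  function serves directly as a test.\<close>

instantiation bool :: encodable begin
definition encode_bool :: "bool \<Rightarrow> val" where "encode_bool b = Atom (if b then 1 else 0)"
instance ..
end

instantiation prod :: (encodable, encodable) encodable begin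
definition encode_prod :: "'a \<times> 'b \<Rightarrow> val" where "encode_prod x = Node (encode (fst x)) (encode (snd x))"
instance ..
end

instantiation list :: (encodable) encodable begin
definition encode_list :: "'a list \<Rightarrow> val" where "encode_list = enc_list encode"
instance ..
end

lemma encode_simps [simp]:
  "encode (k::int) = Atom k"
  "encode (x, y) = Node (encode x) (encode y)"
  "encode ([]::'a::encodable list) = Atom 0"
  "encode (a # as) = Node (encode a) (encode as)"
  by (simp_all add: encode_int_def encode_prod_def encode_list_def)

abbreviation sz :: "'a::encodable \<Rightarrow> nat" where "sz x \<equiv> vsize (encode x)"

lemma floorlog_zero [simp]: "floorlog b 0 = 0"
  by (simp add: floorlog_def)

text \<open>Natural coefficients make every time bound monotone, so that a bound on an intermediate
  size can be inserted into the bound of the next program.\<close>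

lemma poly_nat_mono: "a \<le> b \<Longrightarrow> poly (q :: nat poly) a \<le> poly q b"
  by (induction q) (auto intro!: add_mono mult_mono)

text \<open>Total on the whole type: malformed inputs are covered as well, so validity of an input
  never enters a running time.\<close>

definition poly_time :: "('a::encodable \<Rightarrow> 'b::encodable) \<Rightarrow> bool" where
  "poly_time f \<longleftrightarrow> (\<exists>p q. \<forall>x. \<exists>t. runs p (encode x) (encode (f x)) t \<and> t \<le> poly q (sz x))"

lemma poly_timeE:
  assumes "poly_time f"
  obtains p q where "\<And>x. \<exists>t. runs p (encode x) (encode (f x)) t \<and> t \<le> poly q (sz x)"
  using assms unfolding poly_time_def by blast

text \<open>Every step is charged for the data it produces, so the running time also bounds the
  growth of the output.\<close>

lemma poly_time_size:
  assumes "poly_time f"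
  obtains q where "\<And>x. sz (f x) \<le> poly q (sz x)"
proof -
  obtain p q where *: "\<And>x. \<exists>t. runs p (encode x) (encode (f x)) t \<and> t \<le> poly q (sz x)"
    using poly_timeE[OF assms] by blast
  have "sz (f x) \<le> poly ([:0, 1:] + q) (sz x)" for x
    using *[of x] runs_output_size by fastforce
  then show ?thesis using that by blast
qed

lemma poly_time_prim:
  assumes "\<And>x. apply_prim f (encode x) = encode (g x)" "\<And>x. sz (g x) \<le> poly q (sz x)"
  shows "poly_time g"
  unfolding poly_time_def
proof (intro exI allI conjI)
  fix x
  show "runs (Prim f) (encode x) (encode (g x)) (sz x + sz (g x))"
    using runs.prim[of f "encode x"] by (simp add: assms(1))
  show "sz x + sz (g x) \<le> poly ([:0, 1:] + q) (sz x)"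
    using assms(2)[of x] by simp
qed

lemma poly_time_id [simp, intro]: "poly_time (\<lambda>x. x)"
  by (rule poly_time_prim[of Ident _ "[:0, 1:]"]) auto

lemma poly_time_const [simp, intro]: "poly_time (\<lambda>x. c)"
  by (rule poly_time_prim[of "Quote (encode c)" _ "[:sz c:]"]) auto

section \<open>Closure under composition, pairing and case distinction\<close>

lemma poly_time_comp:
  assumes "poly_time f" "poly_time g"
  shows "poly_time (\<lambda>x. g (f x))"
proof -
  obtain p q where f: "\<And>x. \<exists>t. runs p (encode x) (encode (f x)) t \<and> t \<le> poly q (sz x)"
    using poly_timeE[OF assms(1)] by blast
  obtain p' q' where g: "\<And>x. \<exists>t. runs p' (encode x) (encode (g x)) t \<and> t \<le> poly q' (sz x)"
    using poly_timeE[OF assms(2)] by blast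
  show ?thesis unfolding poly_time_def
  proof (rule exI[of _ "Then p p'"], rule exI[of _ "1 + q + pcompose q' ([:0, 1:] + q)"], rule allI)
    fix x
    obtain s where s: "runs p (encode x) (encode (f x)) s" "s \<le> poly q (sz x)" using f by blast
    obtain t where t: "runs p' (encode (f x)) (encode (g (f x))) t" "t \<le> poly q' (sz (f x))"
      using g by blast
    \<comment> \<open>The second program sees an argument of size up to
      \<open>sz x + poly q (sz x)\<close>, whence the composed polynomial.\<close>
    have "sz (f x) \<le> sz x + poly q (sz x)" using runs_output_size[OF s(1)] s(2) by linarith
    then have "t \<le> poly q' (sz x + poly q (sz x))"
      using t(2) poly_nat_mono order_trans by blast
    then show "\<exists>t. runs (Then p p') (encode x) (encode (g (f x))) t \<and>
        t \<le> poly (1 + q + pcompose q' ([:0, 1:] + q)) (sz x)"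
      using runs.seq[OF s(1) t(1)] s(2) by (intro exI conjI) (auto simp: poly_pcompose)
  qed
qed

lemma poly_time_Pair:
  assumes "poly_time f" "poly_time g"
  shows "poly_time (\<lambda>x. (f x, g x))"
proof -
  obtain p q where f: "\<And>x. \<exists>t. runs p (encode x) (encode (f x)) t \<and> t \<le> poly q (sz x)"
    using poly_timeE[OF assms(1)] by blast
  obtain p' q' where g: "\<And>x. \<exists>t. runs p' (encode x) (encode (g x)) t \<and> t \<le> poly q' (sz x)"
    using poly_timeE[OF assms(2)] by blast
  show ?thesis unfolding poly_time_def
  proof (rule exI[of _ "Fork p p'"], rule exI[of _ "[:1, 1:] + q + q'"], rule allI)
    fix x
    obtain s where s: "runs p (encode x) (encode (f x)) s" "s \<le> poly q (sz x)" using f by blast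
    obtain t where t: "runs p' (encode x) (encode (g x)) t" "t \<le> poly q' (sz x)" using g by blast
    show "\<exists>t. runs (Fork p p') (encode x) (encode (f x, g x)) t \<and> t \<le> poly ([:1, 1:] + q + q') (sz x)"
      using runs.fork[OF s(1) t(1)] s(2) t(2) by (intro exI conjI) auto
  qed
qed

lemma poly_time_comp2:
  assumes "poly_time (\<lambda>p. h (fst p) (snd p))" "poly_time f" "poly_time g"
  shows "poly_time (\<lambda>x. h (f x) (g x))"
  using poly_time_comp[OF poly_time_Pair[OF assms(2,3)] assms(1)] by simp

lemma poly_time_fst: "poly_time f \<Longrightarrow> poly_time (\<lambda>x. fst (f x))"
  by (rule poly_time_comp[of f fst], assumption, rule poly_time_prim[of Left _ "[:0,1:]"])
    (auto simp: encode_prod_def)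

lemma poly_time_snd: "poly_time f \<Longrightarrow> poly_time (\<lambda>x. snd (f x))"
  by (rule poly_time_comp[of f snd], assumption, rule poly_time_prim[of Right _ "[:0,1:]"])
    (auto simp: encode_prod_def)

text \<open>A list cell and a pair have the same code, so the pairing program works
  unchanged.\<close>

lemma poly_time_Cons: "poly_time f \<Longrightarrow> poly_time g \<Longrightarrow> poly_time (\<lambda>x. f x # g x)"
  using poly_time_Pair[of f g] unfolding poly_time_def by simp

lemma poly_time_if:
  assumes "poly_time b" "poly_time f" "poly_time g"
  shows "poly_time (\<lambda>x. if b x then f x else g x)"
proof -
  obtain p0 q0 where b: "\<And>x. \<exists>t. runs p0 (encode x) (encode (b x)) t \<and> t \<le> poly q0 (sz x)"
    using poly_timeE[OF assms(1)] by blast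
  obtain p q where f: "\<And>x. \<exists>t. runs p (encode x) (encode (f x)) t \<and> t \<le> poly q (sz x)"
    using poly_timeE[OF assms(2)] by blast
  obtain p' q' where g: "\<And>x. \<exists>t. runs p' (encode x) (encode (g x)) t \<and> t \<le> poly q' (sz x)"
    using poly_timeE[OF assms(3)] by blast
  show ?thesis unfolding poly_time_def
  proof (rule exI[of _ "Cond p0 p p'"], rule exI[of _ "[:1, 1:] + q0 + q + q'"], rule allI)
    fix x
    obtain r where r: "runs p0 (encode x) (encode (b x)) r" "r \<le> poly q0 (sz x)" using b by blast
    obtain s where s: "runs p (encode x) (encode (f x)) s" "s \<le> poly q (sz x)" using f by blast
    obtain t where t: "runs p' (encode x) (encode (g x)) t" "t \<le> poly q' (sz x)" using g by blast
    show "\<exists>t. runs (Cond p0 p p') (encode x) (encode (if b x then f x else g x)) t \<and>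
        t \<le> poly ([:1, 1:] + q0 + q + q') (sz x)"
    proof (cases "b x")
      case True
      with r have "runs p0 (encode x) (Atom 1) r" by (simp add: encode_bool_def)
      from runs.cond_true[OF this _ s(1), of p'] r(2) s(2) True show ?thesis
        by (intro exI conjI) auto
    next
      case False
      with r have "runs p0 (encode x) (Atom 0) r" by (simp add: encode_bool_def)
      from runs.cond_false[OF this t(1), of p] r(2) t(2) False show ?thesis
        by (intro exI conjI) auto
    qed
  qed
qed

lemma poly_time_nonempty: "poly_time f \<Longrightarrow> poly_time (\<lambda>x. f x \<noteq> [])"
proof (rule poly_time_comp[of f "\<lambda>xs. xs \<noteq> []"], assumption, rule poly_time_prim[of IsNode _ "[:2:]"])
  fix x :: "'b list"
  show "apply_prim IsNode (encode x) = encode (x \<noteq> [])" by (cases x) (auto simp: encode_bool_def)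
qed (auto simp: encode_bool_def floorlog_def)

text \<open>Programs have no variables, so the second branch has to rebuild its environment: it is
  run on x together with the value of f.\<close>

lemma poly_time_case_list:
  assumes "poly_time f" "poly_time g" "poly_time (\<lambda>p. h (fst p) (fst (snd p)) (snd (snd p)))"
  shows "poly_time (\<lambda>x. case f x of [] \<Rightarrow> g x | y # ys \<Rightarrow> h x y ys)"
proof -
  obtain p q where f: "\<And>x. \<exists>t. runs p (encode x) (encode (f x)) t \<and> t \<le> poly q (sz x)"
    using poly_timeE[OF assms(1)] by blast
  obtain p' q' where g: "\<And>x. \<exists>t. runs p' (encode x) (encode (g x)) t \<and> t \<le> poly q' (sz x)"
    using poly_timeE[OF assms(2)] by blast
  obtain ph qh where h: "\<And>x. \<exists>t. runs ph (encode x) (encode (h (fst x) (fst (snd x)) (snd (snd x)))) t \<and> t \<le> poly qh (sz x)"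
    using poly_timeE[OF assms(3)] by blast
  obtain pb qb where b: "\<And>x. \<exists>t. runs pb (encode x) (encode (f x \<noteq> [])) t \<and> t \<le> poly qb (sz x)"
    using poly_timeE[OF poly_time_nonempty[OF assms(1)]] by blast
  define Q where "Q = [:5, 4:] + qb + 2 * q + q' + pcompose qh ([:1, 2:] + q)"
  show ?thesis unfolding poly_time_def
  proof (rule exI[of _ "Cond pb (Then (Fork (Prim Ident) p) ph) p'"], rule exI[of _ Q], rule allI)
    fix x
    obtain r where r: "runs pb (encode x) (encode (f x \<noteq> [])) r" "r \<le> poly qb (sz x)" using b by blast
    obtain s where s: "runs p (encode x) (encode (f x)) s" "s \<le> poly q (sz x)" using f by blast
    obtain t where t: "runs p' (encode x) (encode (g x)) t" "t \<le> poly q' (sz x)" using g by blast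
    show "\<exists>t. runs (Cond pb (Then (Fork (Prim Ident) p) ph) p') (encode x)
        (encode (case f x of [] \<Rightarrow> g x | y # ys \<Rightarrow> h x y ys)) t \<and> t \<le> poly Q (sz x)"
    proof (cases "f x")
      case Nil
      with r have "runs pb (encode x) (Atom 0) r" by (simp add: encode_bool_def)
      from runs.cond_false[OF this t(1)] r(2) t(2) Nil show ?thesis
        by (intro exI conjI) (auto simp: Q_def)
    next
      case (Cons y ys)
      with r have "runs pb (encode x) (Atom 1) r" by (simp add: encode_bool_def)
      obtain u where u: "runs ph (encode (x, (y, ys))) (encode (h x y ys)) u" "u \<le> poly qh (sz (x, (y, ys)))"
        using h[of "(x, (y, ys))"] by auto
      \<comment> \<open>The code of a nonempty list is already the pair of its head and tail, so
        nothing has to be taken apart.\<close>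
      have e: "encode (y, ys) = encode (f x)" using Cons by simp
      have "sz (f x) \<le> sz x + poly q (sz x)" using runs_output_size[OF s(1)] s(2) by linarith
      then have "sz (x, (y, ys)) \<le> poly ([:1, 2:] + q) (sz x)" using e by auto
      then have u': "u \<le> poly (pcompose qh ([:1, 2:] + q)) (sz x)"
        using u(2) poly_nat_mono order_trans unfolding poly_pcompose by blast
      have fk: "runs (Fork (Prim Ident) p) (encode x) (Node (encode x) (encode (f x))) (Suc (sz x + (sz x + sz x) + s))"
        using runs.fork[OF runs.prim[of Ident] s(1)] by simp
      have "runs (Then (Fork (Prim Ident) p) ph) (encode x) (encode (h x y ys)) (Suc (Suc (sz x + (sz x + sz x) + s) + u))"
        by (rule runs.seq[OF fk]) (use u(1) e in simp)
      from runs.cond_true[OF \<open>runs pb (encode x) (Atom 1) r\<close> _ this] r(2) u' s(2) Cons show ?thesis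
        by (intro exI conjI) (auto simp: Q_def)
    qed
  qed
qed

section \<open>Bounded iteration and list operations\<close>

lemma sz_pos: "1 \<le> sz x" by (cases "encode x") auto

lemma length_le_sz: "length xs \<le> sz xs"
  by (induction xs) auto

lemma sz_drop: "sz (drop k xs) \<le> sz xs"
proof (induction xs arbitrary: k)
  case (Cons a xs)
  then show ?case by (cases k) (auto simp: le_SucI trans_le_add2)
qed simp

text \<open>Iterating a polynomial-time function can blow up its output, hence the bound on all partial results.\<close>

lemma poly_time_fold:
  assumes "poly_time f" "poly_time g" "poly_time (\<lambda>p. h (fst p) (fst (snd p)) (snd (snd p)))"
    and bd: "\<And>x k. sz (fold (h x) (take k (f x)) (g x)) \<le> poly qs (sz x)"
  shows "poly_time (\<lambda>x. fold (h x) (f x) (g x))"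
proof -
  \<comment> \<open>A loop state holds the fixed parameter, the unprocessed list and the
    accumulator.\<close>
  let ?body = "\<lambda>s. case fst (snd s) of [] \<Rightarrow> s | y # ys \<Rightarrow> (fst s, (ys, h (fst s) y (snd (snd s))))"
  let ?st = "\<lambda>x. (x, (f x, g x))"
  have "poly_time (\<lambda>s. h (fst (fst s)) (fst (snd s)) (snd (snd (fst s))))"
    using poly_time_comp[OF poly_time_Pair[OF poly_time_fst[OF poly_time_fst[OF poly_time_id]] poly_time_Pair[OF poly_time_fst[OF poly_time_snd[OF poly_time_id]]
      poly_time_snd[OF poly_time_snd[OF poly_time_fst[OF poly_time_id]]]]] assms(3)] by simp
  then have "poly_time ?body"
    by (intro poly_time_case_list poly_time_Pair poly_time_fst poly_time_snd poly_time_id)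
  then obtain p q where body: "\<And>x. \<exists>t. runs p (encode x) (encode (?body x)) t \<and> t \<le> poly q (sz x)"
    using poly_timeE by blast
  have "poly_time (\<lambda>s::'a \<times> 'b list \<times> 'c. fst (snd s) \<noteq> [])"
    by (intro poly_time_nonempty poly_time_fst poly_time_snd poly_time_id)
  then obtain pb qb where test: "\<And>x::'a \<times> 'b list \<times> 'c. \<exists>t. runs pb (encode x) (encode (fst (snd x) \<noteq> [])) t \<and> t \<le> poly qb (sz x)"
    using poly_timeE by blast
  obtain qf where qf: "\<And>x. sz (f x) \<le> poly qf (sz x)" using poly_time_size[OF assms(1)] by blast
  have "poly_time ?st" by (intro poly_time_Pair poly_time_id assms)
  then obtain pi qi where init: "\<And>x. \<exists>t. runs pi (encode x) (encode (?st x)) t \<and> t \<le> poly qi (sz x)"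
    using poly_timeE by blast
  have "poly_time (\<lambda>s::'a \<times> 'b list \<times> 'c. snd (snd s))" by (intro poly_time_snd poly_time_id)
  then obtain po qo where out: "\<And>x::'a \<times> 'b list \<times> 'c. \<exists>t. runs po (encode x) (encode (snd (snd x))) t \<and> t \<le> poly qo (sz x)"
    using poly_timeE by blast
  \<comment> \<open>With M bounding every state, each round costs at most the last factor;
    \<open>Suc (length ys)\<close> also counts the final failing test.\<close>
  have iter: "\<exists>t. runs (Loop pb p) (encode (c, (ys, a))) (encode (c, ([]::'b list, fold (h c) ys a))) t \<and>
      t \<le> Suc (length ys) * (1 + M + poly qb M + poly q M)"
    if "\<And>k. sz (c, (drop k ys, fold (h c) (take k ys) a)) \<le> M" for c ys a M
    using that
  proof (induction ys arbitrary: a)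
    case Nil
    have m: "sz (c, ([]::'b list, a)) \<le> M" using Nil[of 0] by simp
    obtain s where s: "runs pb (encode (c, ([]::'b list, a))) (Atom 0) s" "s \<le> poly qb (sz (c, ([]::'b list, a)))"
      using test[of "(c, ([], a))"] by (auto simp: encode_bool_def)
    have "s \<le> poly qb M" using s(2) m poly_nat_mono order_trans by blast
    then show ?case using runs.loop_stop[OF s(1), of p] m by (intro exI conjI) auto
  next
    case (Cons y ys)
    let ?x = "(c, (y # ys, a))"
    have m: "sz ?x \<le> M" using Cons.prems[of 0] by simp
    obtain s where s: "runs pb (encode ?x) (Atom 1) s" "s \<le> poly qb (sz ?x)"
      using test[of ?x] by (auto simp: encode_bool_def)
    obtain t where t: "runs p (encode ?x) (encode (c, (ys, h c y a))) t" "t \<le> poly q (sz ?x)"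
      using body[of ?x] by auto
    have "sz (c, (drop k ys, fold (h c) (take k ys) (h c y a))) \<le> M" for k
      using Cons.prems[of "Suc k"] by simp
    then obtain u where u: "runs (Loop pb p) (encode (c, (ys, h c y a))) (encode (c, ([]::'b list, fold (h c) ys (h c y a)))) u"
      "u \<le> Suc (length ys) * (1 + M + poly qb M + poly q M)"
      using Cons.IH by blast
    have "s \<le> poly qb M" "t \<le> poly q M" using s(2) t(2) m poly_nat_mono order_trans by blast+
    then show ?case
      using runs.loop_step[OF s(1) _ t(1) u(1)] u(2) m by (intro exI conjI) auto
  qed
  define M where "M = [:2, 1:] + qf + qs"
  define Q where "Q = [:2:] + qi + ((1 + qf) * (1 + M + pcompose qb M + pcompose q M) + pcompose qo M)"
  show ?thesis unfolding poly_time_def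
  proof (rule exI[of _ "Then pi (Then (Loop pb p) po)"], rule exI[of _ Q], rule allI)
    fix x :: 'a
    let ?n = "sz x"
    have bnd: "sz (x, (drop k (f x), fold (h x) (take k (f x)) (g x))) \<le> poly M ?n" for k
      using bd[of x k] qf[of x] sz_drop[of k "f x"] by (auto simp: M_def)
    obtain s where s: "runs pi (encode x) (encode (?st x)) s" "s \<le> poly qi ?n" using init by blast
    obtain t where t: "runs (Loop pb p) (encode (?st x)) (encode (x, ([]::'b list, fold (h x) (f x) (g x)))) t"
      "t \<le> Suc (length (f x)) * (1 + poly M ?n + poly qb (poly M ?n) + poly q (poly M ?n))"
      using iter[OF bnd] by blast
    obtain u where u: "runs po (encode (x, ([]::'b list, fold (h x) (f x) (g x)))) (encode (fold (h x) (f x) (g x))) u"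
      "u \<le> poly qo (sz (x, ([]::'b list, fold (h x) (f x) (g x))))"
      using out[of "(x, ([]::'b list, fold (h x) (f x) (g x)))"] by auto
    have "sz (x, ([]::'b list, fold (h x) (f x) (g x))) \<le> poly M ?n"
      using bnd[of "length (f x)"] by simp
    then have "u \<le> poly qo (poly M ?n)" using u(2) poly_nat_mono order_trans by blast
    moreover have "t \<le> (1 + poly qf ?n) * (1 + poly M ?n + poly qb (poly M ?n) + poly q (poly M ?n))"
      using length_le_sz[of "f x"] qf[of x] by (intro order_trans[OF t(2)] mult_right_mono) auto
    ultimately have "Suc (s + Suc (t + u)) \<le> poly Q ?n"
      using s(2) by (simp add: Q_def poly_pcompose)
    then show "\<exists>t. runs (Then pi (Then (Loop pb p) po)) (encode x) (encode (fold (h x) (f x) (g x))) t \<and> t \<le> poly Q ?n"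
      using runs.seq[OF s(1) runs.seq[OF t(1) u(1)]] by blast
  qed
qed

lemma sz_list: "sz xs = Suc (\<Sum>x\<leftarrow>xs. Suc (sz x))"
  by (induction xs) auto

text \<open>The \<open>Suc\<close> accounts for the two terminating atoms of size 1, of which
  concatenation keeps only one.\<close>

lemma sz_append: "Suc (sz (xs @ ys)) = sz xs + sz ys"
  by (induction xs) auto

lemma sz_rev: "sz (rev xs) = sz xs"
  by (simp add: sz_list rev_map[symmetric])

lemma sz_take: "sz (take k xs) \<le> sz xs"
  using sz_append[of "take k xs" "drop k xs"] sz_pos[of "drop k xs"] by simp

lemma sz_elem: "y \<in> set ys \<Longrightarrow> sz y < sz ys"
  by (induction ys) auto

lemma sz_elem_take: "y \<in> set (take k ys) \<Longrightarrow> sz y < sz ys"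
  using sz_elem set_take_subset[of k ys] by blast

lemma fold_Cons_map: "fold (\<lambda>y a. f y # a) ys a = rev (map f ys) @ a"
  by (induction ys arbitrary: a) auto

text \<open>A fold that prepends yields its result reversed; this program restores the order for
  \<open>map\<close>, \<open>filter\<close> and \<open>zip\<close>.\<close>

lemma poly_time_rev:
  assumes "poly_time f"
  shows "poly_time (\<lambda>x. rev (f x))"
proof -
  have "sz (fold Cons (take k xs) []) \<le> sz xs" for k and xs :: "'b list"
    using fold_Cons_map[of id "take k xs" "[]"] sz_take[of k xs] by (simp add: sz_rev)
  then have "poly_time (\<lambda>xs::'b list. fold Cons xs [])"
    by (intro poly_time_fold[where qs = "[:0,1:]"] poly_time_id poly_time_const poly_time_Cons poly_time_fst poly_time_snd) auto
  then have "poly_time (\<lambda>xs::'b list. rev xs)"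
    by (simp only: rev_conv_fold)
  then show ?thesis by (rule poly_time_comp[OF assms])
qed

lemma poly_time_append:
  assumes "poly_time f" "poly_time g"
  shows "poly_time (\<lambda>x. f x @ g x)"
proof -
  obtain qf where qf: "\<And>x. sz (f x) \<le> poly qf (sz x)" using poly_time_size[OF assms(1)] by blast
  obtain qg where qg: "\<And>x. sz (g x) \<le> poly qg (sz x)" using poly_time_size[OF assms(2)] by blast
  have "sz (fold Cons (take k (rev (f x))) (g x)) \<le> poly (qf + qg) (sz x)" for k x
    using fold_Cons_map[of id "take k (rev (f x))" "g x"] qf[of x] qg[of x] sz_rev[of "f x"]
      sz_take[of k "rev (f x)"] sz_append[of "rev (take k (rev (f x)))" "g x"]
    by (simp add: sz_rev)
  then have "poly_time (\<lambda>x. fold Cons (rev (f x)) (g x))"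
    by (intro poly_time_fold[where qs = "qf + qg"] poly_time_Cons poly_time_fst poly_time_snd poly_time_rev poly_time_id assms) auto
  then show ?thesis by (simp add: fold_Cons_rev)
qed

lemma poly_time_map:
  assumes "poly_time f" "poly_time (\<lambda>p. h (fst p) (snd p))"
  shows "poly_time (\<lambda>x. map (h x) (f x))"
proof -
  obtain qf where qf: "\<And>x. sz (f x) \<le> poly qf (sz x)" using poly_time_size[OF assms(1)] by blast
  obtain qh where qh: "\<And>p. sz (h (fst p) (snd p)) \<le> poly qh (sz p)" using poly_time_size[OF assms(2)] by blast
  define Q where "Q = 1 + qf * (1 + pcompose qh (1 + [:0, 1:] + qf))"
  have "sz (fold (\<lambda>y a. h x y # a) (take k (f x)) []) \<le> poly Q (sz x)" for k x
  proof -
    have "(\<Sum>y\<leftarrow>take k (f x). Suc (sz (h x y))) \<le>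
        (\<Sum>y\<leftarrow>take k (f x). Suc (poly qh (1 + sz x + poly qf (sz x))))"
    proof (intro sum_list_mono)
      fix y assume "y \<in> set (take k (f x))"
      then have "sz (x, y) \<le> 1 + sz x + poly qf (sz x)"
        using sz_elem_take[of y k "f x"] qf[of x] by simp
      then show "Suc (sz (h x y)) \<le> Suc (poly qh (1 + sz x + poly qf (sz x)))"
        using order_trans[OF qh poly_nat_mono, of "(x, y)"] by simp
    qed
    also have "\<dots> = length (take k (f x)) * Suc (poly qh (1 + sz x + poly qf (sz x)))"
      by (simp add: sum_list_triv)
    also have "\<dots> \<le> poly qf (sz x) * Suc (poly qh (1 + sz x + poly qf (sz x)))"
      using length_le_sz[of "f x"] qf[of x] by (intro mult_right_mono) auto
    finally show ?thesis
      by (simp add: fold_Cons_map sz_rev sz_list[of "map _ _"] comp_def Q_def poly_pcompose)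
  qed
  moreover have "poly_time (\<lambda>p. h (fst p) (fst (snd p)))"
    using poly_time_comp[OF poly_time_Pair[OF poly_time_fst[OF poly_time_id] poly_time_fst[OF poly_time_snd[OF poly_time_id]]] assms(2)] by simp
  ultimately have "poly_time (\<lambda>x. fold (\<lambda>y a. h x y # a) (f x) [])"
    by (intro poly_time_fold[where qs = Q] poly_time_Cons poly_time_snd poly_time_id poly_time_const assms)
  from poly_time_rev[OF this] show ?thesis by (simp add: fold_Cons_map)
qed

lemma fold_filter_Cons: "fold (\<lambda>y a. if P y then y # a else a) ys a = rev (filter P ys) @ a"
  by (induction ys arbitrary: a) auto

lemma sz_filter: "sz (filter P ys) \<le> sz ys"
  by (induction ys) auto

lemma poly_time_filter:
  assumes "poly_time f" "poly_time (\<lambda>p. P (fst p) (snd p))"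
  shows "poly_time (\<lambda>x. filter (P x) (f x))"
proof -
  obtain qf where qf: "\<And>x. sz (f x) \<le> poly qf (sz x)" using poly_time_size[OF assms(1)] by blast
  have "sz (fold (\<lambda>y a. if P x y then y # a else a) (take k (f x)) []) \<le> poly qf (sz x)" for k x
    unfolding fold_filter_Cons
    using sz_filter[of "P x" "take k (f x)"] sz_take[of k "f x"] qf[of x] by (simp add: sz_rev)
  moreover have "poly_time (\<lambda>p. P (fst p) (fst (snd p)))"
    using poly_time_comp[OF poly_time_Pair[OF poly_time_fst[OF poly_time_id] poly_time_fst[OF poly_time_snd[OF poly_time_id]]] assms(2)] by simp
  ultimately have "poly_time (\<lambda>x. fold (\<lambda>y a. if P x y then y # a else a) (f x) [])"
    by (intro poly_time_fold[where qs = qf] poly_time_if poly_time_Cons poly_time_fst poly_time_snd poly_time_id poly_time_const assms)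
  from poly_time_rev[OF this] show ?thesis by (simp add: fold_filter_Cons)
qed

lemma fold_append_concat: "fold (\<lambda>xs a. a @ xs) xss a = a @ concat xss"
  by (induction xss arbitrary: a) auto

lemma sz_concat: "sz (concat xss) \<le> sz xss"
proof (induction xss)
  case (Cons xs xss)
  then show ?case using sz_append[of xs "concat xss"] by simp
qed simp

lemma poly_time_concat:
  assumes "poly_time f"
  shows "poly_time (\<lambda>x. concat (f x))"
proof -
  have "sz (fold (\<lambda>xs a. a @ xs) (take k xss) []) \<le> poly [:0, 1:] (sz xss)" for k and xss :: "'b list list"
    unfolding fold_append_concat using sz_concat[of "take k xss"] sz_take[of k xss] by simp
  then have "poly_time (\<lambda>xss::'b list list. fold (\<lambda>xs a. a @ xs) xss [])"
    by (intro poly_time_fold poly_time_append poly_time_fst poly_time_snd poly_time_id poly_time_const)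
  from poly_time_comp[OF assms this] show ?thesis by (simp add: fold_append_concat)
qed

lemma sz_bool: "sz (b::bool) \<le> 2"
  by (simp add: encode_bool_def floorlog_def)

lemma poly_time_not: "poly_time b \<Longrightarrow> poly_time (\<lambda>x. \<not> b x)"
  using poly_time_if[of b "\<lambda>x. False" "\<lambda>x. True"] by (simp add: if_bool_eq_conj)

lemma poly_time_conj:
  assumes "poly_time b" "poly_time c"
  shows "poly_time (\<lambda>x. b x \<and> c x)"
proof -
  have "(\<lambda>x. b x \<and> c x) = (\<lambda>x. if b x then c x else False)" by auto
  then show ?thesis using poly_time_if[OF assms poly_time_const[of False]] by (simp only:)
qed

lemma poly_time_disj: "poly_time b \<Longrightarrow> poly_time c \<Longrightarrow> poly_time (\<lambda>x. b x \<or> c x)"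
  using poly_time_not[OF poly_time_conj[OF poly_time_not poly_time_not], of b c] by simp

lemma poly_time_imp: "poly_time b \<Longrightarrow> poly_time c \<Longrightarrow> poly_time (\<lambda>x. b x \<longrightarrow> c x)"
  using poly_time_disj[OF poly_time_not, of b c] by (simp only: imp_conv_disj)

lemma fold_list_ex: "fold (\<lambda>y b. P y \<or> b) ys b = (list_ex P ys \<or> b)"
  by (induction ys arbitrary: b) auto

lemma poly_time_list_ex:
  assumes "poly_time f" "poly_time (\<lambda>p. P (fst p) (snd p))"
  shows "poly_time (\<lambda>x. list_ex (P x) (f x))"
proof -
  have *: "poly_time (\<lambda>p. P (fst p) (fst (snd p)))"
    using poly_time_comp[OF poly_time_Pair[OF poly_time_fst[OF poly_time_id] poly_time_fst[OF poly_time_snd[OF poly_time_id]]] assms(2)] by simp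
  have "sz (fold (\<lambda>y b. P x y \<or> b) (take k (f x)) False) \<le> poly [:2:] (sz x)" for k x
    using sz_bool by simp
  then have "poly_time (\<lambda>x. fold (\<lambda>y b. P x y \<or> b) (f x) False)"
    by (intro poly_time_fold[where h = "\<lambda>x y b. P x y \<or> b"] poly_time_disj[OF *] poly_time_snd poly_time_id poly_time_const assms)
  then show ?thesis by (simp add: fold_list_ex)
qed

lemma poly_time_list_all:
  assumes "poly_time f" "poly_time (\<lambda>p. P (fst p) (snd p))"
  shows "poly_time (\<lambda>x. list_all (P x) (f x))"
proof -
  have "poly_time (\<lambda>x. \<not> list_ex (\<lambda>y. \<not> P x y) (f x))"
    by (intro poly_time_not poly_time_list_ex assms)
  then show ?thesis by (simp add: list_ex_iff list_all_iff)
qed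

text \<open>\<open>fold\<close> traverses one list only, so the second list is carried in the
  accumulator and consumed in step.\<close>

lemma fold_zip:
  "fold (\<lambda>x s. case fst s of [] \<Rightarrow> s | y # ys \<Rightarrow> (ys, (x, y) # snd s)) xs (ys, a) =
    (drop (length xs) ys, rev (zip xs ys) @ a)"
proof (induction xs arbitrary: ys a)
  case (Cons x xs)
  then show ?case by (cases ys) auto
qed auto

lemma sz_zip: "sz (zip xs ys) \<le> sz xs + sz ys"
proof (induction xs arbitrary: ys)
  case (Cons x xs)
  show ?case
  proof (cases ys)
    case (Cons y ys')
    then show ?thesis using Cons.IH[of ys'] by simp
  qed simp
qed simp

lemma poly_time_zip:
  assumes "poly_time f" "poly_time g"
  shows "poly_time (\<lambda>x. zip (f x) (g x))"
proof -
  obtain qf where qf: "\<And>x. sz (f x) \<le> poly qf (sz x)" using poly_time_size[OF assms(1)] by blast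
  obtain qg where qg: "\<And>x. sz (g x) \<le> poly qg (sz x)" using poly_time_size[OF assms(2)] by blast
  have "sz (fold (\<lambda>x s. case fst s of [] \<Rightarrow> s | y # ys \<Rightarrow> (ys, (x, y) # snd s)) (take k (f x)) (g x, []))
      \<le> poly (1 + qf + 2 * qg) (sz x)" for k x
    unfolding fold_zip
    using qf[of x] qg[of x] sz_take[of k "f x"] sz_zip[of "take k (f x)" "g x"]
      sz_drop[of "length (take k (f x))" "g x"] by (simp add: sz_rev)
  then have "poly_time (\<lambda>x. fold (\<lambda>x s. case fst s of [] \<Rightarrow> s | y # ys \<Rightarrow> (ys, (x, y) # snd s)) (f x) (g x, []))"
    by (intro poly_time_fold poly_time_case_list poly_time_Pair poly_time_Cons poly_time_fst poly_time_snd poly_time_id poly_time_const assms)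
  from poly_time_rev[OF poly_time_snd[OF this]] show ?thesis by (simp add: fold_zip)
qed

section \<open>Bit lengths of integers\<close>

abbreviation bits :: "int \<Rightarrow> nat" where "bits k \<equiv> floorlog 2 (nat \<bar>k\<bar>)"

lemma bits_le_iff: "bits k \<le> b \<longleftrightarrow> \<bar>k\<bar> < 2 ^ b"
  by (simp add: floorlog_le_iff nat_less_iff)

lemma abs_less_bits: "\<bar>k\<bar> < 2 ^ bits k"
  using bits_le_iff by blast

lemma bits_mult: "bits (j * k) \<le> bits j + bits k"
proof -
  have "\<bar>j\<bar> * \<bar>k\<bar> < 2 ^ bits j * 2 ^ bits k"
    by (intro mult_strict_mono' abs_less_bits) auto
  then show ?thesis unfolding bits_le_iff by (simp add: abs_mult power_add)
qed

lemma bits_add: "bits (j + k) \<le> Suc (max (bits j) (bits k))"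
proof -
  have "\<bar>j\<bar> < 2 ^ max (bits j) (bits k)" "\<bar>k\<bar> < 2 ^ max (bits j) (bits k)"
    by (simp_all add: bits_le_iff[symmetric])
  then show ?thesis unfolding bits_le_iff using abs_triangle_ineq[of j k] by simp
qed

lemma bits_diff: "bits (j - k) \<le> Suc (max (bits j) (bits k))"
  using bits_add[of j "- k"] by simp

text \<open>The operand pair has size \<open>3 + bits j + bits k\<close>, so the second premise
  makes the identity polynomial a bound for the output.\<close>

lemma poly_time_int_op:
  assumes "\<And>j k. apply_prim f (Node (Atom j) (Atom k)) = encode (g j k :: 'b::encodable)"
    and "\<And>j k. sz (g j k) \<le> 2 + bits j + bits k"
    and "poly_time F" "poly_time G"
  shows "poly_time (\<lambda>x. g (F x) (G x))"
proof (rule poly_time_comp2[OF _ assms(3,4)])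
  show "poly_time (\<lambda>p. g (fst p) (snd p))"
    by (rule poly_time_prim[of f _ "[:0, 1:]"])
      (use assms(2) in \<open>auto simp: encode_prod_def assms(1) intro!: order_trans[OF assms(2)]\<close>)
qed

lemma poly_time_plus: "poly_time f \<Longrightarrow> poly_time g \<Longrightarrow> poly_time (\<lambda>x. f x + g x :: int)"
proof (rule poly_time_int_op[of Plus "(+)"])
  show "sz (j + k) \<le> 2 + bits j + bits k" for j k :: int
    using bits_add[of j k] by (simp add: max_def split: if_splits)
qed simp_all

lemma poly_time_minus: "poly_time f \<Longrightarrow> poly_time g \<Longrightarrow> poly_time (\<lambda>x. f x - g x :: int)"
proof (rule poly_time_int_op[of Minus "(-)"])
  show "sz (j - k) \<le> 2 + bits j + bits k" for j k :: int
    using bits_diff[of j k] by (simp add: max_def split: if_splits)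
qed simp_all

lemma poly_time_times: "poly_time f \<Longrightarrow> poly_time g \<Longrightarrow> poly_time (\<lambda>x. f x * g x :: int)"
  by (rule poly_time_int_op[of Times "(*)"]) (simp_all add: bits_mult le_SucI)

lemma poly_time_le: "poly_time f \<Longrightarrow> poly_time g \<Longrightarrow> poly_time (\<lambda>x. (f x :: int) \<le> g x)"
  by (rule poly_time_int_op[of Leq "(\<le>)"]) (auto simp: encode_bool_def floorlog_def)

lemma poly_time_less: "poly_time f \<Longrightarrow> poly_time g \<Longrightarrow> poly_time (\<lambda>x. (f x :: int) < g x)"
  using poly_time_not[OF poly_time_le, of g f] by (simp add: not_le)

text \<open>With these rules the shape of a definition is its running-time proof. Folds are left out
  on purpose: they need a bound on their partial results.\<close>

lemmas poly_time_intros = poly_time_id poly_time_const poly_time_Pair poly_time_fst poly_time_snd poly_time_Cons poly_time_if poly_time_case_list poly_time_rev poly_time_append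
  poly_time_map poly_time_filter poly_time_concat poly_time_not poly_time_conj poly_time_disj poly_time_imp poly_time_list_ex poly_time_list_all poly_time_zip
  poly_time_plus poly_time_minus poly_time_times poly_time_le poly_time_less

section \<open>Arithmetic of fractions\<close>

definition frac_add :: "frac \<Rightarrow> frac \<Rightarrow> frac" where
  "frac_add x y = (fst x * snd y + fst y * snd x, snd x * snd y)"

definition frac_sub :: "frac \<Rightarrow> frac \<Rightarrow> frac" where
  "frac_sub x y = (fst x * snd y - fst y * snd x, snd x * snd y)"

definition frac_mult :: "frac \<Rightarrow> frac \<Rightarrow> frac" where
  "frac_mult x y = (fst x * fst y, snd x * snd y)"

text \<open>The sign cases keep the denominator positive, with negation expressed through the
  available subtraction; the last case mirrors division by 0 on the reals.\<close>

definition frac_div :: "frac \<Rightarrow> frac \<Rightarrow> frac" where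
  "frac_div x y =
     (if 0 < fst y then (fst x * snd y, snd x * fst y)
      else if fst y < 0 then (0 - fst x * snd y, 0 - snd x * fst y)
      else (0, 1))"

definition frac_le :: "frac \<Rightarrow> frac \<Rightarrow> bool" where
  "frac_le x y \<longleftrightarrow> fst x * snd y \<le> fst y * snd x"

definition frac_less :: "frac \<Rightarrow> frac \<Rightarrow> bool" where
  "frac_less x y \<longleftrightarrow> fst x * snd y < fst y * snd x"

definition frac_max :: "frac \<Rightarrow> frac \<Rightarrow> frac" where
  "frac_max x y = (if frac_le x y then y else x)"

definition frac_sum :: "frac list \<Rightarrow> frac" where
  "frac_sum xs = fold frac_add xs (0, 1)"

definition frac_prod :: "frac list \<Rightarrow> frac" where
  "frac_prod xs = fold frac_mult xs (1, 1)"

text \<open>The start value is the clip of reservation values at 0.\<close>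

definition frac_maximum :: "frac list \<Rightarrow> frac" where
  "frac_maximum xs = fold frac_max xs (0, 1)"

text \<open>Values are compared, because different unreduced fractions can represent the same
  number.\<close>

definition frac_insert_new :: "frac \<Rightarrow> frac list \<Rightarrow> frac list" where
  "frac_insert_new y ys = (if list_ex (\<lambda>z. frac_le z y \<and> frac_le y z) ys then ys else y # ys)"

definition frac_dedup :: "frac list \<Rightarrow> frac list" where
  "frac_dedup xs = fold frac_insert_new xs []"

lemma poly_time_frac_ops:
  "poly_time f \<Longrightarrow> poly_time g \<Longrightarrow> poly_time (\<lambda>x. frac_add (f x) (g x))"
  "poly_time f \<Longrightarrow> poly_time g \<Longrightarrow> poly_time (\<lambda>x. frac_sub (f x) (g x))"
  "poly_time f \<Longrightarrow> poly_time g \<Longrightarrow> poly_time (\<lambda>x. frac_mult (f x) (g x))"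
  "poly_time f \<Longrightarrow> poly_time g \<Longrightarrow> poly_time (\<lambda>x. frac_div (f x) (g x))"
  "poly_time f \<Longrightarrow> poly_time g \<Longrightarrow> poly_time (\<lambda>x. frac_le (f x) (g x))"
  "poly_time f \<Longrightarrow> poly_time g \<Longrightarrow> poly_time (\<lambda>x. frac_less (f x) (g x))"
  "poly_time f \<Longrightarrow> poly_time g \<Longrightarrow> poly_time (\<lambda>x. frac_max (f x) (g x))"
  unfolding frac_add_def frac_sub_def frac_mult_def frac_div_def frac_le_def frac_less_def frac_max_def
  by (intro poly_time_intros; assumption)+

lemma poly_time_frac_insert_new: "poly_time (\<lambda>p. frac_insert_new (fst p) (snd p))"
  unfolding frac_insert_new_def by (intro poly_time_intros poly_time_frac_ops)

text \<open>Unlike \<^const>\<open>vsize\<close>, this measure is subadditive with constant \<open>1\<close> under both sums and products, so that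
  iterated sums and products of unreduced fractions keep polynomial size.\<close>

definition frac_bits :: "frac \<Rightarrow> nat" where
  "frac_bits q = Suc (max (bits (fst q)) (bits (snd q)))"

lemma frac_bits_le_sz: "frac_bits q \<le> sz q"
  by (simp add: frac_bits_def encode_prod_def)

lemma sz_le_frac_bits: "sz q \<le> 2 * frac_bits q + 1"
  by (simp add: frac_bits_def encode_prod_def)

lemma frac_bits_le_iff: "frac_bits q \<le> Suc b \<longleftrightarrow> bits (fst q) \<le> b \<and> bits (snd q) \<le> b"
  by (auto simp: frac_bits_def)

lemma frac_bits_mult: "frac_bits (frac_mult x y) \<le> frac_bits x + frac_bits y"
proof -
  obtain a b where ab: "frac_bits x = Suc a" "frac_bits y = Suc b" by (simp add: frac_bits_def)
  have "bits (fst x) \<le> a" "bits (snd x) \<le> a" "bits (fst y) \<le> b" "bits (snd y) \<le> b"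
    using frac_bits_le_iff[of x a] frac_bits_le_iff[of y b] ab by auto
  then have "bits (fst x * fst y) \<le> a + b" "bits (snd x * snd y) \<le> a + b"
    by (meson add_mono bits_mult order_trans)+
  then have "frac_bits (frac_mult x y) \<le> Suc (a + b)"
    by (simp add: frac_bits_le_iff frac_mult_def)
  then show ?thesis using ab by simp
qed

text \<open>The numerator adds two products of at most a + b bits and may gain a carry bit; the
  extra unit in the measure of each summand pays for it.\<close>

lemma frac_bits_add: "frac_bits (frac_add x y) \<le> frac_bits x + frac_bits y"
proof -
  obtain a b where ab: "frac_bits x = Suc a" "frac_bits y = Suc b" by (simp add: frac_bits_def)
  have "bits (fst x) \<le> a" "bits (snd x) \<le> a" "bits (fst y) \<le> b" "bits (snd y) \<le> b"
    using frac_bits_le_iff[of x a] frac_bits_le_iff[of y b] ab by auto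
  then have "bits (fst x * snd y) \<le> a + b" "bits (snd x * fst y) \<le> a + b" "bits (snd x * snd y) \<le> a + b"
    by (meson add_mono bits_mult order_trans)+
  moreover from this have "bits (fst x * snd y + snd x * fst y) \<le> Suc (a + b)"
    by (meson bits_add le_trans max.boundedI Suc_le_mono)
  ultimately have "frac_bits (frac_add x y) \<le> Suc (Suc (a + b))"
    by (simp add: frac_bits_le_iff frac_add_def mult.commute)
  then show ?thesis using ab by simp
qed

lemma frac_bits_fold:
  assumes "\<And>x y. frac_bits (f x y) \<le> frac_bits x + frac_bits y"
  shows "sz (fold f (take k xs) a) \<le> 2 * (sz xs + frac_bits a) + 1"
proof -
  have "frac_bits (fold f ys a) \<le> sz ys + frac_bits a" for ys
  proof (induction ys arbitrary: a)
    case (Cons y ys)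
    show ?case using Cons[of "f y a"] assms[of y a] frac_bits_le_sz[of y] by simp
  qed simp
  from this[of "take k xs"] show ?thesis
    using sz_le_frac_bits[of "fold f (take k xs) a"] sz_take[of k xs] by simp
qed

lemma poly_time_frac_sum: "poly_time frac_sum"
proof -
  have "sz (fold frac_add (take k xs) (0, 1)) \<le> poly [:2 * frac_bits (0, 1) + 1, 2:] (sz xs)" for k xs
    using frac_bits_fold[OF frac_bits_add, of k xs "(0, 1)"] by simp
  then show ?thesis
    unfolding frac_sum_def[abs_def]
    by (intro poly_time_fold[where h = "\<lambda>_. frac_add"] poly_time_frac_ops poly_time_intros)
qed

lemma poly_time_frac_prod: "poly_time frac_prod"
proof -
  have "sz (fold frac_mult (take k xs) (1, 1)) \<le> poly [:2 * frac_bits (1, 1) + 1, 2:] (sz xs)" for k xs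
    using frac_bits_fold[OF frac_bits_mult, of k xs "(1, 1)"] by simp
  then show ?thesis
    unfolding frac_prod_def[abs_def]
    by (intro poly_time_fold[where h = "\<lambda>_. frac_mult"] poly_time_frac_ops poly_time_intros)
qed

lemma poly_time_frac_maximum: "poly_time frac_maximum"
proof -
  have *: "sz (fold frac_max ys a) \<le> sz ys + sz a" for ys a
  proof (induction ys arbitrary: a)
    case (Cons y ys)
    show ?case using Cons[of "frac_max y a"] by (auto simp: frac_max_def)
  qed simp
  have "sz (fold frac_max (take k xs) (0, 1)) \<le> poly [:sz (0::int, 1::int), 1:] (sz xs)" for k xs
    using order_trans[OF *[of "take k xs" "(0, 1)"] add_right_mono[OF sz_take]] by simp
  then show ?thesis
    unfolding frac_maximum_def[abs_def]
    by (intro poly_time_fold[where h = "\<lambda>_. frac_max"] poly_time_frac_ops poly_time_intros)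
qed

lemma poly_time_frac_dedup: "poly_time frac_dedup"
proof -
  have *: "sz (fold frac_insert_new ys a) \<le> sz ys + sz a" for ys a
  proof (induction ys arbitrary: a)
    case (Cons y ys)
    show ?case using Cons[of "frac_insert_new y a"] by (auto simp: frac_insert_new_def split: if_splits)
  qed simp
  have "sz (fold frac_insert_new (take k xs) []) \<le> poly [:1, 1:] (sz xs)" for k xs
    using order_trans[OF *[of "take k xs" "[]"] add_right_mono[OF sz_take]] by simp
  then show ?thesis
    unfolding frac_dedup_def[abs_def]
    by (intro poly_time_fold[where h = "\<lambda>_. frac_insert_new"] poly_time_comp2[OF poly_time_frac_insert_new] poly_time_intros)
qed

lemmas poly_time_frac_intros = poly_time_frac_ops poly_time_comp[OF _ poly_time_frac_sum] poly_time_comp[OF _ poly_time_frac_prod]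
  poly_time_comp[OF _ poly_time_frac_maximum] poly_time_comp[OF _ poly_time_frac_dedup]

section \<open>The algorithm\<close>

text \<open>Every function is defined over the reals, for its correctness, and over fractions, for its running
  time. The two versions are related by transfer. An action is its cost with the list of pairs of
  probability and reward.\<close>

type_synonym 'a act = "'a \<times> ('a \<times> 'a) list"

definition tail_prob :: "(real \<times> real) list \<Rightarrow> real \<Rightarrow> real" where
  "tail_prob prs r = sum_list (map (\<lambda>x. if r \<le> snd x then fst x else 0) prs)"

definition frac_tail_prob :: "(frac \<times> frac) list \<Rightarrow> frac \<Rightarrow> frac" where
  "frac_tail_prob prs r = frac_sum (map (\<lambda>x. if frac_le r (snd x) then fst x else (0, 1)) prs)"

definition tail_reward :: "(real \<times> real) list \<Rightarrow> real \<Rightarrow> real" where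
  "tail_reward prs r = sum_list (map (\<lambda>x. if r \<le> snd x then fst x * snd x else 0) prs)"

definition frac_tail_reward :: "(frac \<times> frac) list \<Rightarrow> frac \<Rightarrow> frac" where
  "frac_tail_reward prs r =
     frac_sum (map (\<lambda>x. if frac_le r (snd x) then frac_mult (fst x) (snd x) else (0, 1)) prs)"

text \<open>\<open>E max(0, \<alpha> r - s)\<close> is the maximum over \<open>\<rho>\<close> of the contributions of the rewards \<open>\<ge> \<rho>\<close>. So it is at most
  the cost iff \<open>s\<close> is above all of the following lines, given by slope and negated intercept.\<close>

definition act_lines :: "real act \<Rightarrow> (real \<times> real) list" where
  "act_lines a = map (\<lambda>x. (tail_reward (snd a) (snd x) / tail_prob (snd a) (snd x),
       fst a / tail_prob (snd a) (snd x)))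
     (filter (\<lambda>x. 0 < tail_prob (snd a) (snd x)) (snd a))"

definition frac_act_lines :: "frac act \<Rightarrow> (frac \<times> frac) list" where
  "frac_act_lines a = map (\<lambda>x. (frac_div (frac_tail_reward (snd a) (snd x)) (frac_tail_prob (snd a) (snd x)),
       frac_div (fst a) (frac_tail_prob (snd a) (snd x))))
     (filter (\<lambda>x. frac_less (0, 1) (frac_tail_prob (snd a) (snd x))) (snd a))"

text \<open>Weitzman's reservation value, clipped at 0, in closed form; no equation has to be solved
  for it.\<close>

definition act_index :: "real \<Rightarrow> real act \<Rightarrow> real" where
  "act_index \<alpha> a = fold max (map (\<lambda>l. \<alpha> * fst l - snd l) (act_lines a)) 0"

definition frac_act_index :: "frac \<Rightarrow> frac act \<Rightarrow> frac" where
  "frac_act_index \<alpha> a =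
     frac_maximum (map (\<lambda>l. frac_sub (frac_mult \<alpha> (fst l)) (snd l)) (frac_act_lines a))"

text \<open>Distribution function at y of the minimum of the index and \<alpha> times the random
  reward, which is at most y for certain once the index is.\<close>

definition prob_le :: "real \<Rightarrow> real \<Rightarrow> real act \<Rightarrow> real" where
  "prob_le \<alpha> y a = (if act_index \<alpha> a \<le> y then 1
     else sum_list (map (\<lambda>x. if \<alpha> * snd x \<le> y then fst x else 0) (snd a)))"

definition frac_prob_le :: "frac \<Rightarrow> frac \<Rightarrow> frac act \<Rightarrow> frac" where
  "frac_prob_le \<alpha> y a = (if frac_le (frac_act_index \<alpha> a) y then (1, 1)
     else frac_sum (map (\<lambda>x. if frac_le (frac_mult \<alpha> (snd x)) y then fst x else (0, 1)) (snd a)))"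

definition prob_less :: "real \<Rightarrow> real \<Rightarrow> real act \<Rightarrow> real" where
  "prob_less \<alpha> y a = (if act_index \<alpha> a < y then 1
     else sum_list (map (\<lambda>x. if \<alpha> * snd x < y then fst x else 0) (snd a)))"

definition frac_prob_less :: "frac \<Rightarrow> frac \<Rightarrow> frac act \<Rightarrow> frac" where
  "frac_prob_less \<alpha> y a = (if frac_less (frac_act_index \<alpha> a) y then (1, 1)
     else frac_sum (map (\<lambda>x. if frac_less (frac_mult \<alpha> (snd x)) y then fst x else (0, 1)) (snd a)))"

text \<open>Two inequalities replace \<open>=\<close>, because equality of fractions does not
  correspond to equality of reals under transfer.\<close>

definition dedup :: "real list \<Rightarrow> real list" where
  "dedup xs = fold (\<lambda>y ys. if list_ex (\<lambda>z. z \<le> y \<and> y \<le> z) ys then ys else y # ys) xs []"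

text \<open>Expectation of the maximum in Weitzman's formula as a sum over its possible values y,
  each weighted by Pr(\<le> y) - Pr(< y). Independence makes both probabilities products; a repeated
  value would count twice, hence \<open>dedup\<close>.\<close>

definition opt_value :: "real list \<Rightarrow> real act list \<Rightarrow> real \<Rightarrow> real" where
  "opt_value rs as \<alpha> = sum_list (map
     (\<lambda>y. y * (prod_list (map (prob_le \<alpha> y) as) - prod_list (map (prob_less \<alpha> y) as)))
     (dedup (map (\<lambda>r. \<alpha> * r) rs @ map (act_index \<alpha>) as)))"

definition frac_opt_value :: "frac list \<Rightarrow> frac act list \<Rightarrow> frac \<Rightarrow> frac" where
  "frac_opt_value rs as \<alpha> = frac_sum (map
     (\<lambda>y. frac_mult y (frac_sub (frac_prod (map (frac_prob_le \<alpha> y) as)) (frac_prod (map (frac_prob_less \<alpha> y) as))))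
     (frac_dedup (map (\<lambda>r. frac_mult \<alpha> r) rs @ map (frac_act_index \<alpha>) as)))"

definition all_lines :: "real list \<Rightarrow> real act list \<Rightarrow> (real \<times> real) list" where
  "all_lines rs as = map (\<lambda>r. (r, 0)) rs @ concat (map act_lines as)"

definition frac_all_lines :: "frac list \<Rightarrow> frac act list \<Rightarrow> (frac \<times> frac) list" where
  "frac_all_lines rs as = map (\<lambda>r. (r, (0, 1))) rs @ concat (map frac_act_lines as)"

text \<open>A pair \<open>(a, b)\<close> stands for the line \<alpha> a - b. Ordering two lines by
  slope visits each pair once and excludes division by 0.\<close>

definition crossings :: "(real \<times> real) list \<Rightarrow> real list" where
  "crossings ls = concat (map (\<lambda>l. map (\<lambda>k. (snd l - snd k) / (fst l - fst k))
     (filter (\<lambda>k. fst k < fst l) ls)) ls)"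

definition frac_crossings :: "(frac \<times> frac) list \<Rightarrow> frac list" where
  "frac_crossings ls = concat (map (\<lambda>l. map (\<lambda>k. frac_div (frac_sub (snd l) (snd k)) (frac_sub (fst l) (fst k)))
     (filter (\<lambda>k. frac_less (fst k) (fst l)) ls)) ls)"

text \<open>The points \<open>0\<close> and \<open>2\<close> only ensure that each \<open>\<alpha>\<close> in \<open>(0, 1]\<close> has neighbours on both sides.\<close>

definition points :: "real list \<Rightarrow> real act list \<Rightarrow> real list" where
  "points rs as = 0 # 2 # filter (\<lambda>\<alpha>. 0 < \<alpha>) (crossings (all_lines rs as))"

definition frac_points :: "frac list \<Rightarrow> frac act list \<Rightarrow> frac list" where
  "frac_points rs as = (0, 1) # (2, 1) # filter (\<lambda>\<alpha>. frac_less (0, 1) \<alpha>) (frac_crossings (frac_all_lines rs as))"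

definition below_chords :: "(real \<times> real) list \<Rightarrow> real \<times> real \<Rightarrow> bool" where
  "below_chords g v \<longleftrightarrow> list_all (\<lambda>a. list_all (\<lambda>b. fst a < fst v \<and> fst v < fst b \<longrightarrow>
     (fst b - fst a) * snd v < (fst b - fst v) * snd a + (fst v - fst a) * snd b) g) g"

definition frac_below_chords :: "(frac \<times> frac) list \<Rightarrow> frac \<times> frac \<Rightarrow> bool" where
  "frac_below_chords g v \<longleftrightarrow> list_all (\<lambda>a. list_all (\<lambda>b. frac_less (fst a) (fst v) \<and> frac_less (fst v) (fst b) \<longrightarrow>
     frac_less (frac_mult (frac_sub (fst b) (fst a)) (snd v))
       (frac_add (frac_mult (frac_sub (fst b) (fst v)) (snd a)) (frac_mult (frac_sub (fst v) (fst a)) (snd b)))) g) g"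

definition kinks_of_graph :: "(real \<times> real) list \<Rightarrow> real list" where
  "kinks_of_graph g = map fst (filter (\<lambda>v. 0 < fst v \<and> fst v \<le> 1 \<and> below_chords g v) g)"

definition frac_kinks_of_graph :: "(frac \<times> frac) list \<Rightarrow> frac list" where
  "frac_kinks_of_graph g =
     map fst (filter (\<lambda>v. frac_less (0, 1) (fst v) \<and> frac_le (fst v) (1, 1) \<and> frac_below_chords g v) g)"

definition kinks :: "real list \<Rightarrow> real act list \<Rightarrow> real list" where
  "kinks rs as = kinks_of_graph (map (\<lambda>\<alpha>. (\<alpha>, opt_value rs as \<alpha>)) (points rs as))"

definition frac_kinks :: "frac list \<Rightarrow> frac act list \<Rightarrow> frac list" where
  "frac_kinks rs as = frac_kinks_of_graph (map (\<lambda>\<alpha>. (\<alpha>, frac_opt_value rs as \<alpha>)) (frac_points rs as))"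

definition acts_of :: "'a list \<Rightarrow> 'a list \<Rightarrow> 'a list list \<Rightarrow> 'a act list" where
  "acts_of cs rs ps = map (\<lambda>x. (fst x, zip (snd x) rs)) (zip cs ps)"

definition solve_critical :: "input \<Rightarrow> frac list" where
  "solve_critical x = frac_kinks (fst (snd x)) (acts_of (fst x) (fst (snd x)) (snd (snd x)))"

lemma poly_time_comp3:
  assumes "poly_time (\<lambda>p. h (fst p) (fst (snd p)) (snd (snd p)))" "poly_time f" "poly_time g" "poly_time k"
  shows "poly_time (\<lambda>x. h (f x) (g x) (k x))"
  using poly_time_comp[OF poly_time_Pair[OF assms(2) poly_time_Pair[OF assms(3,4)]] assms(1)] by simp

lemma poly_time_frac_tail_prob: "poly_time (\<lambda>p. frac_tail_prob (fst p) (snd p))"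
  unfolding frac_tail_prob_def by (intro poly_time_intros poly_time_frac_intros)

lemma poly_time_frac_tail_reward: "poly_time (\<lambda>p. frac_tail_reward (fst p) (snd p))"
  unfolding frac_tail_reward_def by (intro poly_time_intros poly_time_frac_intros)

lemma poly_time_frac_act_lines: "poly_time frac_act_lines"
  unfolding frac_act_lines_def[abs_def]
  by (intro poly_time_intros poly_time_frac_intros poly_time_comp2[OF poly_time_frac_tail_prob] poly_time_comp2[OF poly_time_frac_tail_reward])

lemma poly_time_frac_act_index: "poly_time (\<lambda>p. frac_act_index (fst p) (snd p))"
  unfolding frac_act_index_def
  by (intro poly_time_intros poly_time_frac_intros poly_time_comp[OF _ poly_time_frac_act_lines])

lemma poly_time_frac_prob_le: "poly_time (\<lambda>p. frac_prob_le (fst p) (fst (snd p)) (snd (snd p)))"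
  unfolding frac_prob_le_def
  by (intro poly_time_intros poly_time_frac_intros poly_time_comp2[OF poly_time_frac_act_index])

lemma poly_time_frac_prob_less: "poly_time (\<lambda>p. frac_prob_less (fst p) (fst (snd p)) (snd (snd p)))"
  unfolding frac_prob_less_def
  by (intro poly_time_intros poly_time_frac_intros poly_time_comp2[OF poly_time_frac_act_index])

lemma poly_time_frac_opt_value: "poly_time (\<lambda>p. frac_opt_value (fst p) (fst (snd p)) (snd (snd p)))"
  unfolding frac_opt_value_def
  by (intro poly_time_intros poly_time_frac_intros poly_time_comp3[OF poly_time_frac_prob_le] poly_time_comp3[OF poly_time_frac_prob_less]
    poly_time_comp2[OF poly_time_frac_act_index])

lemma poly_time_frac_all_lines: "poly_time (\<lambda>p. frac_all_lines (fst p) (snd p))"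
  unfolding frac_all_lines_def
  by (intro poly_time_intros poly_time_frac_intros poly_time_comp[OF _ poly_time_frac_act_lines])

lemma poly_time_frac_crossings: "poly_time frac_crossings"
  unfolding frac_crossings_def[abs_def] by (intro poly_time_intros poly_time_frac_intros)

lemma poly_time_frac_points: "poly_time (\<lambda>p. frac_points (fst p) (snd p))"
  unfolding frac_points_def
  by (intro poly_time_intros poly_time_frac_intros poly_time_comp[OF _ poly_time_frac_crossings] poly_time_frac_all_lines)

lemma poly_time_frac_below_chords: "poly_time (\<lambda>p. frac_below_chords (fst p) (snd p))"
  unfolding frac_below_chords_def by (intro poly_time_intros poly_time_frac_intros)

lemma poly_time_frac_kinks_of_graph: "poly_time frac_kinks_of_graph"
  unfolding frac_kinks_of_graph_def[abs_def]
  by (intro poly_time_intros poly_time_frac_intros poly_time_comp2[OF poly_time_frac_below_chords])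

lemma poly_time_frac_kinks: "poly_time (\<lambda>p. frac_kinks (fst p) (snd p))"
  unfolding frac_kinks_def
  by (intro poly_time_comp[OF _ poly_time_frac_kinks_of_graph] poly_time_intros poly_time_comp3[OF poly_time_frac_opt_value] poly_time_frac_points)

lemma poly_time_solve_critical: "poly_time solve_critical"
  unfolding solve_critical_def[abs_def] acts_of_def
  by (intro poly_time_comp2[OF poly_time_frac_kinks] poly_time_intros)

section \<open>Transfer between fractions and reals\<close>

text \<open>Positivity of the denominator is part of the relation, since comparison by
  cross-multiplication depends on it. Many fractions are related to one real, so nothing ever has to
  be reduced.\<close>

definition frac_rel :: "frac \<Rightarrow> real \<Rightarrow> bool" where
  "frac_rel q r \<longleftrightarrow> proper q \<and> frac_val q = r"

lemma frac_rel_ops [transfer_rule]: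
  "rel_fun frac_rel (rel_fun frac_rel frac_rel) frac_add (+)"
  "rel_fun frac_rel (rel_fun frac_rel frac_rel) frac_sub (-)"
  "rel_fun frac_rel (rel_fun frac_rel frac_rel) frac_mult (*)"
  by (auto simp: rel_fun_def frac_rel_def proper_def frac_val_def frac_add_def frac_sub_def frac_mult_def
    add_frac_eq diff_frac_eq)

lemma frac_rel_div [transfer_rule]: "rel_fun frac_rel (rel_fun frac_rel frac_rel) frac_div (/)"
proof (intro rel_funI)
  fix x y and r s :: real
  assume "frac_rel x r" "frac_rel y s"
  then have x: "0 < snd x" and y: "0 < snd y"
    and r: "r = real_of_int (fst x) / real_of_int (snd x)" and s: "s = real_of_int (fst y) / real_of_int (snd y)"
    by (auto simp: frac_rel_def proper_def frac_val_def)
  consider "0 < fst y" | "fst y < 0" | "fst y = 0" by linarith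
  then show "frac_rel (frac_div x y) (r / s)"
  proof cases
    case 1
    then show ?thesis using x y by (simp add: frac_rel_def proper_def frac_val_def frac_div_def r s)
  next
    case 2
    then show ?thesis using x y
      by (simp add: frac_rel_def proper_def frac_val_def frac_div_def r s mult_pos_neg)
  next
    case 3
    then show ?thesis by (simp add: frac_rel_def proper_def frac_val_def frac_div_def r s)
  qed
qed

lemma frac_rel_const [transfer_rule]:
  "frac_rel (0, 1) 0" "frac_rel (1, 1) 1" "frac_rel (2, 1) 2"
  by (auto simp: frac_rel_def proper_def frac_val_def)

lemma frac_less_iff:
  assumes "proper x" "proper y"
  shows "frac_less x y \<longleftrightarrow> frac_val x < frac_val y"
proof -
  have "frac_val x < frac_val y \<longleftrightarrow> real_of_int (fst x * snd y) < real_of_int (fst y * snd x)"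
    using assms by (simp add: frac_val_def proper_def field_simps)
  then show ?thesis by (simp only: of_int_less_iff frac_less_def)
qed

lemma frac_le_iff:
  assumes "proper x" "proper y"
  shows "frac_le x y \<longleftrightarrow> frac_val x \<le> frac_val y"
proof -
  have "frac_le x y \<longleftrightarrow> \<not> frac_less y x" by (simp add: frac_less_def frac_le_def not_less)
  then show ?thesis by (simp only: frac_less_iff assms not_less)
qed

lemma frac_rel_order [transfer_rule]:
  "rel_fun frac_rel (rel_fun frac_rel (=)) frac_less (<)"
  "rel_fun frac_rel (rel_fun frac_rel (=)) frac_le (\<le>)"
  "rel_fun frac_rel (rel_fun frac_rel frac_rel) frac_max max"
  by (auto simp: rel_fun_def frac_rel_def frac_less_iff frac_le_iff frac_max_def max_def)

lemma sum_list_fold: "fold (+) xs a = a + sum_list xs" for a :: real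
  by (induction xs arbitrary: a) auto

lemma prod_list_fold: "fold (*) xs a = a * prod_list xs" for a :: real
  by (induction xs arbitrary: a) auto

lemma frac_sum_transfer [transfer_rule]: "rel_fun (list_all2 frac_rel) frac_rel frac_sum sum_list"
proof -
  have "rel_fun (list_all2 frac_rel) frac_rel frac_sum (\<lambda>xs. fold (+) xs 0)"
    unfolding frac_sum_def[abs_def] by transfer_prover
  then show ?thesis by (simp add: sum_list_fold)
qed

lemma frac_prod_transfer [transfer_rule]: "rel_fun (list_all2 frac_rel) frac_rel frac_prod prod_list"
proof -
  have "rel_fun (list_all2 frac_rel) frac_rel frac_prod (\<lambda>xs. fold (*) xs 1)"
    unfolding frac_prod_def[abs_def] by transfer_prover
  then show ?thesis by (simp add: prod_list_fold)
qed

lemma frac_dedup_transfer [transfer_rule]: "rel_fun (list_all2 frac_rel) (list_all2 frac_rel) frac_dedup dedup"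
  unfolding frac_dedup_def[abs_def] dedup_def[abs_def] frac_insert_new_def[abs_def] by transfer_prover

lemma tail_prob_transfer [transfer_rule]:
  "rel_fun (list_all2 (rel_prod frac_rel frac_rel)) (rel_fun frac_rel frac_rel) frac_tail_prob tail_prob"
  unfolding frac_tail_prob_def[abs_def] tail_prob_def[abs_def] by transfer_prover

lemma tail_reward_transfer [transfer_rule]:
  "rel_fun (list_all2 (rel_prod frac_rel frac_rel)) (rel_fun frac_rel frac_rel) frac_tail_reward tail_reward"
  unfolding frac_tail_reward_def[abs_def] tail_reward_def[abs_def] by transfer_prover

abbreviation act_rel :: "frac act \<Rightarrow> real act \<Rightarrow> bool" where
  "act_rel \<equiv> rel_prod frac_rel (list_all2 (rel_prod frac_rel frac_rel))"

lemma act_lines_transfer [transfer_rule]: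
  "rel_fun act_rel (list_all2 (rel_prod frac_rel frac_rel)) frac_act_lines act_lines"
  unfolding frac_act_lines_def[abs_def] act_lines_def[abs_def] by transfer_prover

lemma act_index_transfer [transfer_rule]:
  "rel_fun frac_rel (rel_fun act_rel frac_rel) frac_act_index act_index"
  unfolding frac_act_index_def[abs_def] act_index_def[abs_def] frac_maximum_def[abs_def] by transfer_prover

lemma prob_le_transfer [transfer_rule]:
  "rel_fun frac_rel (rel_fun frac_rel (rel_fun act_rel frac_rel)) frac_prob_le prob_le"
  unfolding frac_prob_le_def[abs_def] prob_le_def[abs_def] by transfer_prover

lemma prob_less_transfer [transfer_rule]:
  "rel_fun frac_rel (rel_fun frac_rel (rel_fun act_rel frac_rel)) frac_prob_less prob_less"
  unfolding frac_prob_less_def[abs_def] prob_less_def[abs_def] by transfer_prover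

lemma opt_value_transfer [transfer_rule]:
  "rel_fun (list_all2 frac_rel) (rel_fun (list_all2 act_rel) (rel_fun frac_rel frac_rel)) frac_opt_value opt_value"
  unfolding frac_opt_value_def[abs_def] opt_value_def[abs_def] by transfer_prover

lemma all_lines_transfer [transfer_rule]:
  "rel_fun (list_all2 frac_rel) (rel_fun (list_all2 act_rel) (list_all2 (rel_prod frac_rel frac_rel)))
     frac_all_lines all_lines"
  unfolding frac_all_lines_def[abs_def] all_lines_def[abs_def] by transfer_prover

lemma crossings_transfer [transfer_rule]:
  "rel_fun (list_all2 (rel_prod frac_rel frac_rel)) (list_all2 frac_rel) frac_crossings crossings"
  unfolding frac_crossings_def[abs_def] crossings_def[abs_def] by transfer_prover

lemma points_transfer [transfer_rule]:
  "rel_fun (list_all2 frac_rel) (rel_fun (list_all2 act_rel) (list_all2 frac_rel)) frac_points points"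
  unfolding frac_points_def[abs_def] points_def[abs_def] by transfer_prover

lemma below_chords_transfer [transfer_rule]:
  "rel_fun (list_all2 (rel_prod frac_rel frac_rel)) (rel_fun (rel_prod frac_rel frac_rel) (=))
     frac_below_chords below_chords"
  unfolding frac_below_chords_def[abs_def] below_chords_def[abs_def] by transfer_prover

lemma kinks_of_graph_transfer [transfer_rule]:
  "rel_fun (list_all2 (rel_prod frac_rel frac_rel)) (list_all2 frac_rel) frac_kinks_of_graph kinks_of_graph"
  unfolding frac_kinks_of_graph_def[abs_def] kinks_of_graph_def[abs_def] by transfer_prover

lemma kinks_transfer [transfer_rule]:
  "rel_fun (list_all2 frac_rel) (rel_fun (list_all2 act_rel) (list_all2 frac_rel)) frac_kinks kinks"
  unfolding frac_kinks_def[abs_def] kinks_def[abs_def] by transfer_prover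

lemma acts_of_transfer [transfer_rule]:
  "rel_fun (list_all2 A) (rel_fun (list_all2 A) (rel_fun (list_all2 (list_all2 A))
     (list_all2 (rel_prod A (list_all2 (rel_prod A A)))))) acts_of acts_of"
  unfolding acts_of_def[abs_def] by transfer_prover

lemma frac_rel_map: "list_all2 frac_rel xs ys \<longleftrightarrow> list_all proper xs \<and> map frac_val xs = ys"
  unfolding frac_rel_def
  by (induction xs arbitrary: ys) (auto simp: list_all2_Cons1)

lemma frac_rel_map_map:
  "list_all2 (list_all2 frac_rel) xs ys \<longleftrightarrow> list_all (list_all proper) xs \<and> map (map frac_val) xs = ys"
  by (induction xs arbitrary: ys) (auto simp: list_all2_Cons1 frac_rel_map)

lemma solve_critical_correct:
  assumes "list_all proper cs" "list_all proper rs" "list_all (list_all proper) ps"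
  shows "list_all proper (solve_critical (cs, rs, ps)) \<and> map frac_val (solve_critical (cs, rs, ps)) =
    kinks (map frac_val rs) (acts_of (map frac_val cs) (map frac_val rs) (map (map frac_val) ps))"
proof -
  have "list_all2 frac_rel cs (map frac_val cs)" "list_all2 frac_rel rs (map frac_val rs)"
    "list_all2 (list_all2 frac_rel) ps (map (map frac_val) ps)"
    using assms by (simp_all add: frac_rel_map frac_rel_map_map)
  then have "list_all2 frac_rel (solve_critical (cs, rs, ps))
      (kinks (map frac_val rs) (acts_of (map frac_val cs) (map frac_val rs) (map (map frac_val) ps)))"
    using kinks_transfer acts_of_transfer[of frac_rel] unfolding solve_critical_def rel_fun_def by simp
  then show ?thesis by (simp add: frac_rel_map)
qed

lemma enc_frac_eq: "encode = enc_frac"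
  by (auto simp: fun_eq_iff)

lemma solve_critical_poly_time:
  "\<exists>p q. \<forall>x. \<exists>t. runs p (enc_input x) (enc_list enc_frac (solve_critical x)) t \<and> t \<le> poly q (vsize (enc_input x))"
proof -
  have "enc_input x = encode x" for x
    by (cases x) (simp add: enc_frac_eq[symmetric] encode_list_def[symmetric])
  then show ?thesis using poly_time_solve_critical
    unfolding poly_time_def by (simp add: enc_frac_eq[symmetric] encode_list_def[symmetric])
qed

section \<open>Kinks of an upper envelope of lines\<close>

text \<open>Used with the strategies as index set, expected reward as slope and expected cost as
  negated intercept.\<close>

locale line_family =
  fixes S :: "'s set" and R C :: "'s \<Rightarrow> real"
  assumes finite_S: "finite S" and S_nonempty: "S \<noteq> {}"
begin

definition upper :: "real \<Rightarrow> real" where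
  "upper \<alpha> = Max ((\<lambda>s. \<alpha> * R s - C s) ` S)"

definition opt :: "real \<Rightarrow> 's set" where
  "opt \<alpha> = {s \<in> S. \<forall>u\<in>S. \<alpha> * R u - C u \<le> \<alpha> * R s - C s}"

definition kink :: "real \<Rightarrow> bool" where
  "kink \<alpha> \<longleftrightarrow> (\<exists>s\<in>opt \<alpha>. \<exists>u\<in>opt \<alpha>. R s \<noteq> R u)"

lemma upper_ge: "s \<in> S \<Longrightarrow> \<alpha> * R s - C s \<le> upper \<alpha>"
  unfolding upper_def using finite_S by (intro Max_ge) auto

lemma opt_iff: "s \<in> opt \<alpha> \<longleftrightarrow> s \<in> S \<and> \<alpha> * R s - C s = upper \<alpha>"
proof -
  have "upper \<alpha> \<in> (\<lambda>s. \<alpha> * R s - C s) ` S"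
    unfolding upper_def using finite_S S_nonempty by (intro Max_in) auto
  then show ?thesis unfolding opt_def using upper_ge[of _ \<alpha>] by force
qed

lemma opt_nonempty: obtains s where "s \<in> opt \<alpha>"
proof -
  have "upper \<alpha> \<in> (\<lambda>s. \<alpha> * R s - C s) ` S"
    unfolding upper_def using finite_S S_nonempty by (intro Max_in) auto
  then show ?thesis using that opt_iff by auto
qed

lemma upper_eqI: "(\<And>s. s \<in> S \<Longrightarrow> \<alpha> * R s - C s \<le> w) \<Longrightarrow> s \<in> S \<Longrightarrow> \<alpha> * R s - C s = w \<Longrightarrow> upper \<alpha> = w"
  unfolding upper_def using finite_S by (intro Max_eqI) auto

text \<open>Two optimal lines of different slope meet at \<alpha>. If the envelope reached the chord
  there, both would have to touch the envelope at a as well, and two lines sharing two points have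
  equal slope.\<close>

lemma kink_below_chord:
  assumes "kink \<alpha>" "a < \<alpha>" "\<alpha> < b"
  shows "(b - a) * upper \<alpha> < (b - \<alpha>) * upper a + (\<alpha> - a) * upper b"
proof (rule ccontr)
  assume le: "\<not> ?thesis"
  have eq: "a * R s - C s = upper a" if "s \<in> opt \<alpha>" for s
  proof -
    have s: "s \<in> S" "\<alpha> * R s - C s = upper \<alpha>" using that opt_iff by auto
    have "(b - a) * upper \<alpha> = (b - \<alpha>) * (a * R s - C s) + (\<alpha> - a) * (b * R s - C s)"
      unfolding s(2)[symmetric] by (simp add: algebra_simps)
    moreover have "(\<alpha> - a) * (b * R s - C s) \<le> (\<alpha> - a) * upper b"
      using upper_ge[OF s(1)] assms by (intro mult_left_mono) auto
    ultimately have "(b - \<alpha>) * upper a \<le> (b - \<alpha>) * (a * R s - C s)" using le by linarith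
    then show ?thesis using upper_ge[OF s(1), of a] assms by simp
  qed
  obtain s u where su: "s \<in> opt \<alpha>" "u \<in> opt \<alpha>" "R s \<noteq> R u" using assms(1) unfolding kink_def by blast
  have "a * R s - C s = a * R u - C u" using eq su by simp
  moreover have "\<alpha> * R s - C s = \<alpha> * R u - C u" using su opt_iff by simp
  ultimately have "(\<alpha> - a) * (R s - R u) = 0" by (simp add: algebra_simps)
  then show False using su assms by simp
qed

lemma kink_not_affine_near:
  assumes "kink \<alpha>" "\<forall>\<^sub>F x in nhds \<alpha>. upper x = \<rho> * x + \<gamma>"
  shows False
proof -
  obtain e where e: "e > 0" "\<And>x. dist x \<alpha> < e \<Longrightarrow> upper x = \<rho> * x + \<gamma>"
    using assms(2) unfolding eventually_nhds_metric by blast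
  define d where "d = e / 2"
  have eqs: "upper (\<alpha> - d) = \<rho> * (\<alpha> - d) + \<gamma>" "upper \<alpha> = \<rho> * \<alpha> + \<gamma>" "upper (\<alpha> + d) = \<rho> * (\<alpha> + d) + \<gamma>"
    by (rule e(2); use e(1) in \<open>simp add: dist_real_def d_def\<close>)+
  have "\<alpha> - d < \<alpha>" "\<alpha> < \<alpha> + d" using e(1) by (auto simp: d_def)
  from kink_below_chord[OF assms(1) this] show False
    unfolding eqs by (simp add: algebra_simps)
qed

text \<open>Without a kink all optimal lines coincide, and the finitely many others are strictly
  lower, which persists nearby.\<close>

lemma opt_near:
  assumes "\<not> kink \<alpha>" "s \<in> opt \<alpha>"
  shows "\<forall>\<^sub>F x in nhds \<alpha>. opt x = opt \<alpha> \<and> upper x = x * R s - C s"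
proof -
  have s: "s \<in> S" "\<alpha> * R s - C s = upper \<alpha>" using assms(2) opt_iff by auto
  have same: "R u = R s \<and> C u = C s" if "u \<in> opt \<alpha>" for u
    using assms that s opt_iff[of u \<alpha>] unfolding kink_def by (metis add_diff_cancel_left' diff_add_cancel)
  have "\<forall>\<^sub>F x in nhds \<alpha>. \<forall>u\<in>S - opt \<alpha>. x * R u - C u < x * R s - C s"
  proof (intro eventually_ball_finite ballI)
    fix u assume "u \<in> S - opt \<alpha>"
    then have "\<alpha> * R u - C u < \<alpha> * R s - C s" using s opt_iff[of u \<alpha>] upper_ge[of u \<alpha>] by auto
    then show "\<forall>\<^sub>F x in nhds \<alpha>. x * R u - C u < x * R s - C s"
      by (intro eventually_nhds_in_open[of "{x. x * R u - C u < x * R s - C s}", simplified] open_Collect_less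
        continuous_intros) auto
  qed (use finite_S in auto)
  then show ?thesis
  proof eventually_elim
    case (elim x)
    have le: "x * R u - C u \<le> x * R s - C s" if "u \<in> S" for u
      using elim that same[of u] by (cases "u \<in> opt \<alpha>") (auto intro: less_imp_le)
    then have up: "upper x = x * R s - C s" using s by (intro upper_eqI[of x _ s]) auto
    moreover have "opt x = opt \<alpha>"
    proof (intro set_eqI iffI)
      fix u assume "u \<in> opt x"
      then show "u \<in> opt \<alpha>" using elim up opt_iff[of u x] by (metis DiffI less_irrefl)
    next
      fix u assume u: "u \<in> opt \<alpha>"
      then show "u \<in> opt x" using up same[OF u] opt_iff[of u] by simp
    qed
    ultimately show ?case by simp
  qed
qed

text \<open>Of two lines meeting at \<alpha>, the flatter one is strictly higher to the
  left.\<close>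

lemma not_opt_left:
  assumes "s \<in> opt \<alpha>" "u \<in> opt \<alpha>" "R u < R s" "\<beta> < \<alpha>"
  shows "s \<notin> opt \<beta>"
proof
  assume "s \<in> opt \<beta>"
  moreover have "u \<in> S" using assms opt_iff by auto
  ultimately have "\<beta> * R u - C u \<le> \<beta> * R s - C s" unfolding opt_def by auto
  moreover have "\<alpha> * R s - C s = \<alpha> * R u - C u" using assms opt_iff by auto
  ultimately have "(\<alpha> - \<beta>) * (R s - R u) \<le> 0" by (simp add: algebra_simps)
  then show False using assms(3,4) by (simp add: mult_le_0_iff)
qed

text \<open>In the converse direction only the neighbours a and b of \<alpha> in P matter: without a
  kink the envelope is one line near \<alpha>, so its pieces on [a, \<alpha>] and [\<alpha>, b] both
  continue that line and the chord inequality becomes an equality.\<close>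

lemma kink_iff_below_chords:
  assumes "finite P" and lr: "\<exists>a\<in>P. a < \<alpha>" "\<exists>b\<in>P. \<alpha> < b"
    and aff: "\<And>a b. a \<in> P \<Longrightarrow> b \<in> P \<Longrightarrow> a < b \<Longrightarrow> P \<inter> {a<..<b} = {} \<Longrightarrow>
      \<exists>\<rho> \<gamma>. \<forall>x\<in>{a..b}. upper x = \<rho> * x + \<gamma>"
  shows "kink \<alpha> \<longleftrightarrow> \<alpha> \<in> P \<and> (\<forall>a\<in>P. \<forall>b\<in>P. a < \<alpha> \<and> \<alpha> < b \<longrightarrow>
    (b - a) * upper \<alpha> < (b - \<alpha>) * upper a + (\<alpha> - a) * upper b)"
proof -
  define a where "a = Max {x \<in> P. x < \<alpha>}"
  define b where "b = Min {x \<in> P. \<alpha> < x}"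
  have "a \<in> {x \<in> P. x < \<alpha>}" unfolding a_def using lr(1) \<open>finite P\<close> by (intro Max_in) auto
  then have a: "a \<in> P" "a < \<alpha>" by auto
  have "b \<in> {x \<in> P. \<alpha> < x}" unfolding b_def using lr(2) \<open>finite P\<close> by (intro Min_in) auto
  then have b: "b \<in> P" "\<alpha> < b" by auto
  have a_max: "x \<le> a" if "x \<in> P" "x < \<alpha>" for x
    unfolding a_def using that \<open>finite P\<close> by (intro Max_ge) auto
  have b_min: "b \<le> x" if "x \<in> P" "\<alpha> < x" for x
    unfolding b_def using that \<open>finite P\<close> by (intro Min_le) auto
  show ?thesis
  proof
    assume k: "kink \<alpha>"
    have "\<alpha> \<in> P"
    proof (rule ccontr)
      assume "\<alpha> \<notin> P"
      then have "P \<inter> {a<..<b} = {}"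
        using a_max b_min by (force simp: not_less)
      from aff[OF a(1) b(1) _ this] a b
      obtain \<rho> \<gamma> where "\<forall>x\<in>{a..b}. upper x = \<rho> * x + \<gamma>" by auto
      then have "upper \<alpha> = \<rho> * \<alpha> + \<gamma>" "upper a = \<rho> * a + \<gamma>" "upper b = \<rho> * b + \<gamma>" using a b by auto
      then show False using kink_below_chord[OF k a(2) b(2)] by (simp add: algebra_simps)
    qed
    then show "\<alpha> \<in> P \<and> (\<forall>a\<in>P. \<forall>b\<in>P. a < \<alpha> \<and> \<alpha> < b \<longrightarrow>
      (b - a) * upper \<alpha> < (b - \<alpha>) * upper a + (\<alpha> - a) * upper b)"
      using kink_below_chord[OF k] by blast
  next
    assume *: "\<alpha> \<in> P \<and> (\<forall>a\<in>P. \<forall>b\<in>P. a < \<alpha> \<and> \<alpha> < b \<longrightarrow>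
      (b - a) * upper \<alpha> < (b - \<alpha>) * upper a + (\<alpha> - a) * upper b)"
    show "kink \<alpha>"
    proof (rule ccontr)
      assume nk: "\<not> kink \<alpha>"
      obtain s where s: "s \<in> opt \<alpha>" using opt_nonempty by blast
      obtain e where e: "e > 0" "\<And>x. dist x \<alpha> < e \<Longrightarrow> upper x = x * R s - C s"
        using opt_near[OF nk s] unfolding eventually_nhds_metric by blast
      \<comment> \<open>An affine piece is identified by its values at \<alpha> and at one further
        point close to it.\<close>
      have same: "\<rho> = R s \<and> \<gamma> = - C s"
        if "upper \<alpha> = \<rho> * \<alpha> + \<gamma>" "upper x = \<rho> * x + \<gamma>" "dist x \<alpha> < e" "x \<noteq> \<alpha>" for \<rho> \<gamma> x
      proof -
        have "\<rho> * \<alpha> + \<gamma> = \<alpha> * R s - C s" "\<rho> * x + \<gamma> = x * R s - C s"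
          using e(2)[OF that(3)] e(2)[of \<alpha>] e(1) that by auto
        then have "(x - \<alpha>) * (\<rho> - R s) = 0" by (simp add: algebra_simps)
        then have "\<rho> = R s" using that by simp
        then show ?thesis using \<open>\<rho> * \<alpha> + \<gamma> = \<alpha> * R s - C s\<close> by simp
      qed
      have "P \<inter> {a<..<\<alpha>} = {}" using a_max by force
      from aff[OF a(1) _ a(2) this] * obtain \<rho> \<gamma> where l: "\<forall>x\<in>{a..\<alpha>}. upper x = \<rho> * x + \<gamma>" by blast
      have "dist (max a (\<alpha> - e / 2)) \<alpha> < e" "max a (\<alpha> - e / 2) \<noteq> \<alpha>"
        using a e(1) by (auto simp: dist_real_def)
      with l a have l': "\<rho> = R s \<and> \<gamma> = - C s" by (intro same[of \<rho> \<gamma> "max a (\<alpha> - e / 2)"]) (use e in auto)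
      have "P \<inter> {\<alpha><..<b} = {}" using b_min by force
      from aff[OF _ b(1) b(2) this] * obtain \<rho>' \<gamma>' where r: "\<forall>x\<in>{\<alpha>..b}. upper x = \<rho>' * x + \<gamma>'" by blast
      have "dist (min b (\<alpha> + e / 2)) \<alpha> < e" "min b (\<alpha> + e / 2) \<noteq> \<alpha>"
        using b e(1) by (auto simp: dist_real_def)
      with r b have r': "\<rho>' = R s \<and> \<gamma>' = - C s" by (intro same[of \<rho>' \<gamma>' "min b (\<alpha> + e / 2)"]) (use e in auto)
      have eqs: "upper a = R s * a - C s" "upper \<alpha> = R s * \<alpha> - C s" "upper b = R s * b - C s"
        using l r l' r' a b by auto
      have "(b - a) * upper \<alpha> < (b - \<alpha>) * upper a + (\<alpha> - a) * upper b" using * a b by blast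
      then show False unfolding eqs by (simp add: algebra_simps)
    qed
  qed
qed

end

text \<open>A set of functions that is linearly ordered along a filter is closed under \<open>max\<close> and \<open>min\<close> up to
  eventual equality. It is used for neighbourhoods of a point and for intervals (principal filters).\<close>

definition comparable_along :: "real filter \<Rightarrow> (real \<Rightarrow> real) set \<Rightarrow> bool" where
  "comparable_along Fl F \<longleftrightarrow>
     (\<forall>f\<in>F. \<forall>g\<in>F. (\<forall>\<^sub>F x in Fl. f x \<le> g x) \<or> (\<forall>\<^sub>F x in Fl. g x \<le> f x))"

definition member_along :: "real filter \<Rightarrow> (real \<Rightarrow> real) set \<Rightarrow> (real \<Rightarrow> real) \<Rightarrow> bool" where
  "member_along Fl F g \<longleftrightarrow> (\<exists>f\<in>F. \<forall>\<^sub>F x in Fl. g x = f x)"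

lemma member_along_refl: "f \<in> F \<Longrightarrow> member_along Fl F f"
  unfolding member_along_def by (rule bexI[of _ f]) auto

lemma member_along_max:
  assumes "comparable_along Fl F" "member_along Fl F f" "member_along Fl F g"
  shows "member_along Fl F (\<lambda>x. max (f x) (g x))"
proof -
  obtain f' g' where f': "f' \<in> F" "\<forall>\<^sub>F x in Fl. f x = f' x" and g': "g' \<in> F" "\<forall>\<^sub>F x in Fl. g x = g' x"
    using assms(2,3) unfolding member_along_def by blast
  consider "\<forall>\<^sub>F x in Fl. f' x \<le> g' x" | "\<forall>\<^sub>F x in Fl. g' x \<le> f' x"
    using assms(1) f' g' unfolding comparable_along_def by blast
  then show ?thesis
  proof cases
    case 1
    with f'(2) g'(2) have "\<forall>\<^sub>F x in Fl. max (f x) (g x) = g' x" by eventually_elim auto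
    with g' show ?thesis unfolding member_along_def by blast
  next
    case 2
    with f'(2) g'(2) have "\<forall>\<^sub>F x in Fl. max (f x) (g x) = f' x" by eventually_elim auto
    with f' show ?thesis unfolding member_along_def by blast
  qed
qed

lemma member_along_min:
  assumes "comparable_along Fl F" "member_along Fl F f" "member_along Fl F g"
  shows "member_along Fl F (\<lambda>x. min (f x) (g x))"
proof -
  obtain f' g' where f': "f' \<in> F" "\<forall>\<^sub>F x in Fl. f x = f' x" and g': "g' \<in> F" "\<forall>\<^sub>F x in Fl. g x = g' x"
    using assms(2,3) unfolding member_along_def by blast
  consider "\<forall>\<^sub>F x in Fl. f' x \<le> g' x" | "\<forall>\<^sub>F x in Fl. g' x \<le> f' x"
    using assms(1) f' g' unfolding comparable_along_def by blast
  then show ?thesis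
  proof cases
    case 1
    with f'(2) g'(2) have "\<forall>\<^sub>F x in Fl. min (f x) (g x) = f' x" by eventually_elim auto
    with f' show ?thesis unfolding member_along_def by blast
  next
    case 2
    with f'(2) g'(2) have "\<forall>\<^sub>F x in Fl. min (f x) (g x) = g' x" by eventually_elim auto
    with g' show ?thesis unfolding member_along_def by blast
  qed
qed

lemma member_along_Max:
  assumes "comparable_along Fl F" "finite S" "member_along Fl F f" "\<And>i. i \<in> S \<Longrightarrow> member_along Fl F (g i)"
  shows "member_along Fl F (\<lambda>x. Max (insert (f x) ((\<lambda>i. g i x) ` S)))"
  using assms(2,4)
proof (induction S rule: finite_induct)
  case empty
  then show ?case using assms(3) by simp
next
  case (insert i S)
  have "Max (insert (f x) ((\<lambda>i. g i x) ` insert i S)) = max (g i x) (Max (insert (f x) ((\<lambda>i. g i x) ` S)))" for x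
  proof -
    have "insert (f x) ((\<lambda>i. g i x) ` insert i S) = insert (g i x) (insert (f x) ((\<lambda>i. g i x) ` S))" by auto
    then show ?thesis using insert(1) by (simp del: Max_insert) (subst Max_insert, auto)
  qed
  then show ?case using insert by (simp only:) (intro member_along_max[OF assms(1)]; auto)
qed

definition affine_along :: "real filter \<Rightarrow> (real \<Rightarrow> real) \<Rightarrow> bool" where
  "affine_along Fl g \<longleftrightarrow> (\<exists>\<rho> \<gamma>. \<forall>\<^sub>F x in Fl. g x = \<rho> * x + \<gamma>)"

lemma affine_along_member:
  assumes "member_along Fl F g" "\<And>f. f \<in> F \<Longrightarrow> affine_along Fl f"
  shows "affine_along Fl g"
proof -
  obtain f where f: "f \<in> F" "\<forall>\<^sub>F x in Fl. g x = f x" using assms(1) unfolding member_along_def by blast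
  obtain \<rho> \<gamma> where "\<forall>\<^sub>F x in Fl. f x = \<rho> * x + \<gamma>" using assms(2)[OF f(1)] unfolding affine_along_def by blast
  with f(2) have "\<forall>\<^sub>F x in Fl. g x = \<rho> * x + \<gamma>" by eventually_elim simp
  then show ?thesis unfolding affine_along_def by blast
qed

lemma affine_along_sum:
  assumes "\<And>i. i \<in> S \<Longrightarrow> affine_along Fl (g i)"
  shows "affine_along Fl (\<lambda>x. \<Sum>i\<in>S. w i * g i x)"
proof (cases "finite S")
  case True
  have "\<forall>i\<in>S. \<exists>\<rho> \<gamma>. \<forall>\<^sub>F x in Fl. g i x = \<rho> * x + \<gamma>" using assms unfolding affine_along_def by blast
  then obtain \<rho> \<gamma> where *: "\<forall>i\<in>S. \<forall>\<^sub>F x in Fl. g i x = \<rho> i * x + \<gamma> i" by metis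
  then have "\<forall>\<^sub>F x in Fl. \<forall>i\<in>S. g i x = \<rho> i * x + \<gamma> i" using True by (intro eventually_ball_finite) auto
  then have "\<forall>\<^sub>F x in Fl. (\<Sum>i\<in>S. w i * g i x) = (\<Sum>i\<in>S. w i * \<rho> i) * x + (\<Sum>i\<in>S. w i * \<gamma> i)"
    by eventually_elim (simp add: distrib_left sum.distrib sum_distrib_right mult.assoc)
  then show ?thesis unfolding affine_along_def by blast
next
  case False
  then show ?thesis unfolding affine_along_def by (intro exI[of _ 0]) simp
qed

section \<open>Weitzman's index policy\<close>

locale independent_instance =
  fixes I :: contract_instance
  assumes model: "independent_action_model I"
begin

abbreviation A where "A \<equiv> actions I"
abbreviation J where "J \<equiv> outcomes I"
abbreviation c where "c \<equiv> cost I"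
abbreviation r where "r \<equiv> reward I"

lemma finite_A [simp]: "finite A" and finite_J [simp]: "finite J"
  by (simp_all add: actions_def outcomes_def)

lemma one_in_J: "1 \<in> J"
  using model by (simp add: independent_action_model_def is_instance_def outcomes_def)

lemma r_one [simp]: "r 1 = 0" "r (Suc 0) = 0"
  using model by (simp_all add: independent_action_model_def is_instance_def)

lemma r_mono: "j \<in> J \<Longrightarrow> k \<in> J \<Longrightarrow> j \<le> k \<Longrightarrow> r j \<le> r k"
  using model by (auto simp: independent_action_model_def is_instance_def mono_on_def)

lemma r_nonneg: "j \<in> J \<Longrightarrow> 0 \<le> r j"
  using r_mono[OF one_in_J, of j] by (simp add: outcomes_def)

lemma c_nonneg: "i \<in> A \<Longrightarrow> 0 \<le> c i"
  using model by (auto simp: independent_action_model_def is_instance_def)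

definition p :: "nat \<Rightarrow> nat pmf" where "p i = map_pmf (\<lambda>x. x i) (law I)"

abbreviation q :: "nat \<Rightarrow> nat \<Rightarrow> real" where "q i j \<equiv> pmf (p i) j"

lemma outcome_prob_eq: "outcome_prob I i j = q i j"
  by (simp add: outcome_prob_def p_def pmf_map vimage_def)

lemma set_p: "i \<in> A \<Longrightarrow> set_pmf (p i) \<subseteq> J"
  using model by (auto simp: p_def independent_action_model_def is_instance_def)

lemma sum_q: "i \<in> A \<Longrightarrow> (\<Sum>j\<in>J. q i j) = 1"
  by (rule sum_pmf_eq_1) (use set_p in auto)

text \<open>The default 1 is the zero outcome, so that the coordinates outside S are legal outcomes
  too.\<close>

definition joint_pmf :: "nat set \<Rightarrow> (nat \<Rightarrow> nat) pmf" where "joint_pmf S = Pi_pmf S 1 p"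

text \<open>A finite sum instead of an integral, so that no integrability conditions arise; for sets
  of actions the support is finite.\<close>

definition expect :: "nat set \<Rightarrow> ((nat \<Rightarrow> nat) \<Rightarrow> real) \<Rightarrow> real" where
  "expect S f = (\<Sum>x\<in>set_pmf (joint_pmf S). pmf (joint_pmf S) x * f x)"

lemma set_joint_pmf: "S \<subseteq> A \<Longrightarrow> x \<in> set_pmf (joint_pmf S) \<Longrightarrow> x i \<in> J"
proof -
  assume S: "S \<subseteq> A" and x: "x \<in> set_pmf (joint_pmf S)"
  have "finite S" using S finite_subset finite_A by blast
  with x have "x \<in> PiE_dflt S 1 (set_pmf \<circ> p)" by (simp add: joint_pmf_def set_Pi_pmf)
  then have "x i \<in> (if i \<in> S then set_pmf (p i) else {1})" by (auto simp: PiE_dflt_def)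
  then show ?thesis using S set_p[of i] one_in_J by (auto split: if_splits)
qed

lemma finite_set_joint_pmf [simp]: "S \<subseteq> A \<Longrightarrow> finite (set_pmf (joint_pmf S))"
proof -
  assume S: "S \<subseteq> A"
  have "finite S" using S finite_subset finite_A by blast
  moreover have "finite (set_pmf (p i))" if "i \<in> S" for i
    using that S set_p[of i] finite_J finite_subset by blast
  ultimately show ?thesis unfolding joint_pmf_def set_Pi_pmf[OF \<open>finite S\<close>]
    by (intro finite_PiE_dflt) auto
qed

lemma expect_expectation: "S \<subseteq> A \<Longrightarrow> measure_pmf.expectation (joint_pmf S) f = expect S f"
  unfolding expect_def by (subst integral_measure_pmf[of "set_pmf (joint_pmf S)"]) auto

lemma expect_cong: "(\<And>x. x \<in> set_pmf (joint_pmf S) \<Longrightarrow> f x = g x) \<Longrightarrow> expect S f = expect S g"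
  unfolding expect_def by (intro sum.cong) auto

lemma expect_mono: "(\<And>x. x \<in> set_pmf (joint_pmf S) \<Longrightarrow> f x \<le> g x) \<Longrightarrow> expect S f \<le> expect S g"
  unfolding expect_def by (intro sum_mono mult_left_mono) auto

lemma expect_const: "S \<subseteq> A \<Longrightarrow> expect S (\<lambda>_. k) = k"
  unfolding expect_def by (simp add: sum_distrib_right[symmetric] sum_pmf_eq_1)

lemma expect_diff: "expect S (\<lambda>x. f x - g x) = expect S f - expect S g"
  unfolding expect_def by (simp add: right_diff_distrib sum_subtractf)

lemma expect_mult: "expect S (\<lambda>x. k * f x) = k * expect S f"
  unfolding expect_def by (simp add: sum_distrib_left mult.left_commute)

lemma expect_sum: "expect S (\<lambda>x. \<Sum>j\<in>K. w j * f j x) = (\<Sum>j\<in>K. w j * expect S (f j))"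
  unfolding expect_def sum_distrib_left by (subst sum.swap) (simp add: mult.left_commute)

text \<open>Conditioning on the outcome of i: the product law is a draw from \<open>p i\<close>
  followed by an independent draw for the other actions.\<close>

lemma expect_remove:
  assumes "S \<subseteq> A" "i \<in> S"
  shows "expect S f = (\<Sum>j\<in>J. q i j * expect (S - {i}) (\<lambda>x. f (x(i := j))))"
proof -
  have fin: "finite (S - {i})" using assms(1) finite_subset finite_A by blast
  have sub: "S - {i} \<subseteq> A" using assms by auto
  have "joint_pmf S = p i \<bind> (\<lambda>y. map_pmf (\<lambda>x. x(i := y)) (joint_pmf (S - {i})))"
    unfolding joint_pmf_def using Pi_pmf_insert'[OF fin, of i 1 p] assms by (simp add: insert_absorb map_pmf_def)
  then have "measure_pmf.expectation (joint_pmf S) f =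
      (\<Sum>j\<in>J. q i j *\<^sub>R measure_pmf.expectation (map_pmf (\<lambda>x. x(i := j)) (joint_pmf (S - {i}))) f)"
    using assms set_p[of i] finite_set_joint_pmf[OF sub] by (simp only:) (intro pmf_expectation_bind; auto)
  with sub show ?thesis using assms by (simp add: expect_expectation)
qed

section \<open>Reservation values\<close>

definition tail_p :: "nat \<Rightarrow> real \<Rightarrow> real" where
  "tail_p i \<rho> = (\<Sum>k | k \<in> J \<and> \<rho> \<le> r k. q i k)"

definition tail_r :: "nat \<Rightarrow> real \<Rightarrow> real" where
  "tail_r i \<rho> = (\<Sum>k | k \<in> J \<and> \<rho> \<le> r k. q i k * r k)"

text \<open>Clipping the reservation value at \<open>0\<close> is harmless, as the agent always has an outcome of value \<open>\<ge> 0\<close>.\<close>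

definition reservation :: "nat \<Rightarrow> real \<Rightarrow> real" where
  "reservation i \<alpha> = Max (insert 0 ((\<lambda>j. (\<alpha> * tail_r i (r j) - c i) / tail_p i (r j)) ` {j \<in> J. 0 < tail_p i (r j)}))"

definition surplus :: "nat \<Rightarrow> real \<Rightarrow> real \<Rightarrow> real" where
  "surplus i \<alpha> s = (\<Sum>j\<in>J. q i j * max 0 (\<alpha> * r j - s))"

lemma reservation_nonneg: "0 \<le> reservation i \<alpha>"
  unfolding reservation_def by (intro Max_ge) auto

lemma tail_le_surplus: "\<alpha> * tail_r i \<rho> - s * tail_p i \<rho> \<le> surplus i \<alpha> s"
proof -
  have "\<alpha> * tail_r i \<rho> - s * tail_p i \<rho> = (\<Sum>k | k \<in> J \<and> \<rho> \<le> r k. q i k * (\<alpha> * r k - s))"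
    unfolding tail_r_def tail_p_def
    by (simp add: sum_distrib_left sum_subtractf[symmetric] algebra_simps)
  also have "\<dots> \<le> (\<Sum>k | k \<in> J \<and> \<rho> \<le> r k. q i k * max 0 (\<alpha> * r k - s))"
    by (intro sum_mono mult_left_mono) auto
  also have "\<dots> \<le> surplus i \<alpha> s"
    unfolding surplus_def by (intro sum_mono2) auto
  finally show ?thesis .
qed

text \<open>The outcomes worth more than s form an upper set of rewards, and a least element j of it
  makes the tail bound an equality.\<close>

lemma surplus_eq_tail:
  assumes "0 \<le> \<alpha>" "0 \<le> s" "0 < surplus i \<alpha> s"
  obtains j where "j \<in> J" "0 < tail_p i (r j)" "surplus i \<alpha> s = \<alpha> * tail_r i (r j) - s * tail_p i (r j)"
proof -
  define T where "T = {k \<in> J. s < \<alpha> * r k}"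
  have surp: "surplus i \<alpha> s = (\<Sum>k\<in>T. q i k * (\<alpha> * r k - s))"
    unfolding surplus_def T_def by (intro sum.mono_neutral_cong_right) auto
  then have "T \<noteq> {}" using assms by auto
  moreover have "finite T" by (simp add: T_def)
  ultimately obtain j where j: "j \<in> T" "\<And>k. k \<in> T \<Longrightarrow> r j \<le> r k"
    using arg_min_if_finite[of T r] by (metis not_less)
  have "\<alpha> \<noteq> 0" using j assms by (auto simp: T_def)
  then have \<alpha>: "0 < \<alpha>" using assms by simp
  have T: "T = {k. k \<in> J \<and> r j \<le> r k}"
  proof (intro set_eqI iffI)
    fix k assume "k \<in> {k. k \<in> J \<and> r j \<le> r k}"
    moreover from this have "\<alpha> * r j \<le> \<alpha> * r k" using \<alpha> by simp
    ultimately show "k \<in> T" using j(1) by (auto simp: T_def)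
  qed (use j(2) in \<open>auto simp: T_def\<close>)
  have "surplus i \<alpha> s = \<alpha> * tail_r i (r j) - s * tail_p i (r j)"
    unfolding surp unfolding T tail_r_def tail_p_def
    by (simp add: sum_distrib_left sum_subtractf[symmetric] algebra_simps)
  moreover have "tail_p i (r j) \<noteq> 0"
  proof
    assume "tail_p i (r j) = 0"
    then have "\<forall>k\<in>T. q i k = 0" unfolding tail_p_def T[symmetric] using \<open>finite T\<close>
      by (simp add: sum_nonneg_eq_0_iff)
    then show False using surp assms by simp
  qed
  moreover have "0 \<le> tail_p i (r j)" unfolding tail_p_def by (intro sum_nonneg) auto
  ultimately show ?thesis using that j(1) by (auto simp: T_def)
qed

text \<open>No tail contributes more than the surplus and, if the surplus is positive, some tail
  attains it. So the explicit maximum is the least s \<ge> 0 at which the surplus does not exceed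
  the cost.\<close>

lemma reservation_le_iff:
  assumes "i \<in> A" "0 \<le> \<alpha>" "0 \<le> s"
  shows "reservation i \<alpha> \<le> s \<longleftrightarrow> surplus i \<alpha> s \<le> c i"
proof -
  have "reservation i \<alpha> \<le> s \<longleftrightarrow> (\<forall>j\<in>J. 0 < tail_p i (r j) \<longrightarrow> \<alpha> * tail_r i (r j) - s * tail_p i (r j) \<le> c i)"
    unfolding reservation_def using assms by (subst Max_le_iff) (auto simp: divide_le_eq algebra_simps)
  also have "\<dots> \<longleftrightarrow> surplus i \<alpha> s \<le> c i"
  proof
    assume *: "\<forall>j\<in>J. 0 < tail_p i (r j) \<longrightarrow> \<alpha> * tail_r i (r j) - s * tail_p i (r j) \<le> c i"
    show "surplus i \<alpha> s \<le> c i"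
    proof (cases "0 < surplus i \<alpha> s")
      case True
      then show ?thesis using surplus_eq_tail[OF assms(2,3) True] * by metis
    next
      case False
      then show ?thesis using c_nonneg[OF assms(1)] by simp
    qed
  qed (use tail_le_surplus order_trans in blast)
  finally show ?thesis .
qed

lemma surplus_reservation_le: "i \<in> A \<Longrightarrow> 0 \<le> \<alpha> \<Longrightarrow> surplus i \<alpha> (reservation i \<alpha>) \<le> c i"
  using reservation_le_iff[of i \<alpha> "reservation i \<alpha>"] reservation_nonneg by simp

text \<open>A positive maximum is attained by one of the lines, whose tail alone already gains the
  full cost.\<close>

lemma surplus_reservation:
  assumes "i \<in> A" "0 \<le> \<alpha>" "0 < reservation i \<alpha>"
  shows "surplus i \<alpha> (reservation i \<alpha>) = c i"
proof (rule antisym[OF surplus_reservation_le[OF assms(1,2)]])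
  have "reservation i \<alpha> \<in> insert 0 ((\<lambda>j. (\<alpha> * tail_r i (r j) - c i) / tail_p i (r j)) ` {j \<in> J. 0 < tail_p i (r j)})"
    unfolding reservation_def by (intro Max_in) auto
  then obtain j where "0 < tail_p i (r j)" "reservation i \<alpha> = (\<alpha> * tail_r i (r j) - c i) / tail_p i (r j)"
    using assms(3) by auto
  then have "c i = \<alpha> * tail_r i (r j) - reservation i \<alpha> * tail_p i (r j)" by simp
  then show "c i \<le> surplus i \<alpha> (reservation i \<alpha>)" using tail_le_surplus[of \<alpha> i "r j" "reservation i \<alpha>"] by simp
qed

section \<open>The value function and its Bellman equation\<close>

definition capped :: "real \<Rightarrow> nat \<Rightarrow> nat \<Rightarrow> real" where
  "capped \<alpha> i j = min (\<alpha> * r j) (reservation i \<alpha>)"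

definition best_capped :: "real \<Rightarrow> nat set \<Rightarrow> real \<Rightarrow> (nat \<Rightarrow> nat) \<Rightarrow> real" where
  "best_capped \<alpha> S y x = Max (insert y ((\<lambda>i. capped \<alpha> i (x i)) ` S))"

text \<open>Candidate for the optimal continuation value when the actions in S are untaken and the
  best revealed value is y.\<close>

definition capped_value :: "real \<Rightarrow> nat set \<Rightarrow> real \<Rightarrow> real" where
  "capped_value \<alpha> S y = expect S (best_capped \<alpha> S y)"

lemma best_capped_ge: "finite S \<Longrightarrow> y \<le> best_capped \<alpha> S y x"
  unfolding best_capped_def by (intro Max_ge) auto

lemma best_capped_max:
  assumes "finite S"
  shows "best_capped \<alpha> S (max y z) = (\<lambda>x. max z (best_capped \<alpha> S y x))"
  unfolding best_capped_def using assms
  by (cases "S = {}") (simp_all add: fun_eq_iff max.assoc max.left_commute[of y] max.commute[of y])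

lemma best_capped_remove:
  assumes "finite S" "i \<in> S"
  shows "best_capped \<alpha> S y (x(i := j)) = max (capped \<alpha> i j) (best_capped \<alpha> (S - {i}) y x)"
proof -
  have "insert y ((\<lambda>k. capped \<alpha> k ((x(i := j)) k)) ` S) =
      insert (capped \<alpha> i j) (insert y ((\<lambda>k. capped \<alpha> k (x k)) ` (S - {i})))"
    using assms(2) by auto
  then show ?thesis unfolding best_capped_def using assms by (simp only:) (subst Max_insert, auto)
qed

lemma best_capped_le:
  assumes "finite S" "y \<le> s" "\<And>i. i \<in> S \<Longrightarrow> reservation i \<alpha> \<le> s"
  shows "best_capped \<alpha> S y x \<le> s"
  unfolding best_capped_def capped_def using assms by (subst Max_le_iff) (auto simp: min_le_iff_disj)

text \<open>The cost is paid back exactly by the surplus above the reservation value, as long as the fallback \<open>z\<close>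
  does not exceed the reservation value.\<close>

lemma one_step_le:
  assumes "i \<in> A" "0 \<le> \<alpha>" "0 \<le> z"
  shows "(\<Sum>j\<in>J. q i j * max (\<alpha> * r j) z) - c i \<le> (\<Sum>j\<in>J. q i j * max (capped \<alpha> i j) z)"
    and "z \<le> reservation i \<alpha> \<Longrightarrow> 0 < reservation i \<alpha> \<Longrightarrow>
      (\<Sum>j\<in>J. q i j * max (\<alpha> * r j) z) - c i = (\<Sum>j\<in>J. q i j * max (capped \<alpha> i j) z)"
proof -
  show eq: "(\<Sum>j\<in>J. q i j * max (\<alpha> * r j) z) - c i = (\<Sum>j\<in>J. q i j * max (capped \<alpha> i j) z)"
    if "z \<le> reservation i \<alpha>" "0 < reservation i \<alpha>"
  proof -
    have "(\<Sum>j\<in>J. q i j * max (\<alpha> * r j) z) - (\<Sum>j\<in>J. q i j * max (capped \<alpha> i j) z) =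
        surplus i \<alpha> (reservation i \<alpha>)"
      unfolding surplus_def sum_subtractf[symmetric]
      using that by (intro sum.cong) (auto simp: capped_def right_diff_distrib[symmetric] max_def min_def)
    then show ?thesis using surplus_reservation[OF assms(1,2) that(2)] by simp
  qed
  show "(\<Sum>j\<in>J. q i j * max (\<alpha> * r j) z) - c i \<le> (\<Sum>j\<in>J. q i j * max (capped \<alpha> i j) z)"
  proof (cases "z < reservation i \<alpha>")
    case True
    then show ?thesis using eq assms by simp
  next
    case False
    have "(\<Sum>j\<in>J. q i j * max (\<alpha> * r j) z) - (\<Sum>j\<in>J. q i j * z) = surplus i \<alpha> z"
      unfolding surplus_def sum_subtractf[symmetric]
      by (intro sum.cong) (auto simp: right_diff_distrib[symmetric] max_def)
    moreover have "surplus i \<alpha> z \<le> c i" using reservation_le_iff[OF assms] False by simp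
    moreover have "(\<Sum>j\<in>J. q i j * z) \<le> (\<Sum>j\<in>J. q i j * max (capped \<alpha> i j) z)"
      by (intro sum_mono mult_left_mono) auto
    ultimately show ?thesis by linarith
  qed
qed

lemma capped_value_remove:
  assumes "S \<subseteq> A" "i \<in> S"
  shows "capped_value \<alpha> S y = expect (S - {i}) (\<lambda>x. \<Sum>j\<in>J. q i j * max (capped \<alpha> i j) (best_capped \<alpha> (S - {i}) y x))"
proof -
  have "finite S" using assms finite_subset finite_A by blast
  then show ?thesis unfolding capped_value_def using assms
    by (subst expect_remove[OF assms]) (simp add: best_capped_remove expect_sum)
qed

text \<open>Puts the values after all outcomes of the next action under one expectation over the
  other actions, so that \<open>one_step_le\<close> can be applied pointwise.\<close>

lemma capped_value_max:
  assumes "S \<subseteq> A"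
  shows "(\<Sum>j\<in>J. w j * capped_value \<alpha> S (max y (\<alpha> * r j))) =
    expect S (\<lambda>x. \<Sum>j\<in>J. w j * max (\<alpha> * r j) (best_capped \<alpha> S y x))"
proof -
  have "finite S" using assms finite_subset finite_A by blast
  then show ?thesis unfolding capped_value_def by (simp add: expect_sum best_capped_max)
qed

lemma bellman_le:
  assumes "S \<subseteq> A" "i \<in> S" "0 \<le> \<alpha>" "0 \<le> y"
  shows "(\<Sum>j\<in>J. q i j * capped_value \<alpha> (S - {i}) (max y (\<alpha> * r j))) - c i \<le> capped_value \<alpha> S y"
proof -
  have S: "S - {i} \<subseteq> A" "finite (S - {i})" "i \<in> A" using assms finite_subset[OF _ finite_A] by auto
  have "(\<Sum>j\<in>J. q i j * capped_value \<alpha> (S - {i}) (max y (\<alpha> * r j))) - c i =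
      expect (S - {i}) (\<lambda>x. (\<Sum>j\<in>J. q i j * max (\<alpha> * r j) (best_capped \<alpha> (S - {i}) y x)) - c i)"
    by (simp add: capped_value_max[OF S(1)] expect_diff expect_const[OF S(1)])
  also have "\<dots> \<le> capped_value \<alpha> S y"
    unfolding capped_value_remove[OF assms(1,2)]
    by (intro expect_mono one_step_le(1) S assms order_trans[OF assms(4) best_capped_ge])
  finally show ?thesis .
qed

text \<open>For an action of largest index, neither y nor the other capped values can exceed that
  index, so the pointwise one-step estimate is an equality.\<close>

lemma bellman_eq:
  assumes "S \<subseteq> A" "i \<in> S" "0 \<le> \<alpha>" "0 \<le> y" "y < reservation i \<alpha>" "\<And>k. k \<in> S \<Longrightarrow> reservation k \<alpha> \<le> reservation i \<alpha>"
  shows "(\<Sum>j\<in>J. q i j * capped_value \<alpha> (S - {i}) (max y (\<alpha> * r j))) - c i = capped_value \<alpha> S y"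
proof -
  have S: "S - {i} \<subseteq> A" "finite (S - {i})" "i \<in> A" using assms finite_subset[OF _ finite_A] by auto
  have "(\<Sum>j\<in>J. q i j * capped_value \<alpha> (S - {i}) (max y (\<alpha> * r j))) - c i =
      expect (S - {i}) (\<lambda>x. (\<Sum>j\<in>J. q i j * max (\<alpha> * r j) (best_capped \<alpha> (S - {i}) y x)) - c i)"
    by (simp add: capped_value_max[OF S(1)] expect_diff expect_const[OF S(1)])
  also have "\<dots> = capped_value \<alpha> S y"
    unfolding capped_value_remove[OF assms(1,2)]
    by (intro expect_cong one_step_le(2) S assms order_trans[OF assms(4) best_capped_ge] best_capped_le)
      (use assms in auto)
  finally show ?thesis .
qed

lemma capped_value_ge: "S \<subseteq> A \<Longrightarrow> y \<le> capped_value \<alpha> S y"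
  unfolding capped_value_def using expect_mono[of S "\<lambda>_. y" "best_capped \<alpha> S y"] best_capped_ge
    finite_subset[OF _ finite_A] by (auto simp: expect_const)

lemma capped_value_halt:
  assumes "S \<subseteq> A" "\<And>i. i \<in> S \<Longrightarrow> reservation i \<alpha> \<le> y"
  shows "capped_value \<alpha> S y = y"
proof -
  have "finite S" using assms(1) finite_subset finite_A by blast
  then have "best_capped \<alpha> S y = (\<lambda>_. y)"
    using best_capped_le[of S y y] best_capped_ge[of S y] assms(2) by (intro ext antisym) auto
  then show ?thesis unfolding capped_value_def using expect_const[OF assms(1)] by simp
qed

end

section \<open>Verification of the value function along runs\<close>

context independent_instance
begin

definition taken :: "history \<Rightarrow> nat set" where "taken h = fst ` set h"

definition rest :: "history \<Rightarrow> nat set" where "rest h = A - taken h"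

definition best :: "real \<Rightarrow> history \<Rightarrow> real" where
  "best \<alpha> h = Max ((\<lambda>j. \<alpha> * r j) ` insert 1 (snd ` set h))"

definition step :: "strategy \<Rightarrow> (nat \<Rightarrow> nat) \<Rightarrow> history \<Rightarrow> history" where
  "step \<pi> x h = (case \<pi> h of Take i \<Rightarrow> h @ [(i, x i)] | Halt j \<Rightarrow> h)"

text \<open>Unlike \<open>play\<close>, it may start from any history and unfolds at the front, as
  an induction over the remaining game requires.\<close>

definition run :: "strategy \<Rightarrow> (nat \<Rightarrow> nat) \<Rightarrow> nat \<Rightarrow> history \<Rightarrow> history" where
  "run \<pi> x k h = (step \<pi> x ^^ k) h"

lemma run_0 [simp]: "run \<pi> x 0 h = h"
  by (simp add: run_def)

lemma run_Suc: "run \<pi> x (Suc k) h = run \<pi> x k (step \<pi> x h)"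
  by (simp add: run_def funpow_swap1)

lemma play_eq_run: "play \<pi> x k = run \<pi> x k []"
  unfolding run_def by (induction k) (simp_all add: step_def split: decision.split)

lemma run_halt: "\<pi> h = Halt j \<Longrightarrow> run \<pi> x k h = h"
  by (induction k) (simp_all add: run_Suc step_def)

lemma rest_subset [simp]: "rest h \<subseteq> A" and finite_rest [simp]: "finite (rest h)"
  by (auto simp: rest_def)

lemma history_snoc: "h \<in> histories I \<Longrightarrow> i \<in> rest h \<Longrightarrow> j \<in> J \<Longrightarrow> h @ [(i, j)] \<in> histories I"
  by (auto simp: histories_def rest_def taken_def)

lemma rest_snoc: "rest (h @ [(i, j)]) = rest h - {i}"
  by (auto simp: rest_def taken_def)

lemma best_snoc: "best \<alpha> (h @ [(i, j)]) = max (best \<alpha> h) (\<alpha> * r j)"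
proof -
  have "(\<lambda>j. \<alpha> * r j) ` insert 1 (snd ` set (h @ [(i, j)])) =
      insert (\<alpha> * r j) ((\<lambda>j. \<alpha> * r j) ` insert 1 (snd ` set h))" by auto
  then show ?thesis unfolding best_def by (simp only:) (subst Max_insert, auto simp: max.commute)
qed

lemma best_ge: "j \<in> insert 1 (snd ` set h) \<Longrightarrow> \<alpha> * r j \<le> best \<alpha> h"
  unfolding best_def by (intro Max_ge) auto

lemma best_nonneg: "0 \<le> best \<alpha> h"
  using best_ge[of 1 h \<alpha>] by simp

lemma best_attained: obtains j where "j \<in> insert 1 (snd ` set h)" "best \<alpha> h = \<alpha> * r j"
proof -
  have "best \<alpha> h \<in> (\<lambda>j. \<alpha> * r j) ` insert 1 (snd ` set h)"
    unfolding best_def by (intro Max_in) auto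
  then show ?thesis by (rule imageE) (use that in blast)
qed

lemma sum_taken_snoc: "i \<in> rest h \<Longrightarrow> sum c (taken (h @ [(i, j)])) = sum c (taken h) + c i"
  by (auto simp: rest_def taken_def)

lemma legal_decision:
  assumes "\<pi> \<in> strategies I" "h \<in> histories I"
  obtains i where "\<pi> h = Take i" "i \<in> rest h"
  | j where "\<pi> h = Halt j" "j \<in> insert 1 (snd ` set h)"
proof -
  have "\<pi> h \<in> legal_decisions I h" using assms by (auto simp: strategies_def)
  then show ?thesis using that by (auto simp: legal_decisions_def rest_def taken_def)
qed

text \<open>Outcomes of actions already taken are recorded in the history and never read again. This
  permits changing coordinate i once i has been taken.\<close>

lemma run_cong:
  assumes "\<pi> \<in> strategies I" "\<And>i. x i \<in> J" "h \<in> histories I" "\<And>i. i \<in> rest h \<Longrightarrow> x i = x' i"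
  shows "run \<pi> x k h = run \<pi> x' k h"
  using assms(3,4)
proof (induction k arbitrary: h)
  case (Suc k)
  from legal_decision[OF assms(1) Suc.prems(1)] show ?case
  proof cases
    case (1 i)
    then have "step \<pi> x h = h @ [(i, x i)]" "step \<pi> x' h = h @ [(i, x i)]"
      using Suc.prems(2) by (auto simp: step_def)
    then show ?thesis
      using Suc.IH[OF history_snoc[OF Suc.prems(1) 1(2) assms(2)]] Suc.prems(2)
      by (simp add: run_Suc rest_snoc)
  next
    case (2 j)
    then show ?thesis by (simp add: run_halt)
  qed
qed simp

definition payoff :: "real \<Rightarrow> strategy \<Rightarrow> history \<Rightarrow> real" where
  "payoff \<alpha> \<pi> h = \<alpha> * r (final (\<pi> h)) - sum c (taken h)"

text \<open>Each decision has to attain the Bellman equality; no particular index rule is built in,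
  since the verification argument uses the equality only.\<close>

definition greedy :: "real \<Rightarrow> strategy \<Rightarrow> bool" where
  "greedy \<alpha> \<pi> \<longleftrightarrow> (\<forall>h\<in>histories I. capped_value \<alpha> (rest h) (best \<alpha> h) =
     (case \<pi> h of
        Take i \<Rightarrow> (\<Sum>j\<in>J. q i j * capped_value \<alpha> (rest h - {i}) (max (best \<alpha> h) (\<alpha> * r j))) - c i
      | Halt j \<Rightarrow> \<alpha> * r j))"

lemma expected_payoff_halt:
  assumes "\<pi> \<in> strategies I" "h \<in> histories I" "\<pi> h = Halt j"
  shows "expect (rest h) (\<lambda>x. payoff \<alpha> \<pi> (run \<pi> x k h)) \<le> capped_value \<alpha> (rest h) (best \<alpha> h) - sum c (taken h)"
    and "greedy \<alpha> \<pi> \<Longrightarrow>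
      expect (rest h) (\<lambda>x. payoff \<alpha> \<pi> (run \<pi> x k h)) = capped_value \<alpha> (rest h) (best \<alpha> h) - sum c (taken h)"
proof -
  have eq: "expect (rest h) (\<lambda>x. payoff \<alpha> \<pi> (run \<pi> x k h)) = \<alpha> * r j - sum c (taken h)"
    using assms(3) by (simp add: run_halt expect_const payoff_def)
  have "j \<in> insert 1 (snd ` set h)"
    using legal_decision[OF assms(1,2)] assms(3) by (metis decision.distinct(1) decision.inject(2))
  from best_ge[OF this] capped_value_ge[of "rest h" "best \<alpha> h" \<alpha>]
  show "expect (rest h) (\<lambda>x. payoff \<alpha> \<pi> (run \<pi> x k h)) \<le> capped_value \<alpha> (rest h) (best \<alpha> h) - sum c (taken h)"
    unfolding eq by (meson diff_right_mono order_trans rest_subset)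
  show "expect (rest h) (\<lambda>x. payoff \<alpha> \<pi> (run \<pi> x k h)) = capped_value \<alpha> (rest h) (best \<alpha> h) - sum c (taken h)"
    if "greedy \<alpha> \<pi>"
    unfolding eq using that assms(2,3) by (simp add: greedy_def)
qed

lemma expected_payoff_take:
  assumes "\<pi> \<in> strategies I" "h \<in> histories I" "\<pi> h = Take i" "i \<in> rest h"
  shows "expect (rest h) (\<lambda>x. payoff \<alpha> \<pi> (run \<pi> x (Suc k) h)) =
    (\<Sum>j\<in>J. q i j * expect (rest (h @ [(i, j)])) (\<lambda>x. payoff \<alpha> \<pi> (run \<pi> x k (h @ [(i, j)]))))"
proof -
  have "run \<pi> (x(i := j)) (Suc k) h = run \<pi> x k (h @ [(i, j)])"
    if "x \<in> set_pmf (joint_pmf (rest h - {i}))" "j \<in> J" for x j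
  proof -
    have x: "x m \<in> J" for m by (rule set_joint_pmf[OF _ that(1)]) (use rest_subset in blast)
    have "run \<pi> x k (h @ [(i, j)]) = run \<pi> (x(i := j)) k (h @ [(i, j)])"
      by (rule run_cong[OF assms(1) x history_snoc[OF assms(2,4) that(2)]]) (simp add: rest_snoc)
    then show ?thesis using assms(3) by (simp add: run_Suc step_def)
  qed
  then show ?thesis
    by (subst expect_remove[OF _ assms(4)]) (auto simp: rest_snoc intro!: sum.cong expect_cong)
qed

text \<open>Backward induction. Costs already paid are sunk and enter additively, the Bellman
  inequality bounds every strategy, and greedy decisions lose nothing. The k rounds suffice because
  each round removes an action unless the run has halted.\<close>

lemma expected_payoff:
  assumes "\<pi> \<in> strategies I" "0 \<le> \<alpha>" "h \<in> histories I" "card (rest h) \<le> k"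
  shows "expect (rest h) (\<lambda>x. payoff \<alpha> \<pi> (run \<pi> x k h)) \<le> capped_value \<alpha> (rest h) (best \<alpha> h) - sum c (taken h) \<and>
    (greedy \<alpha> \<pi> \<longrightarrow>
      expect (rest h) (\<lambda>x. payoff \<alpha> \<pi> (run \<pi> x k h)) = capped_value \<alpha> (rest h) (best \<alpha> h) - sum c (taken h))"
  using assms(3,4)
proof (induction k arbitrary: h)
  case 0
  then have "rest h = {}" by simp
  with legal_decision[OF assms(1) 0(1)] obtain j where "\<pi> h = Halt j" by auto
  from expected_payoff_halt[OF assms(1) 0(1) this] show ?case by blast
next
  case (Suc k)
  from legal_decision[OF assms(1) Suc.prems(1)] show ?case
  proof cases
    case (2 j)
    from expected_payoff_halt[OF assms(1) Suc.prems(1) 2(1)] show ?thesis by blast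
  next
    case (1 i)
    let ?V = "\<lambda>j. expect (rest (h @ [(i, j)])) (\<lambda>x. payoff \<alpha> \<pi> (run \<pi> x k (h @ [(i, j)])))"
    let ?w = "\<lambda>j. capped_value \<alpha> (rest h - {i}) (max (best \<alpha> h) (\<alpha> * r j))"
    have V: "expect (rest h) (\<lambda>x. payoff \<alpha> \<pi> (run \<pi> x (Suc k) h)) = (\<Sum>j\<in>J. q i j * ?V j)"
      by (rule expected_payoff_take[OF assms(1) Suc.prems(1) 1])
    have "card (rest h - {i}) \<le> k" using Suc.prems(2) 1(2) by simp
    then have IH: "?V j \<le> ?w j - (sum c (taken h) + c i)"
      "greedy \<alpha> \<pi> \<Longrightarrow> ?V j = ?w j - (sum c (taken h) + c i)" if "j \<in> J" for j
      using Suc.IH[OF history_snoc[OF Suc.prems(1) 1(2) that]]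
      by (simp_all add: rest_snoc best_snoc sum_taken_snoc[OF 1(2)])
    have "i \<in> A" using 1(2) by (simp add: rest_def)
    then have sum: "(\<Sum>j\<in>J. q i j * (?w j - (sum c (taken h) + c i))) =
        (\<Sum>j\<in>J. q i j * ?w j) - c i - sum c (taken h)"
      by (simp add: right_diff_distrib sum_subtractf sum_distrib_right[symmetric] sum_q)
    have "(\<Sum>j\<in>J. q i j * ?V j) \<le> (\<Sum>j\<in>J. q i j * (?w j - (sum c (taken h) + c i)))"
      by (intro sum_mono mult_left_mono IH) auto
    also have "\<dots> \<le> capped_value \<alpha> (rest h) (best \<alpha> h) - sum c (taken h)"
      unfolding sum using bellman_le[OF rest_subset 1(2) assms(2) best_nonneg, of \<alpha>] by simp
    finally have "(\<Sum>j\<in>J. q i j * ?V j) \<le> capped_value \<alpha> (rest h) (best \<alpha> h) - sum c (taken h)" .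
    moreover have "(\<Sum>j\<in>J. q i j * ?V j) = capped_value \<alpha> (rest h) (best \<alpha> h) - sum c (taken h)" if "greedy \<alpha> \<pi>"
    proof -
      have "(\<Sum>j\<in>J. q i j * ?V j) = (\<Sum>j\<in>J. q i j * (?w j - (sum c (taken h) + c i)))"
        using IH(2)[OF _ that] by (intro sum.cong) auto
      moreover have "capped_value \<alpha> (rest h) (best \<alpha> h) = (\<Sum>j\<in>J. q i j * ?w j) - c i"
        using that Suc.prems(1) 1(1) by (simp add: greedy_def)
      ultimately show ?thesis unfolding sum by simp
    qed
    ultimately show ?thesis unfolding V by blast
  qed
qed

text \<open>Weitzman's rule: halt once no remaining index exceeds the best revealed value, otherwise
  take an action of largest index.\<close>

lemma greedy_exists:
  assumes "0 \<le> \<alpha>"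
  obtains \<pi> where "\<pi> \<in> strategies I" "greedy \<alpha> \<pi>"
proof -
  let ?good = "\<lambda>h d. capped_value \<alpha> (rest h) (best \<alpha> h) = (case d of
      Take i \<Rightarrow> (\<Sum>j\<in>J. q i j * capped_value \<alpha> (rest h - {i}) (max (best \<alpha> h) (\<alpha> * r j))) - c i
    | Halt j \<Rightarrow> \<alpha> * r j)"
  have ex: "\<exists>d. d \<in> legal_decisions I h \<and> ?good h d" for h
  proof (cases "\<forall>i\<in>rest h. reservation i \<alpha> \<le> best \<alpha> h")
    case True
    obtain j where j: "j \<in> insert 1 (snd ` set h)" "best \<alpha> h = \<alpha> * r j" using best_attained by blast
    have "?good h (Halt j)" using capped_value_halt[OF rest_subset, of h \<alpha> "best \<alpha> h"] True j by simp
    moreover have "Halt j \<in> legal_decisions I h" using j(1) by (auto simp: legal_decisions_def)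
    ultimately show ?thesis by blast
  next
    case False
    then obtain k where k: "k \<in> rest h" "best \<alpha> h < reservation k \<alpha>" by auto
    have "Max ((\<lambda>i. reservation i \<alpha>) ` rest h) \<in> (\<lambda>i. reservation i \<alpha>) ` rest h" using k by (intro Max_in) auto
    then obtain i where i: "i \<in> rest h" "reservation i \<alpha> = Max ((\<lambda>i. reservation i \<alpha>) ` rest h)" by auto
    have le: "reservation m \<alpha> \<le> reservation i \<alpha>" if "m \<in> rest h" for m
      unfolding i(2) using that by (intro Max_ge) auto
    have "best \<alpha> h < reservation i \<alpha>" using k le[OF k(1)] by simp
    from bellman_eq[OF rest_subset i(1) assms best_nonneg this le]
    have "?good h (Take i)" by simp
    moreover have "Take i \<in> legal_decisions I h"
      using i(1) by (auto simp: legal_decisions_def rest_def taken_def)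
    ultimately show ?thesis by blast
  qed
  define d where "d h = (SOME d. d \<in> legal_decisions I h \<and> ?good h d)" for h
  have d: "d h \<in> legal_decisions I h" "?good h (d h)" for h
    using someI_ex[OF ex[of h]] unfolding d_def by blast+
  have "restrict d (histories I) \<in> strategies I" using d(1) by (auto simp: strategies_def)
  moreover have "greedy \<alpha> (restrict d (histories I))" using d(2) by (auto simp: greedy_def)
  ultimately show ?thesis using that by blast
qed

section \<open>Strategies as lines under linear contracts\<close>

definition last_history :: "strategy \<Rightarrow> (nat \<Rightarrow> nat) \<Rightarrow> history" where
  "last_history \<pi> x = run \<pi> x (num_actions I) []"

definition exp_reward :: "strategy \<Rightarrow> real" where
  "exp_reward \<pi> = expect A (\<lambda>x. r (final (\<pi> (last_history \<pi> x))))"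

definition exp_cost :: "strategy \<Rightarrow> real" where
  "exp_cost \<pi> = expect A (\<lambda>x. sum c (taken (last_history \<pi> x)))"

text \<open>The law is arbitrary outside the action set; once these coordinates are reset to the
  default, independence makes it the product law.\<close>

lemma joint_pmf_A: "joint_pmf A = map_pmf (\<lambda>x i. if i \<in> A then x i else 1) (law I)"
proof (rule pmf_eqI)
  fix y :: "nat \<Rightarrow> nat"
  let ?g = "\<lambda>(x :: nat \<Rightarrow> nat) i. if i \<in> A then x i else 1"
  show "pmf (joint_pmf A) y = pmf (map_pmf ?g (law I)) y"
  proof (cases "\<forall>i. i \<notin> A \<longrightarrow> y i = 1")
    case False
    then have "?g -` {y} = {}" by auto
    then have "pmf (map_pmf ?g (law I)) y = 0" by (simp add: pmf_map)
    then show ?thesis using False by (auto simp: joint_pmf_def pmf_Pi)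
  next
    case True
    then have v: "?g -` {y} = {x. \<forall>i\<in>A. x i = y i}" by (auto simp: fun_eq_iff)
    have "measure_pmf.prob (law I) {x. \<forall>i\<in>A. x i = y i} = (\<Prod>i\<in>A. q i (y i))"
    proof (cases "A = {}")
      case False
      have indep: "prob_space.indep_vars (measure_pmf (law I)) (\<lambda>_. count_space UNIV) (\<lambda>i x. x i) A"
        using model by (simp add: independent_action_model_def)
      have "{x. \<forall>i\<in>A. x i = y i} = (\<Inter>i\<in>A. (\<lambda>x. x i) -` {y i} \<inter> space (measure_pmf (law I)))"
        using False by auto
      also have "measure_pmf.prob (law I) \<dots> =
          (\<Prod>i\<in>A. measure_pmf.prob (law I) ((\<lambda>x. x i) -` {y i} \<inter> space (measure_pmf (law I))))"
        by (rule prob_space.indep_varsD_finite[OF measure_pmf.prob_space_axioms indep False]) auto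
      also have "\<dots> = (\<Prod>i\<in>A. q i (y i))" by (simp add: p_def pmf_map)
      finally show ?thesis .
    qed simp
    then show ?thesis using True v by (simp add: joint_pmf_def pmf_Pi' pmf_map)
  qed
qed

text \<open>A run reads only coordinates of actions, so resetting the others does not change
  it.\<close>

lemma expectation_law:
  assumes "\<pi> \<in> strategies I"
  shows "measure_pmf.expectation (law I) (\<lambda>x. f (last_history \<pi> x)) = expect A (\<lambda>x. f (last_history \<pi> x))"
proof -
  let ?g = "\<lambda>(x :: nat \<Rightarrow> nat) i. if i \<in> A then x i else 1"
  have "last_history \<pi> x = last_history \<pi> (?g x)" if "x \<in> set_pmf (law I)" for x
  proof -
    have "?g x i \<in> J" for i
      using that model one_in_J by (auto simp: independent_action_model_def is_instance_def)
    then have "run \<pi> (?g x) (num_actions I) [] = run \<pi> x (num_actions I) []"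
      by (intro run_cong[OF assms]) (auto simp: histories_def rest_def)
    then show ?thesis by (simp add: last_history_def)
  qed
  then have "measure_pmf.expectation (law I) (\<lambda>x. f (last_history \<pi> x)) =
      measure_pmf.expectation (law I) (\<lambda>x. f (last_history \<pi> (?g x)))"
    by (intro integral_cong_AE) (auto simp: AE_measure_pmf_iff)
  also have "\<dots> = measure_pmf.expectation (joint_pmf A) (\<lambda>x. f (last_history \<pi> x))"
    unfolding joint_pmf_A by simp
  finally show ?thesis by (simp add: expect_expectation)
qed

lemma agent_utility_linear:
  assumes "\<pi> \<in> strategies I"
  shows "agent_utility I (linear_contract I \<alpha>) \<pi> = \<alpha> * exp_reward \<pi> - exp_cost \<pi>"
proof -
  have "agent_utility I (linear_contract I \<alpha>) \<pi> =
      measure_pmf.expectation (law I) (\<lambda>x. (\<lambda>h. \<alpha> * r (final (\<pi> h)) - sum c (taken h)) (last_history \<pi> x))"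
    by (simp add: agent_utility_def linear_contract_def final_outcome_def actions_taken_def
      final_history_def play_eq_run last_history_def taken_def)
  also have "\<dots> = expect A (\<lambda>x. (\<lambda>h. \<alpha> * r (final (\<pi> h)) - sum c (taken h)) (last_history \<pi> x))"
    by (rule expectation_law[OF assms])
  finally show ?thesis by (simp add: exp_reward_def exp_cost_def expect_diff expect_mult)
qed

text \<open>Hence for \<alpha> < 1 ties are broken towards larger expected reward, while for
  \<alpha> = 1 the principal is indifferent.\<close>

lemma principal_utility_linear:
  assumes "\<pi> \<in> strategies I"
  shows "principal_utility I (linear_contract I \<alpha>) \<pi> = (1 - \<alpha>) * exp_reward \<pi>"
proof -
  have "principal_utility I (linear_contract I \<alpha>) \<pi> =
      measure_pmf.expectation (law I) (\<lambda>x. (\<lambda>h. (1 - \<alpha>) * r (final (\<pi> h))) (last_history \<pi> x))"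
    by (simp add: principal_utility_def linear_contract_def final_outcome_def
      final_history_def play_eq_run last_history_def algebra_simps)
  also have "\<dots> = expect A (\<lambda>x. (\<lambda>h. (1 - \<alpha>) * r (final (\<pi> h))) (last_history \<pi> x))"
    by (rule expectation_law[OF assms])
  finally show ?thesis by (simp only: exp_reward_def expect_mult)
qed

lemma finite_histories: "finite (histories I)"
proof -
  have "histories I \<subseteq> {h. set h \<subseteq> A \<times> J \<and> length h \<le> num_actions I}"
  proof safe
    fix h assume h: "h \<in> histories I"
    then have "length h = card (set (map fst h))" using distinct_card[of "map fst h"] by (simp add: histories_def)
    also have "\<dots> \<le> card A" using h by (intro card_mono) (auto simp: histories_def)
    finally show "length h \<le> num_actions I" by (simp add: actions_def)
  qed (auto simp: histories_def)
  moreover have "finite {h. set h \<subseteq> A \<times> J \<and> length h \<le> num_actions I}"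
    by (intro finite_lists_length_le) auto
  ultimately show ?thesis by (rule finite_subset)
qed

lemma finite_strategies: "finite (strategies I)"
  unfolding strategies_def using finite_histories by (intro finite_PiE) (auto simp: legal_decisions_def)

end

sublocale independent_instance \<subseteq> line_family "strategies I" exp_reward exp_cost
proof
  show "strategies I \<noteq> {}" using greedy_exists[of 0] by auto
qed (rule finite_strategies)

context independent_instance
begin

theorem upper_eq_capped_value:
  assumes "0 \<le> \<alpha>"
  shows "upper \<alpha> = capped_value \<alpha> A 0"
proof -
  have h: "[] \<in> histories I" "rest [] = A" "taken [] = {}" "best \<alpha> [] = 0" "card A = num_actions I"
    by (auto simp: histories_def rest_def taken_def best_def actions_def)
  have "\<alpha> * exp_reward \<pi> - exp_cost \<pi> = expect (rest []) (\<lambda>x. payoff \<alpha> \<pi> (run \<pi> x (num_actions I) []))" for \<pi>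
    by (simp add: h exp_reward_def exp_cost_def payoff_def last_history_def expect_diff expect_mult)
  then have *: "\<pi> \<in> strategies I \<Longrightarrow> \<alpha> * exp_reward \<pi> - exp_cost \<pi> \<le> capped_value \<alpha> A 0 \<and>
      (greedy \<alpha> \<pi> \<longrightarrow> \<alpha> * exp_reward \<pi> - exp_cost \<pi> = capped_value \<alpha> A 0)" for \<pi>
    using expected_payoff[OF _ assms h(1), of \<pi> "num_actions I"] by (simp add: h)
  obtain \<pi> where "\<pi> \<in> strategies I" "greedy \<alpha> \<pi>" using greedy_exists[OF assms] by blast
  with * show ?thesis by (intro upper_eqI[of \<alpha> _ \<pi>]) auto
qed

end

section \<open>Critical values and kinks\<close>

text \<open>Makes the definite description in \<open>best_response\<close> well defined;
  \<open>(a, b)\<close> in T means that a is chosen before b.\<close>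

lemma linear_order_least:
  assumes "linear_order_on X T" "S \<subseteq> X" "finite S" "S \<noteq> {}"
  shows "\<exists>!a. a \<in> S \<and> (\<forall>b\<in>S. (a, b) \<in> T)"
proof -
  have "refl_on X T" and tr: "trans T" and an: "antisym T" and tot: "total_on X T"
    using assms(1) by (simp_all add: linear_order_on_def partial_order_on_def preorder_on_def)
  have refl: "(a, a) \<in> T" if "a \<in> X" for a using \<open>refl_on X T\<close> that by (rule refl_onD)
  have total: "(a, b) \<in> T \<or> (b, a) \<in> T" if "a \<in> X" "b \<in> X" for a b
    using tot refl that by (cases "a = b") (auto simp: total_on_def)
  have "\<exists>a. a \<in> S \<and> (\<forall>b\<in>S. (a, b) \<in> T)"
    using assms(3,4,2)
  proof (induction S rule: finite_ne_induct)
    case (insert x S)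
    then obtain a where a: "a \<in> S" "\<forall>b\<in>S. (a, b) \<in> T" by auto
    consider "(x, a) \<in> T" | "(a, x) \<in> T" using total[of x a] a insert.prems by auto
    then show ?case
    proof cases
      case 1
      then have "(x, b) \<in> T" if "b \<in> insert x S" for b
        using a refl[of x] insert.prems that transD[OF tr 1] by auto
      then show ?thesis by blast
    next
      case 2
      then show ?thesis using a by (intro exI[of _ a]) simp
    qed
  qed (use refl in auto)
  then obtain a where a: "a \<in> S" "\<forall>b\<in>S. (a, b) \<in> T" by blast
  then show ?thesis
    by (intro ex1I[of _ a] conjI) (use antisymD[OF an] in blast)+
qed

text \<open>An injection into the naturals gives the order, with s moved to the front. It is needed
  at \<alpha> = 1, where the order decides among all optimal strategies.\<close>

lemma linear_order_with_least:
  assumes "finite X" "s \<in> X"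
  obtains T where "linear_order_on X T" "\<And>a. a \<in> X \<Longrightarrow> (s, a) \<in> T"
proof -
  obtain f :: "'a \<Rightarrow> nat" where f: "inj_on f X" using finite_imp_inj_to_nat_seg[OF assms(1)] by blast
  define g where "g a = (if a = s then 0 else Suc (f a))" for a
  have g: "inj_on g X" using f by (auto simp: inj_on_def g_def)
  define T where "T = {(a, b). a \<in> X \<and> b \<in> X \<and> g a \<le> g b}"
  have "linear_order_on X T"
    unfolding linear_order_on_def partial_order_on_def preorder_on_def refl_on_def total_on_def trans_def antisym_def T_def
    using g by (auto simp: inj_on_def)
  moreover have "(s, a) \<in> T" if "a \<in> X" for a using that assms by (auto simp: T_def g_def)
  ultimately show ?thesis using that by blast
qed

section \<open>Best responses at kinks and elsewhere\<close>

context independent_instance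
begin

lemma agent_optimal_linear: "agent_optimal I (linear_contract I \<alpha>) = opt \<alpha>"
  unfolding agent_optimal_def opt_def by (auto simp: agent_utility_linear)

lemma opt_strategies: "opt \<alpha> \<subseteq> strategies I"
  by (auto simp: opt_def)

abbreviation preferred :: "real \<Rightarrow> strategy set" where
  "preferred \<alpha> \<equiv> principal_preferred I (linear_contract I \<alpha>)"

lemma preferred_eq:
  "preferred \<alpha> = {\<pi> \<in> opt \<alpha>. \<forall>\<sigma>\<in>opt \<alpha>. (1 - \<alpha>) * exp_reward \<sigma> \<le> (1 - \<alpha>) * exp_reward \<pi>}"
  unfolding principal_preferred_def agent_optimal_linear
  using opt_strategies by (auto simp: principal_utility_linear subset_iff)

lemma finite_opt: "finite (opt \<alpha>)"
  using opt_strategies finite_strategies finite_subset by blast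

lemma preferred_nonempty: "preferred \<alpha> \<noteq> {}"
proof -
  let ?f = "\<lambda>\<pi>. (1 - \<alpha>) * exp_reward \<pi>"
  have "Max (?f ` opt \<alpha>) \<in> ?f ` opt \<alpha>"
    using finite_opt opt_nonempty[of \<alpha>] by (intro Max_in) auto
  then obtain \<pi> where \<pi>: "\<pi> \<in> opt \<alpha>" "?f \<pi> = Max (?f ` opt \<alpha>)" by auto
  have "?f \<sigma> \<le> ?f \<pi>" if "\<sigma> \<in> opt \<alpha>" for \<sigma>
    unfolding \<pi>(2) using that finite_opt by (intro Max_ge) auto
  then show ?thesis using \<pi>(1) by (auto simp: preferred_eq)
qed

lemma preferred_least:
  assumes "tie_breaking_order I T"
  shows "\<exists>!\<pi>. \<pi> \<in> preferred \<alpha> \<and> (\<forall>\<sigma>\<in>preferred \<alpha>. (\<pi>, \<sigma>) \<in> T)"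
proof (rule linear_order_least)
  show "linear_order_on (strategies I) T" using assms by (simp add: tie_breaking_order_def)
  show "preferred \<alpha> \<subseteq> strategies I" using opt_strategies by (auto simp: preferred_eq)
  then show "finite (preferred \<alpha>)" using finite_strategies finite_subset by blast
qed (rule preferred_nonempty)

lemma best_response_preferred:
  assumes "tie_breaking_order I T"
  shows "best_response I T (linear_contract I \<alpha>) \<in> preferred \<alpha>"
  using theI'[OF preferred_least[OF assms, of \<alpha>]] unfolding best_response_def by blast

lemma best_response_eqI:
  assumes "tie_breaking_order I T" "\<pi> \<in> preferred \<alpha>" "\<And>\<sigma>. \<sigma> \<in> preferred \<alpha> \<Longrightarrow> (\<pi>, \<sigma>) \<in> T"
  shows "best_response I T (linear_contract I \<alpha>) = \<pi>"
  unfolding best_response_def using the1_equality[OF preferred_least[OF assms(1)]] assms(2,3) by blast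

text \<open>All optimal strategies then have the same expected reward and remain exactly the optimal
  ones nearby, so the set from which T selects does not change.\<close>

lemma best_response_settled:
  assumes "\<not> kink \<alpha>"
  shows "\<forall>\<^sub>F \<beta> in at_left \<alpha>. best_response I T (linear_contract I \<beta>) = best_response I T (linear_contract I \<alpha>)"
proof -
  obtain s where s: "s \<in> opt \<alpha>" using opt_nonempty by blast
  have pref: "preferred \<beta> = opt \<alpha>" if "opt \<beta> = opt \<alpha>" for \<beta>
  proof -
    have eq: "exp_reward \<sigma> = exp_reward \<pi>" if "\<sigma> \<in> opt \<alpha>" "\<pi> \<in> opt \<alpha>" for \<sigma> \<pi>
      using assms that unfolding kink_def by blast
    have "(1 - \<beta>) * exp_reward \<sigma> \<le> (1 - \<beta>) * exp_reward \<pi>" if "\<sigma> \<in> opt \<alpha>" "\<pi> \<in> opt \<alpha>" for \<sigma> \<pi>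
      using eq[OF that] by simp
    then show ?thesis unfolding preferred_eq \<open>opt \<beta> = opt \<alpha>\<close> by blast
  qed
  have "\<forall>\<^sub>F \<beta> in at_left \<alpha>. opt \<beta> = opt \<alpha> \<and> upper \<beta> = \<beta> * exp_reward s - exp_cost s"
    using opt_near[OF assms s] by (rule filter_leD[OF at_within_le_nhds])
  then show ?thesis
  proof eventually_elim
    case (elim \<beta>)
    then have "preferred \<beta> = preferred \<alpha>" using pref by simp
    then show ?case by (simp add: best_response_def)
  qed
qed

text \<open>A best response is always optimal, but s is beaten by u everywhere to the left of
  \<alpha>.\<close>

lemma best_response_changes:
  assumes "tie_breaking_order I T" "best_response I T (linear_contract I \<alpha>) = s" "s \<in> opt \<alpha>"
    "u \<in> opt \<alpha>" "exp_reward u < exp_reward s"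
  shows "\<not> (\<forall>\<^sub>F \<beta> in at_left \<alpha>.
    best_response I T (linear_contract I \<beta>) = best_response I T (linear_contract I \<alpha>))"
proof
  assume "\<forall>\<^sub>F \<beta> in at_left \<alpha>. best_response I T (linear_contract I \<beta>) = best_response I T (linear_contract I \<alpha>)"
  moreover have "\<forall>\<^sub>F \<beta> in at_left \<alpha>. \<beta> < \<alpha>" by (simp add: eventually_at_filter)
  ultimately have "\<forall>\<^sub>F \<beta> in at_left \<alpha>. False"
  proof eventually_elim
    case (elim \<beta>)
    then have "s \<in> opt \<beta>" using best_response_preferred[OF assms(1), of \<beta>] assms(2) by (simp add: preferred_eq)
    then show ?case using not_opt_left[OF assms(3-5)] elim by blast
  qed
  then show False by simp
qed

lemma critical_values_subset:
  "critical_values I T \<subseteq> {\<alpha>. 0 < \<alpha> \<and> \<alpha> \<le> 1 \<and> kink \<alpha>}"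
  unfolding critical_values_def using best_response_settled by blast

text \<open>Below 1 the principal's preference selects a largest expected reward, and at a kink some
  optimal strategy has a smaller one.\<close>

lemma critical_below_one:
  assumes "tie_breaking_order I T" "0 < \<alpha>" "\<alpha> < 1" "kink \<alpha>"
  shows "\<alpha> \<in> critical_values I T"
proof -
  let ?s = "best_response I T (linear_contract I \<alpha>)"
  have s: "?s \<in> opt \<alpha>" "\<And>\<sigma>. \<sigma> \<in> opt \<alpha> \<Longrightarrow> exp_reward \<sigma> \<le> exp_reward ?s"
    using best_response_preferred[OF assms(1), of \<alpha>] assms(3) by (auto simp: preferred_eq)
  obtain a b where ab: "a \<in> opt \<alpha>" "b \<in> opt \<alpha>" "exp_reward a \<noteq> exp_reward b"
    using assms(4) unfolding kink_def by blast
  then have "exp_reward a < exp_reward ?s \<or> exp_reward b < exp_reward ?s"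
    using s(2)[of a] s(2)[of b] by linarith
  then obtain u where "u \<in> opt \<alpha>" "exp_reward u < exp_reward ?s" using ab by blast
  then show ?thesis
    using best_response_changes[OF assms(1) refl s(1)] assms by (auto simp: critical_values_def)
qed

text \<open>At 1 every optimal strategy is preferred, so an order that puts the steeper of two
  optimal strategies first makes the best response change.\<close>

lemma one_critical_iff: "(\<exists>T. tie_breaking_order I T \<and> 1 \<in> critical_values I T) \<longleftrightarrow> kink 1"
proof
  assume "kink 1"
  then obtain a b where "a \<in> opt 1" "b \<in> opt 1" "exp_reward a \<noteq> exp_reward b"
    unfolding kink_def by blast
  then obtain s u where su: "s \<in> opt 1" "u \<in> opt 1" "exp_reward u < exp_reward s"
    using linorder_less_linear[of "exp_reward a" "exp_reward b"] by blast
  obtain T where T: "linear_order_on (strategies I) T" "\<And>a. a \<in> strategies I \<Longrightarrow> (s, a) \<in> T"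
    using linear_order_with_least[OF finite_strategies] su(1) opt_strategies by blast
  have tie: "tie_breaking_order I T" using T(1) by (simp add: tie_breaking_order_def)
  have "preferred 1 = opt 1" by (auto simp: preferred_eq)
  then have "best_response I T (linear_contract I 1) = s"
    using su(1) T(2) opt_strategies by (intro best_response_eqI[OF tie]) auto
  from best_response_changes[OF tie this su] tie
  show "\<exists>T. tie_breaking_order I T \<and> 1 \<in> critical_values I T" by (auto simp: critical_values_def)
qed (use critical_values_subset in blast)

text \<open>Stated for a filter so as to serve twice: near a point for the count, on an interval for
  the algorithm. For a fixed outcome vector Weitzman's formula is a maximum of minima of members of
  F, and the expectation is a finite combination of these with constant weights.\<close>

lemma upper_affine_along:
  assumes F: "comparable_along Fl F" "\<And>f. f \<in> F \<Longrightarrow> affine_along Fl f"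
    and nonneg: "\<forall>\<^sub>F \<alpha> in Fl. 0 \<le> \<alpha>"
    and rewards: "\<And>j. j \<in> J \<Longrightarrow> member_along Fl F (\<lambda>\<alpha>. \<alpha> * r j)"
    and indices: "\<And>i. i \<in> A \<Longrightarrow> member_along Fl F (reservation i)"
  shows "affine_along Fl upper"
proof -
  have "affine_along Fl (\<lambda>\<alpha>. best_capped \<alpha> A 0 x)" if "x \<in> set_pmf (joint_pmf A)" for x
  proof -
    have zero: "member_along Fl F (\<lambda>\<alpha>. 0)" using rewards[OF one_in_J] by simp
    have x: "x i \<in> J" for i using set_joint_pmf[OF order_refl that] .
    have "member_along Fl F (\<lambda>\<alpha>. min (\<alpha> * r (x i)) (reservation i \<alpha>))" if "i \<in> A" for i
      by (rule member_along_min[OF F(1) rewards[OF x] indices[OF that]])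
    then have "member_along Fl F (\<lambda>\<alpha>. best_capped \<alpha> A 0 x)"
      unfolding best_capped_def capped_def
      by (rule member_along_Max[OF F(1) finite_A zero, of "\<lambda>i \<alpha>. min (\<alpha> * r (x i)) (reservation i \<alpha>)"])
    then show ?thesis by (rule affine_along_member) (rule F(2))
  qed
  then have "affine_along Fl (\<lambda>\<alpha>. capped_value \<alpha> A 0)"
    unfolding capped_value_def expect_def
    by (rule affine_along_sum[where w = "pmf (joint_pmf A)" and g = "\<lambda>x \<alpha>. best_capped \<alpha> A 0 x"])
  then obtain \<rho> \<gamma> where "\<forall>\<^sub>F \<alpha> in Fl. capped_value \<alpha> A 0 = \<rho> * \<alpha> + \<gamma>" unfolding affine_along_def by blast
  with nonneg have "\<forall>\<^sub>F \<alpha> in Fl. upper \<alpha> = \<rho> * \<alpha> + \<gamma>" by eventually_elim (simp add: upper_eq_capped_value)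
  then show ?thesis unfolding affine_along_def by blast
qed

text \<open>By scaling, the index of \<open>i\<close> at \<open>\<alpha>\<close> exceeds \<open>\<alpha> r\<^sub>j\<close> iff \<open>c\<^sub>i < \<alpha> h\<^sub>i\<^sub>j\<close> for the number \<open>h\<^sub>i\<^sub>j\<close> that
  does not depend on \<open>\<alpha>\<close>, so each pair \<open>(i, j)\<close> has a single switching point.\<close>

definition unit_surplus :: "nat \<Rightarrow> nat \<Rightarrow> real" where "unit_surplus i j = surplus i 1 (r j)"

text \<open>For \<alpha> \<ge> 0 these are the outcomes whose reward line lies strictly below the
  index; written with the threshold, growth in \<alpha> is evident.\<close>

definition above :: "nat \<Rightarrow> real \<Rightarrow> nat set" where "above i \<alpha> = {j \<in> J. c i < \<alpha> * unit_surplus i j}"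

text \<open>Free actions are excluded, as their index is itself a reward line.\<close>

definition switches :: "nat \<Rightarrow> real set" where
  "switches i = {\<alpha>. 0 < \<alpha> \<and> 0 < c i \<and> (\<exists>j\<in>J. \<alpha> * unit_surplus i j = c i)}"

text \<open>Only crossings not accounted for otherwise: at positive height, away from switching
  points, and where the indices do not coincide nearby. An index that is 0 at a non-switching point
  stays 0 nearby.\<close>

definition crossing_points :: "nat \<Rightarrow> nat \<Rightarrow> real set" where
  "crossing_points i k = {\<alpha>. 0 < \<alpha> \<and> 0 < c i \<and> 0 < c k \<and> \<alpha> \<notin> switches i \<and> \<alpha> \<notin> switches k \<and>
     0 < reservation i \<alpha> \<and> reservation i \<alpha> = reservation k \<alpha> \<and> \<not> (\<forall>\<^sub>F \<beta> in nhds \<alpha>. reservation i \<beta> = reservation k \<beta>)}"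

lemma unit_surplus_nonneg: "0 \<le> unit_surplus i j"
  unfolding unit_surplus_def surplus_def by (intro sum_nonneg) auto

lemma reservation_le_reward_iff:
  assumes "i \<in> A" "j \<in> J" "0 \<le> \<alpha>"
  shows "reservation i \<alpha> \<le> \<alpha> * r j \<longleftrightarrow> \<alpha> * unit_surplus i j \<le> c i"
proof -
  have "surplus i \<alpha> (\<alpha> * r j) = \<alpha> * unit_surplus i j"
    unfolding unit_surplus_def surplus_def sum_distrib_left using assms(3)
    by (intro sum.cong refl) (simp add: max_def right_diff_distrib mult_left_mono mult.left_commute
      mult_le_cancel_left)
  then show ?thesis using reservation_le_iff[OF assms(1,3), of "\<alpha> * r j"] r_nonneg[OF assms(2)] assms(3) by simp
qed

lemma above_iff: "i \<in> A \<Longrightarrow> 0 \<le> \<alpha> \<Longrightarrow> j \<in> above i \<alpha> \<longleftrightarrow> j \<in> J \<and> \<alpha> * r j < reservation i \<alpha>"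
  using reservation_le_reward_iff[of i j \<alpha>] by (auto simp: above_def not_le[symmetric])

lemma one_above_iff: "i \<in> A \<Longrightarrow> 0 \<le> \<alpha> \<Longrightarrow> 1 \<in> above i \<alpha> \<longleftrightarrow> 0 < reservation i \<alpha>"
  using above_iff[of i \<alpha> 1] one_in_J by simp

lemma above_mono: "\<alpha> \<le> \<beta> \<Longrightarrow> above i \<alpha> \<subseteq> above i \<beta>"
  unfolding above_def using mult_right_mono[OF _ unit_surplus_nonneg] by (force intro: less_le_trans)

lemma finite_above [simp]: "finite (above i \<alpha>)"
  by (simp add: above_def)

lemma above_near:
  assumes "\<alpha> \<notin> switches i" "0 < \<alpha>" "0 < c i"
  shows "\<forall>\<^sub>F \<beta> in nhds \<alpha>. above i \<beta> = above i \<alpha>"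
proof -
  have "\<forall>\<^sub>F \<beta> in nhds \<alpha>. \<forall>j\<in>J. c i < \<beta> * unit_surplus i j \<longleftrightarrow> c i < \<alpha> * unit_surplus i j"
  proof (intro eventually_ball_finite ballI)
    fix j assume "j \<in> J"
    then consider "c i < \<alpha> * unit_surplus i j" | "\<alpha> * unit_surplus i j < c i"
      using assms unfolding switches_def by force
    then show "\<forall>\<^sub>F \<beta> in nhds \<alpha>. c i < \<beta> * unit_surplus i j \<longleftrightarrow> c i < \<alpha> * unit_surplus i j"
    proof cases
      case 1
      then have "\<forall>\<^sub>F \<beta> in nhds \<alpha>. c i < \<beta> * unit_surplus i j"
        by (intro eventually_nhds_in_open[of "{\<beta>. c i < \<beta> * unit_surplus i j}", simplified] open_Collect_less continuous_intros) auto
      then show ?thesis by eventually_elim (use 1 in simp)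
    next
      case 2
      then have "\<forall>\<^sub>F \<beta> in nhds \<alpha>. \<beta> * unit_surplus i j < c i"
        by (intro eventually_nhds_in_open[of "{\<beta>. \<beta> * unit_surplus i j < c i}", simplified] open_Collect_less continuous_intros) auto
      then show ?thesis by eventually_elim (use 2 in simp)
    qed
  qed simp
  then show ?thesis by eventually_elim (auto simp: above_def)
qed

text \<open>Solving the equation of \<open>c i\<close> with the sum over \<open>J - Q\<close> of
  \<open>q i j\<close> (\<alpha> \<open>r j\<close> - s) for s gives slope times \<alpha> minus
  offset.\<close>

definition slope :: "nat \<Rightarrow> nat set \<Rightarrow> real" where
  "slope i Q = (\<Sum>j\<in>J - Q. q i j * r j) / (\<Sum>j\<in>J - Q. q i j)"

definition offset :: "nat \<Rightarrow> nat set \<Rightarrow> real" where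
  "offset i Q = c i / (\<Sum>j\<in>J - Q. q i j)"

text \<open>Outcomes below the index contribute nothing to the surplus, so the defining equation
  becomes linear; its denominator is nonzero because the cost is positive.\<close>

lemma reservation_affine:
  assumes "i \<in> A" "0 \<le> \<alpha>" "0 < c i" "1 \<in> above i \<alpha>"
  shows "reservation i \<alpha> = slope i (above i \<alpha>) * \<alpha> - offset i (above i \<alpha>)"
proof -
  let ?Q = "above i \<alpha>"
  have pos: "0 < reservation i \<alpha>" using one_above_iff assms by blast
  have "c i = (\<Sum>j\<in>J. q i j * max 0 (\<alpha> * r j - reservation i \<alpha>))"
    using surplus_reservation[OF assms(1,2) pos] by (simp add: surplus_def)
  also have "\<dots> = (\<Sum>j\<in>J - ?Q. q i j * (\<alpha> * r j - reservation i \<alpha>))"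
    by (intro sum.mono_neutral_cong_right) (auto simp: above_iff[OF assms(1,2)])
  also have "\<dots> = \<alpha> * (\<Sum>j\<in>J - ?Q. q i j * r j) - reservation i \<alpha> * (\<Sum>j\<in>J - ?Q. q i j)"
    by (simp add: sum_distrib_left sum_subtractf[symmetric] algebra_simps)
  finally have eq: "c i = \<alpha> * (\<Sum>j\<in>J - ?Q. q i j * r j) - reservation i \<alpha> * (\<Sum>j\<in>J - ?Q. q i j)" .
  have "(\<Sum>j\<in>J - ?Q. q i j) \<noteq> 0"
  proof
    assume 0: "(\<Sum>j\<in>J - ?Q. q i j) = 0"
    then have "\<forall>j\<in>J - ?Q. q i j = 0" by (subst (asm) sum_nonneg_eq_0_iff) auto
    then have "(\<Sum>j\<in>J - ?Q. q i j * r j) = 0" by simp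
    then show False using eq 0 assms(3) by simp
  qed
  then show ?thesis using eq by (simp add: slope_def offset_def field_simps)
qed

lemma reservation_zero: "i \<in> A \<Longrightarrow> 0 \<le> \<alpha> \<Longrightarrow> 1 \<notin> above i \<alpha> \<Longrightarrow> reservation i \<alpha> = 0"
  using one_above_iff[of i \<alpha>] reservation_nonneg[of i \<alpha>] by simp

lemma eventually_nonneg_nhds: "0 < \<alpha> \<Longrightarrow> \<forall>\<^sub>F \<beta> in nhds \<alpha>. 0 \<le> (\<beta>::real)"
  by (rule eventually_mono[OF eventually_nhds_in_open[of "{0<..}"]]) auto

lemma reservation_affine_near:
  assumes "i \<in> A" "\<alpha> \<notin> switches i" "0 < \<alpha>" "0 < c i"
  shows "affine_along (nhds \<alpha>) (reservation i)"
proof (cases "1 \<in> above i \<alpha>")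
  case True
  have "\<forall>\<^sub>F \<beta> in nhds \<alpha>. reservation i \<beta> = slope i (above i \<alpha>) * \<beta> + (- offset i (above i \<alpha>))"
    using above_near[OF assms(2-4)] eventually_nonneg_nhds[OF assms(3)]
    by eventually_elim (use reservation_affine assms True in auto)
  then show ?thesis unfolding affine_along_def by blast
next
  case False
  have "\<forall>\<^sub>F \<beta> in nhds \<alpha>. reservation i \<beta> = 0 * \<beta> + 0"
    using above_near[OF assms(2-4)] eventually_nonneg_nhds[OF assms(3)]
    by eventually_elim (use reservation_zero assms False in auto)
  then show ?thesis unfolding affine_along_def by blast
qed

text \<open>The surplus at the index has to vanish, so the index is \<alpha> times the largest
  reward that occurs with positive probability.\<close>

lemma reservation_free:
  assumes "i \<in> A" "c i = 0"
  obtains j where "j \<in> J" "\<And>\<alpha>. 0 \<le> \<alpha> \<Longrightarrow> reservation i \<alpha> = \<alpha> * r j"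
proof -
  define K where "K = {k \<in> J. 0 < q i k}"
  have "K \<noteq> {}"
  proof
    assume "K = {}"
    then have "\<forall>k\<in>J. q i k = 0" unfolding K_def using pmf_nonneg by (force simp: order_less_le)
    then show False using sum_q[OF assms(1)] by simp
  qed
  have "finite K" by (simp add: K_def)
  then have "Max (r ` K) \<in> r ` K" using \<open>K \<noteq> {}\<close> by (intro Max_in) auto
  then obtain j where j: "j \<in> K" "r j = Max (r ` K)" by auto
  have le: "r k \<le> r j" if "k \<in> K" for k unfolding j(2) using that \<open>finite K\<close> by (intro Max_ge) auto
  have "reservation i \<alpha> = \<alpha> * r j" if \<alpha>: "0 \<le> \<alpha>" for \<alpha>
  proof (rule antisym)
    have "q i k * max 0 (\<alpha> * r k - \<alpha> * r j) = 0" if "k \<in> J" for k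
    proof (cases "k \<in> K")
      case True
      then have "\<alpha> * r k \<le> \<alpha> * r j" using le \<alpha> by (intro mult_left_mono) auto
      then show ?thesis by simp
    next
      case False
      then have "q i k = 0" using that pmf_nonneg[of "p i" k] by (auto simp: K_def)
      then show ?thesis by simp
    qed
    then have "surplus i \<alpha> (\<alpha> * r j) = 0" unfolding surplus_def by (intro sum.neutral) auto
    then show "reservation i \<alpha> \<le> \<alpha> * r j"
      using reservation_le_iff[OF assms(1) \<alpha>, of "\<alpha> * r j"] j \<alpha> r_nonneg[of j] assms(2) by (simp add: K_def)
    show "\<alpha> * r j \<le> reservation i \<alpha>"
    proof (rule ccontr)
      assume "\<not> ?thesis"
      then have "0 < q i j * max 0 (\<alpha> * r j - reservation i \<alpha>)" using j by (auto simp: K_def)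
      also have "\<dots> \<le> surplus i \<alpha> (reservation i \<alpha>)"
        unfolding surplus_def using j(1) by (intro member_le_sum) (auto simp: K_def)
      finally show False using surplus_reservation_le[OF assms(1) \<alpha>] assms(2) by simp
    qed
  qed
  then show ?thesis using that j by (auto simp: K_def)
qed

section \<open>The order of rewards and indices near a point\<close>

definition exceptional :: "real set" where
  "exceptional = (\<Union>i\<in>A. switches i) \<union> (\<Union>i\<in>A. \<Union>k\<in>A. crossing_points i k)"

text \<open>Free actions are absent because their indices are reward lines for \<alpha> \<ge>
  0.\<close>

definition basic :: "(real \<Rightarrow> real) set" where
  "basic = (\<lambda>j \<alpha>. \<alpha> * r j) ` J \<union> reservation ` {i \<in> A. 0 < c i}"

lemma basic_comparable:
  assumes \<alpha>: "0 < \<alpha>" "\<alpha> \<notin> exceptional"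
  shows "comparable_along (nhds \<alpha>) basic"
proof -
  have nonneg: "\<forall>\<^sub>F \<beta> in nhds \<alpha>. 0 \<le> \<beta>" by (rule eventually_nonneg_nhds[OF \<alpha>(1)])
  have sw: "\<alpha> \<notin> switches i" if "i \<in> A" for i using \<alpha>(2) that by (auto simp: exceptional_def)
  have rr: "\<forall>\<^sub>F \<beta> in nhds \<alpha>. \<beta> * r j \<le> \<beta> * r k" if "r j \<le> r k" for j k
    using nonneg by eventually_elim (use that in \<open>simp add: mult_left_mono\<close>)
  have ir: "(\<forall>\<^sub>F \<beta> in nhds \<alpha>. reservation i \<beta> \<le> \<beta> * r j) \<or> (\<forall>\<^sub>F \<beta> in nhds \<alpha>. \<beta> * r j \<le> reservation i \<beta>)"
    if "i \<in> A" "0 < c i" "j \<in> J" for i j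
  proof (cases "j \<in> above i \<alpha>")
    case True
    have "\<forall>\<^sub>F \<beta> in nhds \<alpha>. \<beta> * r j \<le> reservation i \<beta>"
      using above_near[OF sw[OF that(1)] \<alpha>(1) that(2)] nonneg
      by eventually_elim (use above_iff[OF that(1)] True in \<open>auto intro: less_imp_le\<close>)
    then show ?thesis ..
  next
    case False
    have "\<forall>\<^sub>F \<beta> in nhds \<alpha>. reservation i \<beta> \<le> \<beta> * r j"
      using above_near[OF sw[OF that(1)] \<alpha>(1) that(2)] nonneg
      by eventually_elim (use above_iff[OF that(1)] False that in \<open>auto simp: not_less\<close>)
    then show ?thesis ..
  qed
  have ii: "\<forall>\<^sub>F \<beta> in nhds \<alpha>. reservation i \<beta> \<le> reservation k \<beta>"
    if "i \<in> A" "0 < c i" "k \<in> A" "0 < c k" "reservation i \<alpha> \<le> reservation k \<alpha>" for i k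
  proof -
    note ik = that
    consider "reservation i \<alpha> < reservation k \<alpha>" | "reservation i \<alpha> = 0" | "0 < reservation i \<alpha>" "reservation i \<alpha> = reservation k \<alpha>"
      using ik(5) reservation_nonneg[of i \<alpha>] by linarith
    then show ?thesis
    proof cases
      \<comment> \<open>The strict inequality at \<alpha> is passed to the affine pieces, for which
        it persists by continuity.\<close>
      case 1
      obtain \<rho> \<gamma> where l: "\<forall>\<^sub>F \<beta> in nhds \<alpha>. reservation i \<beta> = \<rho> * \<beta> + \<gamma>"
        using reservation_affine_near[OF ik(1) sw[OF ik(1)] \<alpha>(1) ik(2)] unfolding affine_along_def by blast
      obtain \<rho>' \<gamma>' where l': "\<forall>\<^sub>F \<beta> in nhds \<alpha>. reservation k \<beta> = \<rho>' * \<beta> + \<gamma>'"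
        using reservation_affine_near[OF ik(3) sw[OF ik(3)] \<alpha>(1) ik(4)] unfolding affine_along_def by blast
      have "\<forall>\<^sub>F \<beta> in nhds \<alpha>. \<rho> * \<beta> + \<gamma> < \<rho>' * \<beta> + \<gamma>'"
        using 1 eventually_nhds_x_imp_x[OF l] eventually_nhds_x_imp_x[OF l']
        by (intro eventually_nhds_in_open[of "{\<beta>. \<rho> * \<beta> + \<gamma> < \<rho>' * \<beta> + \<gamma>'}", simplified] open_Collect_less
          continuous_intros) auto
      with l l' show ?thesis by eventually_elim simp
    next
      \<comment> \<open>Outcome 1 has reward 0, so its absence from \<open>above\<close> means that
        the index is 0, and this persists away from switching points.\<close>
      case 2
      then have "1 \<notin> above i \<alpha>" using one_above_iff[OF ik(1), of \<alpha>] \<alpha>(1) by simp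
      show ?thesis using above_near[OF sw[OF ik(1)] \<alpha>(1) ik(2)] nonneg
      proof eventually_elim
        case (elim \<beta>)
        then have "reservation i \<beta> = 0" using \<open>1 \<notin> above i \<alpha>\<close> by (intro reservation_zero[OF ik(1)]) auto
        then show ?case using reservation_nonneg by simp
      qed
    next
      case 3
      have "\<alpha> \<notin> crossing_points i k" using \<alpha>(2) ik by (auto simp: exceptional_def)
      then have "\<forall>\<^sub>F \<beta> in nhds \<alpha>. reservation i \<beta> = reservation k \<beta>"
        using 3 ik \<alpha>(1) sw by (auto simp: crossing_points_def)
      then show ?thesis by eventually_elim simp
    qed
  qed
  show ?thesis
    unfolding comparable_along_def basic_def
  proof (intro ballI; elim UnE imageE CollectE conjE; clarify)
    fix j k assume "j \<in> J" "k \<in> J" "\<not> (\<forall>\<^sub>F x in nhds \<alpha>. x * r k \<le> x * r j)"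
    then show "\<forall>\<^sub>F x in nhds \<alpha>. x * r j \<le> x * r k" using rr[of j k] rr[of k j] by linarith
  next
    fix i k assume "i \<in> A" "0 < c i" "k \<in> A" "0 < c k" "\<not> (\<forall>\<^sub>F x in nhds \<alpha>. reservation k x \<le> reservation i x)"
    then show "\<forall>\<^sub>F x in nhds \<alpha>. reservation i x \<le> reservation k x" using ii[of i k] ii[of k i] by linarith
  qed (use ir in blast)+
qed

lemma kink_exceptional:
  assumes "0 < \<alpha>" "kink \<alpha>"
  shows "\<alpha> \<in> exceptional"
proof (rule ccontr)
  assume ex: "\<alpha> \<notin> exceptional"
  have "affine_along (nhds \<alpha>) upper"
  proof (rule upper_affine_along[of _ basic])
    show "comparable_along (nhds \<alpha>) basic" by (rule basic_comparable[OF assms(1) ex])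
    show "\<forall>\<^sub>F \<alpha> in nhds \<alpha>. 0 \<le> \<alpha>" by (rule eventually_nonneg_nhds[OF assms(1)])
    show "affine_along (nhds \<alpha>) f" if "f \<in> basic" for f
    proof -
      have "affine_along (nhds \<alpha>) (\<lambda>x. x * r j)" for j
        unfolding affine_along_def by (intro exI[of _ "r j"] exI[of _ 0]) simp
      moreover have "affine_along (nhds \<alpha>) (reservation i)" if "i \<in> A" "0 < c i" for i
        by (rule reservation_affine_near[OF that(1) _ assms(1) that(2)]) (use ex that in \<open>auto simp: exceptional_def\<close>)
      ultimately show ?thesis using that by (auto simp: basic_def)
    qed
    show "member_along (nhds \<alpha>) basic (\<lambda>\<alpha>. \<alpha> * r j)" if "j \<in> J" for j
      using that by (intro member_along_refl) (auto simp: basic_def)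
    show "member_along (nhds \<alpha>) basic (reservation i)" if i: "i \<in> A" for i
    proof (cases "c i = 0")
      case True
      obtain j where j: "j \<in> J" "\<And>\<alpha>. 0 \<le> \<alpha> \<Longrightarrow> reservation i \<alpha> = \<alpha> * r j" using reservation_free[OF i True] by blast
      have "\<forall>\<^sub>F \<beta> in nhds \<alpha>. reservation i \<beta> = \<beta> * r j"
        using eventually_nonneg_nhds[OF assms(1)] by eventually_elim (rule j(2))
      with j(1) show ?thesis unfolding member_along_def basic_def
        by (intro bexI[of _ "\<lambda>\<alpha>. \<alpha> * r j"]) auto
    next
      case False
      then show ?thesis using that c_nonneg[OF that] by (intro member_along_refl) (auto simp: basic_def)
    qed
  qed
  then show False using kink_not_affine_near[OF assms(2)] unfolding affine_along_def by blast
qed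

section \<open>Cardinality of the set of exceptional points\<close>

lemma card_J: "card J = num_outcomes I"
  by (simp add: outcomes_def)

text \<open>A positive cost forces \<open>unit_surplus i j\<close> to be nonzero, so each j yields
  at most one switching point.\<close>

lemma switches_bound: "finite (switches i) \<and> card (switches i) \<le> num_outcomes I"
proof -
  have "switches i \<subseteq> (\<lambda>j. c i / unit_surplus i j) ` J"
  proof
    fix \<alpha> assume "\<alpha> \<in> switches i"
    then obtain j where "j \<in> J" "\<alpha> * unit_surplus i j = c i" "0 < c i" by (auto simp: switches_def)
    moreover from this have "unit_surplus i j \<noteq> 0" by auto
    ultimately show "\<alpha> \<in> (\<lambda>j. c i / unit_surplus i j) ` J" by (intro image_eqI[of _ _ j]) (auto simp: field_simps)
  qed
  moreover have "finite ((\<lambda>j. c i / unit_surplus i j) ` J)" by simp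
  ultimately have "finite (switches i)" "card (switches i) \<le> card ((\<lambda>j. c i / unit_surplus i j) ` J)"
    by (auto intro: finite_subset card_mono)
  then show ?thesis
    using card_image_le[OF finite_J, of "\<lambda>j. c i / unit_surplus i j"] by (simp add: card_J)
qed

text \<open>The sets \<open>above i \<alpha>\<close> and \<open>above k \<alpha>\<close> grow with \<open>\<alpha>\<close> and determine both affine pieces, so that their
  total size identifies a crossing.\<close>

lemma crossing_points_bound:
  assumes "i \<in> A" "k \<in> A"
  shows "finite (crossing_points i k) \<and> card (crossing_points i k) \<le> 2 * num_outcomes I + 1"
proof -
  let ?X = "crossing_points i k"
  let ?f = "\<lambda>\<alpha>. card (above i \<alpha>) + card (above k \<alpha>)"
  \<comment> \<open>With equal counts, each index has the same affine piece at both crossings. The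
    two pieces then share two points and are equal, so the indices agree near \<alpha>, contrary to
    the definition of a crossing.\<close>
  have neq: "?f \<alpha> \<noteq> ?f \<beta>" if "\<alpha> \<in> ?X" "\<beta> \<in> ?X" "\<alpha> < \<beta>" for \<alpha> \<beta>
  proof
    assume f: "?f \<alpha> = ?f \<beta>"
    have X: "0 < \<alpha>" "0 < c i" "0 < c k" "\<alpha> \<notin> switches i" "\<alpha> \<notin> switches k" "0 < reservation i \<alpha>" "reservation i \<alpha> = reservation k \<alpha>"
      "reservation i \<beta> = reservation k \<beta>" "\<not> (\<forall>\<^sub>F \<beta> in nhds \<alpha>. reservation i \<beta> = reservation k \<beta>)"
      using that(1,2) by (auto simp: crossing_points_def)
    have sub: "above i \<alpha> \<subseteq> above i \<beta>" "above k \<alpha> \<subseteq> above k \<beta>" using that(3) by (auto intro!: above_mono)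
    then have "card (above i \<alpha>) \<le> card (above i \<beta>)" "card (above k \<alpha>) \<le> card (above k \<beta>)"
      by (auto intro: card_mono)
    then have "card (above i \<alpha>) = card (above i \<beta>)" "card (above k \<alpha>) = card (above k \<beta>)" using f by linarith+
    then have eq: "above i \<beta> = above i \<alpha>" "above k \<beta> = above k \<alpha>"
      using sub card_subset_eq[OF finite_above] by metis+
    define a where "a = slope i (above i \<alpha>)" define b where "b = offset i (above i \<alpha>)"
    define a' where "a' = slope k (above k \<alpha>)" define b' where "b' = offset k (above k \<alpha>)"
    have one: "1 \<in> above i \<alpha>" "1 \<in> above k \<alpha>" using X one_above_iff assms by auto
    have lin: "reservation i x = a * x - b" "reservation k x = a' * x - b'" if "0 \<le> x" "above i x = above i \<alpha>" "above k x = above k \<alpha>" for x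
      using reservation_affine[of i x] reservation_affine[of k x] that X one assms by (auto simp: a_def b_def a'_def b'_def)
    have "a * \<alpha> - b = a' * \<alpha> - b'" "a * \<beta> - b = a' * \<beta> - b'"
      using lin[of \<alpha>] lin[of \<beta>] X eq that(3) by auto
    then have "(\<beta> - \<alpha>) * (a - a') = 0" by (simp add: algebra_simps)
    then have "a = a'" using that(3) by simp
    with \<open>a * \<alpha> - b = a' * \<alpha> - b'\<close> have "b = b'" by simp
    have "\<forall>\<^sub>F x in nhds \<alpha>. reservation i x = reservation k x"
      using above_near[OF X(4,1,2)] above_near[OF X(5,1,3)] eventually_nonneg_nhds[OF X(1)]
      by eventually_elim (use lin \<open>a = a'\<close> \<open>b = b'\<close> in auto)
    then show False using X by blast
  qed
  have inj: "inj_on ?f ?X"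
  proof (rule inj_onI)
    fix \<alpha> \<beta> assume "\<alpha> \<in> ?X" "\<beta> \<in> ?X" "?f \<alpha> = ?f \<beta>"
    then show "\<alpha> = \<beta>" using neq[of \<alpha> \<beta>] neq[of \<beta> \<alpha>] by (metis linorder_neqE_linordered_idom)
  qed
  have "card (above l \<alpha>) \<le> num_outcomes I" for l \<alpha>
    unfolding card_J[symmetric] by (intro card_mono) (auto simp: above_def)
  then have "?f \<alpha> \<le> 2 * num_outcomes I" for \<alpha> by (simp add: add_mono mult_2)
  \<comment> \<open>The total sizes range over 0, ..., 2m, which gives the bound 2m + 1.\<close>
  then have sub: "?f ` ?X \<subseteq> {..2 * num_outcomes I}" by auto
  have "finite ?X" using finite_imageD[OF finite_subset[OF sub] inj] by simp
  moreover have "card ?X \<le> card {..2 * num_outcomes I}"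
    using card_inj_on_le[OF inj sub] by simp
  ultimately show ?thesis by simp
qed

lemma exceptional_bound:
  "finite exceptional \<and> real (card exceptional) \<le> 4 * (real (num_actions I))\<^sup>2 * real (num_outcomes I)"
proof -
  let ?n = "num_actions I" and ?m = "num_outcomes I"
  have n: "card A = ?n" by (simp add: actions_def)
  have m: "1 \<le> ?m" using one_in_J by (simp add: outcomes_def)
  have "finite exceptional" using switches_bound crossing_points_bound by (auto simp: exceptional_def)
  moreover have "card exceptional \<le> ?n * ?m + ?n * (?n * (2 * ?m + 1))"
  proof -
    have "card (\<Union>i\<in>A. switches i) \<le> (\<Sum>i\<in>A. ?m)"
      using switches_bound by (intro order_trans[OF card_UN_le] sum_mono) auto
    moreover have "card (\<Union>k\<in>A. crossing_points i k) \<le> ?n * (2 * ?m + 1)" if "i \<in> A" for i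
    proof -
      have "card (\<Union>k\<in>A. crossing_points i k) \<le> (\<Sum>k\<in>A. 2 * ?m + 1)"
        using crossing_points_bound[OF that] by (intro order_trans[OF card_UN_le] sum_mono) auto
      then show ?thesis by (simp add: n)
    qed
    then have "card (\<Union>i\<in>A. \<Union>k\<in>A. crossing_points i k) \<le> (\<Sum>i\<in>A. ?n * (2 * ?m + 1))"
      by (intro order_trans[OF card_UN_le[OF finite_A, of "\<lambda>i. \<Union>k\<in>A. crossing_points i k"]] sum_mono)
    ultimately show ?thesis
      unfolding exceptional_def by (intro order_trans[OF card_Un_le]) (simp add: n)
  qed
  \<comment> \<open>The constant 4 is 1 from the switching points plus 2 + 1 from the crossings,
    using n \<le> n^2 and 1 \<le> m.\<close>
  moreover have "?n * ?m + ?n * (?n * (2 * ?m + 1)) \<le> 4 * ?n\<^sup>2 * ?m"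
  proof -
    have "?n * ?m \<le> ?n * ?n * ?m" by (intro mult_right_mono) (cases ?n, auto)
    moreover have "?n * ?n * 1 \<le> ?n * ?n * ?m" by (rule mult_left_mono[OF m]) simp
    moreover have "?n * ?m + ?n * (?n * (2 * ?m + 1)) = ?n * ?m + 2 * (?n * ?n * ?m) + ?n * ?n * 1"
      "4 * ?n\<^sup>2 * ?m = 4 * (?n * ?n * ?m)" by (simp_all add: power2_eq_square algebra_simps)
    ultimately show ?thesis by linarith
  qed
  ultimately have "finite exceptional" "card exceptional \<le> 4 * ?n\<^sup>2 * ?m" by linarith+
  then have "real (card exceptional) \<le> real (4 * ?n\<^sup>2 * ?m)" by (simp only: of_nat_le_iff)
  with \<open>finite exceptional\<close> show ?thesis by simp
qed

theorem critical_values_bound: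
  "finite (critical_values I T) \<and>
    real (card (critical_values I T)) \<le> 4 * (real (num_actions I))\<^sup>2 * real (num_outcomes I)"
proof -
  have "critical_values I T \<subseteq> exceptional" using critical_values_subset kink_exceptional by blast
  then have "finite (critical_values I T)" "card (critical_values I T) \<le> card exceptional"
    using exceptional_bound by (auto intro: finite_subset card_mono)
  then show ?thesis using exceptional_bound by linarith
qed

end

section \<open>Correctness of the algorithm\<close>

lemma dedup_properties: "distinct (dedup xs) \<and> set (dedup xs) = set xs"
proof -
  have "distinct ys \<Longrightarrow> distinct (fold (\<lambda>y ys. if list_ex (\<lambda>z. z \<le> y \<and> y \<le> z) ys then ys else y # ys) xs ys) \<and>
      set (fold (\<lambda>y ys. if list_ex (\<lambda>z. z \<le> y \<and> y \<le> z) ys then ys else y # ys) xs ys) = set xs \<union> set ys"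
    for ys :: "real list"
  proof (induction xs arbitrary: ys)
    case (Cons x xs)
    have ex: "list_ex (\<lambda>z. z \<le> x \<and> x \<le> z) ys \<longleftrightarrow> x \<in> set ys" by (auto simp: list_ex_iff intro: antisym)
    show ?case
    proof (cases "x \<in> set ys")
      case True
      then show ?thesis using Cons.IH[OF Cons.prems] ex by auto
    next
      case False
      then have "distinct (x # ys)" using Cons.prems by simp
      from Cons.IH[OF this] show ?thesis using ex False by auto
    qed
  qed simp
  from this[of "[]"] show ?thesis by (simp add: dedup_def)
qed

section \<open>Evaluation of the optimal utility\<close>

context independent_instance
begin

definition outcome_list :: "nat list" where "outcome_list = [1..<Suc (num_outcomes I)]"

definition reward_list :: "real list" where "reward_list = map r outcome_list"

definition act :: "nat \<Rightarrow> real act" where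
  "act i = (c i, map (\<lambda>j. (q i j, r j)) outcome_list)"

definition act_list :: "real act list" where "act_list = map act [0..<num_actions I]"

lemma set_outcome_list [simp]: "set outcome_list = J" "distinct outcome_list"
  by (auto simp: outcome_list_def outcomes_def)

lemma sum_outcome_list: "(\<Sum>j\<leftarrow>outcome_list. f j) = (\<Sum>j\<in>J. f j)"
  using sum.distinct_set_conv_list[of outcome_list f] by simp

lemma prod_act_list: "prod_list (map f act_list) = (\<Prod>i\<in>A. f (act i))"
  using prod.distinct_set_conv_list[of "[0..<num_actions I]" "\<lambda>i. f (act i)"]
  by (simp add: act_list_def comp_def actions_def atLeast0LessThan)

lemma tail_prob_act: "tail_prob (snd (act i)) \<rho> = tail_p i \<rho>"
  by (simp add: tail_prob_def act_def tail_p_def comp_def sum_outcome_list sum.inter_filter[symmetric])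

lemma tail_reward_act: "tail_reward (snd (act i)) \<rho> = tail_r i \<rho>"
  by (simp add: tail_reward_def act_def tail_r_def comp_def sum_outcome_list sum.inter_filter[symmetric])

lemma set_act_lines: "set (act_lines (act i)) =
  (\<lambda>j. (tail_r i (r j) / tail_p i (r j), c i / tail_p i (r j))) ` {j \<in> J. 0 < tail_p i (r j)}"
proof -
  have "set (snd (act i)) = (\<lambda>j. (q i j, r j)) ` J" "fst (act i) = c i" by (simp_all add: act_def)
  moreover have "{x \<in> (\<lambda>j. (q i j, r j)) ` J. 0 < tail_p i (snd x)} = (\<lambda>j. (q i j, r j)) ` {j \<in> J. 0 < tail_p i (r j)}"
    by auto
  ultimately show ?thesis
    unfolding act_lines_def tail_prob_act tail_reward_act by (simp add: image_image)
qed

lemma act_index_act: "act_index \<alpha> (act i) = reservation i \<alpha>"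
proof -
  have "act_index \<alpha> (act i) = Max (insert 0 ((\<lambda>l. \<alpha> * fst l - snd l) ` set (act_lines (act i))))"
    unfolding act_index_def by (simp add: Max.set_eq_fold[symmetric])
  also have "\<dots> = reservation i \<alpha>"
    unfolding reservation_def set_act_lines image_image by (simp add: diff_divide_distrib)
  finally show ?thesis .
qed

lemma prob_p:
  assumes "i \<in> A"
  shows "measure_pmf.prob (p i) {j. Q j} = (\<Sum>j\<in>J. if Q j then q i j else 0)"
proof -
  have "measure_pmf.prob (p i) {j. Q j} = measure_pmf.expectation (p i) (indicat_real {j. Q j})"
    by simp
  also have "\<dots> = (\<Sum>j\<in>J. indicat_real {j. Q j} j * q i j)"
    by (rule integral_measure_pmf_real) (use set_p[OF assms] in auto)
  also have "\<dots> = (\<Sum>j\<in>J. if Q j then q i j else 0)" by (intro sum.cong) auto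
  finally show ?thesis .
qed

lemma prob_le_act: "i \<in> A \<Longrightarrow> prob_le \<alpha> y (act i) = measure_pmf.prob (p i) {j. capped \<alpha> i j \<le> y}"
  unfolding prob_le_def act_index_act prob_p
  by (auto simp: act_def comp_def sum_outcome_list capped_def min_le_iff_disj sum_q cong: if_cong)

lemma prob_less_act: "i \<in> A \<Longrightarrow> prob_less \<alpha> y (act i) = measure_pmf.prob (p i) {j. capped \<alpha> i j < y}"
  unfolding prob_less_def act_index_act prob_p
  by (auto simp: act_def comp_def sum_outcome_list capped_def min_less_iff_disj sum_q cong: if_cong)

lemma prob_joint_pmf: "measure_pmf.prob (joint_pmf A) {x. \<forall>i\<in>A. Q i (x i)} = (\<Prod>i\<in>A. measure_pmf.prob (p i) {j. Q i j})"
proof -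
  have "{x. \<forall>i\<in>A. Q i (x i)} = Pi A (\<lambda>i. {j. Q i j})" by auto
  then show ?thesis unfolding joint_pmf_def by (simp add: measure_Pi_pmf_Pi)
qed

text \<open>The fallback 0 takes part in the maximum; for y \<ge> 0 it imposes no condition, and
  independence factors the event.\<close>

lemma prob_best_le:
  assumes "0 \<le> y"
  shows "expect A (\<lambda>x. if best_capped \<alpha> A 0 x \<le> y then 1 else 0) = prod_list (map (prob_le \<alpha> y) act_list)"
proof -
  have "best_capped \<alpha> A 0 x \<le> y \<longleftrightarrow> (\<forall>i\<in>A. capped \<alpha> i (x i) \<le> y)" for x
    unfolding best_capped_def using assms by (subst Max_le_iff) auto
  then have "(\<lambda>x. if best_capped \<alpha> A 0 x \<le> y then 1 else 0) = indicat_real {x. \<forall>i\<in>A. capped \<alpha> i (x i) \<le> y}"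
    by (auto simp: fun_eq_iff indicator_def)
  then have "expect A (\<lambda>x. if best_capped \<alpha> A 0 x \<le> y then 1 else 0) =
      measure_pmf.expectation (joint_pmf A) (indicat_real {x. \<forall>i\<in>A. capped \<alpha> i (x i) \<le> y})"
    by (simp only: expect_expectation[OF order_refl])
  then show ?thesis using prob_joint_pmf[of "\<lambda>i j. capped \<alpha> i j \<le> y"] by (simp add: prod_act_list prob_le_act)
qed

text \<open>With y = 0 and no actions the product would be 1, although the maximum is never
  negative.\<close>

lemma prob_best_less:
  assumes "0 < y"
  shows "expect A (\<lambda>x. if best_capped \<alpha> A 0 x < y then 1 else 0) = prod_list (map (prob_less \<alpha> y) act_list)"
proof -
  have "best_capped \<alpha> A 0 x < y \<longleftrightarrow> (\<forall>i\<in>A. capped \<alpha> i (x i) < y)" for x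
    unfolding best_capped_def using assms by (subst Max_less_iff) auto
  then have "(\<lambda>x. if best_capped \<alpha> A 0 x < y then 1 else 0) = indicat_real {x. \<forall>i\<in>A. capped \<alpha> i (x i) < y}"
    by (auto simp: fun_eq_iff indicator_def)
  then have "expect A (\<lambda>x. if best_capped \<alpha> A 0 x < y then 1 else 0) =
      measure_pmf.expectation (joint_pmf A) (indicat_real {x. \<forall>i\<in>A. capped \<alpha> i (x i) < y})"
    by (simp only: expect_expectation[OF order_refl])
  then show ?thesis using prob_joint_pmf[of "\<lambda>i j. capped \<alpha> i j < y"] by (simp add: prod_act_list prob_less_act)
qed

lemma opt_value_eq:
  assumes "0 \<le> \<alpha>"
  shows "opt_value reward_list act_list \<alpha> = upper \<alpha>"
proof -
  let ?Z = "best_capped \<alpha> A 0"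
  define ys where "ys = map (\<lambda>r. \<alpha> * r) reward_list @ map (act_index \<alpha>) act_list"
  have ys: "set ys = (\<lambda>j. \<alpha> * r j) ` J \<union> (\<lambda>i. reservation i \<alpha>) ` A"
    by (auto simp: ys_def reward_list_def act_list_def act_index_act actions_def)
  have pos: "0 \<le> y" if "y \<in> set ys" for y
    using that assms r_nonneg reservation_nonneg unfolding ys by auto
  \<comment> \<open>The maximum only takes values from the summation list, so summing over that list
    recovers it.\<close>
  have Z: "?Z x \<in> set ys" if "x \<in> set_pmf (joint_pmf A)" for x
  proof -
    have "?Z x \<in> insert 0 ((\<lambda>i. capped \<alpha> i (x i)) ` A)" unfolding best_capped_def by (intro Max_in) auto
    moreover have "0 \<in> set ys" unfolding ys using image_eqI[of 0 "\<lambda>j. \<alpha> * r j" 1 J] one_in_J by simp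
    moreover have "capped \<alpha> i (x i) \<in> set ys" if "i \<in> A" for i
      using that set_joint_pmf[OF order_refl \<open>x \<in> set_pmf (joint_pmf A)\<close>, of i] unfolding ys capped_def min_def by auto
    ultimately show ?thesis by auto
  qed
  have step: "y * (prod_list (map (prob_le \<alpha> y) act_list) - prod_list (map (prob_less \<alpha> y) act_list)) =
      expect A (\<lambda>x. if ?Z x = y then y else 0)" if "y \<in> set ys" for y
  proof (cases "y = 0")
    case False
    then have "0 < y" using pos[OF that] by simp
    then have "y * (prod_list (map (prob_le \<alpha> y) act_list) - prod_list (map (prob_less \<alpha> y) act_list)) =
        expect A (\<lambda>x. y * ((if ?Z x \<le> y then 1 else 0) - (if ?Z x < y then 1 else 0)))"
      by (simp only: expect_mult expect_diff prob_best_le[OF less_imp_le] prob_best_less)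
    also have "\<dots> = expect A (\<lambda>x. if ?Z x = y then y else 0)" by (intro expect_cong) auto
    finally show ?thesis .
  next
    case True
    have "expect A (\<lambda>x. if ?Z x = y then y else 0) = expect A (\<lambda>_. 0)" by (intro expect_cong) (simp add: True)
    then show ?thesis by (simp add: True expect_const)
  qed
  have "opt_value reward_list act_list \<alpha> = (\<Sum>y\<in>set ys.
      y * (prod_list (map (prob_le \<alpha> y) act_list) - prod_list (map (prob_less \<alpha> y) act_list)))"
    unfolding opt_value_def ys_def[symmetric]
    by (simp only: sum.distinct_set_conv_list[OF dedup_properties[THEN conjunct1], symmetric]
      dedup_properties[THEN conjunct2])
  also have "\<dots> = (\<Sum>y\<in>set ys. 1 * expect A (\<lambda>x. if ?Z x = y then y else 0))"
    by (intro sum.cong refl) (simp add: step)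
  also have "\<dots> = expect A (\<lambda>x. \<Sum>y\<in>set ys. 1 * (if ?Z x = y then y else 0))"
    by (rule expect_sum[symmetric])
  also have "\<dots> = expect A ?Z"
    by (intro expect_cong) (use Z in auto)
  also have "\<dots> = upper \<alpha>" using upper_eq_capped_value[OF assms] by (simp add: capped_value_def)
  finally show ?thesis .
qed

section \<open>Affinity between neighbouring candidate points\<close>

abbreviation line_set :: "(real \<times> real) set" where
  "line_set \<equiv> set (all_lines reward_list act_list)"

abbreviation point_set :: "real set" where
  "point_set \<equiv> set (points reward_list act_list)"

lemma line_set_eq: "line_set = (\<lambda>j. (r j, 0)) ` J \<union> (\<Union>i\<in>A. set (act_lines (act i)))"
  by (auto simp: all_lines_def reward_list_def act_list_def actions_def)

lemma point_set_nonneg: "x \<in> point_set \<Longrightarrow> 0 \<le> x"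
  by (auto simp: points_def)

lemma crossing_in_point_set:
  assumes "l \<in> line_set" "k \<in> line_set" "fst k < fst l" "0 < (snd l - snd k) / (fst l - fst k)"
  shows "(snd l - snd k) / (fst l - fst k) \<in> point_set"
  using assms by (auto simp: points_def crossings_def intro!: bexI[of _ l])

text \<open>A crossing strictly inside the interval would be positive and hence itself a point;
  nonpositive crossings lie to the left, as a \<ge> 0.\<close>

lemma lines_comparable:
  assumes "a \<in> point_set" "a < b" "point_set \<inter> {a<..<b} = {}"
  shows "comparable_along (principal {a..b}) ((\<lambda>l x. x * fst l - snd l) ` line_set)"
proof -
  have steep: "(\<forall>x\<in>{a..b}. x * fst k - snd k \<le> x * fst l - snd l) \<or>
      (\<forall>x\<in>{a..b}. x * fst l - snd l \<le> x * fst k - snd k)"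
    if lk: "l \<in> line_set" "k \<in> line_set" "fst k < fst l" for l k
  proof -
    define z where "z = (snd l - snd k) / (fst l - fst k)"
    have iff: "x * fst k - snd k \<le> x * fst l - snd l \<longleftrightarrow> z \<le> x"
      "x * fst l - snd l \<le> x * fst k - snd k \<longleftrightarrow> x \<le> z" for x
      using lk(3) by (auto simp: z_def divide_le_eq le_divide_eq algebra_simps)
    have "z \<le> a \<or> b \<le> z"
    proof (cases "0 < z")
      case True
      then have "z \<in> point_set" using crossing_in_point_set[OF lk] by (simp add: z_def)
      then show ?thesis using assms(3) by (force simp: not_le)
    next
      case False
      then show ?thesis using point_set_nonneg[OF assms(1)] by simp
    qed
    then show ?thesis unfolding iff by auto
  qed
  have "(\<forall>x\<in>{a..b}. x * fst l - snd l \<le> x * fst k - snd k) \<or>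
      (\<forall>x\<in>{a..b}. x * fst k - snd k \<le> x * fst l - snd l)" if "l \<in> line_set" "k \<in> line_set" for l k
  proof -
    consider "fst k < fst l" | "fst l < fst k" | "fst l = fst k" by linarith
    then show ?thesis
    proof cases
      case 1
      then show ?thesis using steep[of l k] that by blast
    next
      case 2
      then show ?thesis using steep[of k l] that by blast
    next
      case 3
      then show ?thesis by auto
    qed
  qed
  then show ?thesis unfolding comparable_along_def eventually_principal by blast
qed

text \<open>The indices need not be lines themselves; they are maxima of 0, which is the reward line
  of outcome 1, and the lines of the action, and all of these keep their order on the
  interval.\<close>

lemma upper_affine_between_points:
  assumes "a \<in> point_set" "a < b" "point_set \<inter> {a<..<b} = {}"
  shows "\<exists>\<rho> \<gamma>. \<forall>x\<in>{a..b}. upper x = \<rho> * x + \<gamma>"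
proof -
  let ?F = "(\<lambda>l x. x * fst l - snd l) ` line_set"
  have comp: "comparable_along (principal {a..b}) ?F" by (rule lines_comparable[OF assms])
  have rewards: "member_along (principal {a..b}) ?F (\<lambda>\<alpha>. \<alpha> * r j)" if "j \<in> J" for j
    by (rule member_along_refl, rule image_eqI[of _ _ "(r j, 0)"]) (use that in \<open>auto simp: line_set_eq\<close>)
  have "affine_along (principal {a..b}) upper"
  proof (rule upper_affine_along[OF comp _ _ rewards])
    show "affine_along (principal {a..b}) f" if "f \<in> ?F" for f
    proof -
      from that obtain l where "f = (\<lambda>x. x * fst l - snd l)" by auto
      then have "\<forall>\<^sub>F x in principal {a..b}. f x = fst l * x + (- snd l)" by (simp add: eventually_principal)
      then show ?thesis unfolding affine_along_def by blast
    qed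
    show "\<forall>\<^sub>F \<alpha> in principal {a..b}. 0 \<le> \<alpha>"
      using point_set_nonneg[OF assms(1)] by (auto simp: eventually_principal)
    show "member_along (principal {a..b}) ?F (reservation i)" if "i \<in> A" for i
    proof -
      let ?K = "{j \<in> J. 0 < tail_p i (r j)}"
      have "member_along (principal {a..b}) ?F (\<lambda>\<alpha>. 0)" using rewards[OF one_in_J] by simp
      moreover have "member_along (principal {a..b}) ?F (\<lambda>\<alpha>. (\<alpha> * tail_r i (r j) - c i) / tail_p i (r j))"
        if "j \<in> ?K" for j
        by (rule member_along_refl, rule image_eqI[of _ _ "(tail_r i (r j) / tail_p i (r j), c i / tail_p i (r j))"])
          (use that \<open>i \<in> A\<close> in \<open>auto simp: line_set_eq set_act_lines diff_divide_distrib\<close>)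
      ultimately show ?thesis
        unfolding reservation_def[abs_def]
        by (intro member_along_Max[OF comp, where g = "\<lambda>j \<alpha>. (\<alpha> * tail_r i (r j) - c i) / tail_p i (r j)"]) auto
    qed
  qed
  then show ?thesis unfolding affine_along_def eventually_principal .
qed

theorem set_kinks: "set (kinks reward_list act_list) = {\<alpha>. 0 < \<alpha> \<and> \<alpha> \<le> 1 \<and> kink \<alpha>}"
proof -
  let ?P = point_set
  have bc: "below_chords (map (\<lambda>\<alpha>. (\<alpha>, opt_value reward_list act_list \<alpha>)) (points reward_list act_list))
      (\<alpha>, opt_value reward_list act_list \<alpha>) \<longleftrightarrow>
    (\<forall>a\<in>?P. \<forall>b\<in>?P. a < \<alpha> \<and> \<alpha> < b \<longrightarrow> (b - a) * upper \<alpha> < (b - \<alpha>) * upper a + (\<alpha> - a) * upper b)"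
    if "0 < \<alpha>" for \<alpha>
    using that by (auto simp: below_chords_def list_all_iff opt_value_eq point_set_nonneg)
  have "\<alpha> \<in> set (kinks reward_list act_list) \<longleftrightarrow> 0 < \<alpha> \<and> \<alpha> \<le> 1 \<and> kink \<alpha>" for \<alpha>
  proof -
    have "kink \<alpha> \<longleftrightarrow> \<alpha> \<in> ?P \<and> (\<forall>a\<in>?P. \<forall>b\<in>?P. a < \<alpha> \<and> \<alpha> < b \<longrightarrow>
        (b - a) * upper \<alpha> < (b - \<alpha>) * upper a + (\<alpha> - a) * upper b)" if "0 < \<alpha>" "\<alpha> \<le> 1"
    proof (rule kink_iff_below_chords)
      show "\<exists>a\<in>?P. a < \<alpha>" by (rule bexI[of _ 0]) (use that in \<open>auto simp: points_def\<close>)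
      show "\<exists>b\<in>?P. \<alpha> < b" by (rule bexI[of _ 2]) (use that in \<open>auto simp: points_def\<close>)
    qed (auto intro!: upper_affine_between_points)
    moreover have "\<alpha> \<in> set (kinks reward_list act_list) \<longleftrightarrow> \<alpha> \<in> ?P \<and> 0 < \<alpha> \<and> \<alpha> \<le> 1 \<and>
      below_chords (map (\<lambda>\<alpha>. (\<alpha>, opt_value reward_list act_list \<alpha>)) (points reward_list act_list))
        (\<alpha>, opt_value reward_list act_list \<alpha>)"
      unfolding kinks_def kinks_of_graph_def by (auto simp: image_iff)
    ultimately show ?thesis using bc[of \<alpha>] by blast
  qed
  then show ?thesis by blast
qed

lemma acts_of_instance:
  "acts_of (map c [0..<num_actions I]) reward_list
    (map (\<lambda>i. map (outcome_prob I i) outcome_list) [0..<num_actions I]) = act_list"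
  by (simp add: acts_of_def reward_list_def act_list_def act_def zip_map_map zip_same_conv_map
    comp_def outcome_prob_eq)

text \<open>The numbers in the input determine \<open>reward_list\<close> and
  \<open>act_list\<close>, so one output is correct for every instance that the input
  describes.\<close>

theorem solve_critical_lists_critical_values:
  assumes "describes inp I"
  shows "lists_critical_values I (solve_critical inp)"
proof -
  obtain cs rs ps where inp: "inp = (cs, rs, ps)" by (cases inp)
  have d: "list_all proper cs" "list_all proper rs" "list_all (list_all proper) ps"
    "map frac_val cs = map c [0..<num_actions I]" "map frac_val rs = reward_list"
    "map (map frac_val) ps = map (\<lambda>i. map (outcome_prob I i) outcome_list) [0..<num_actions I]"
    using assms unfolding inp reward_list_def outcome_list_def describes.simps by blast+
  have L: "list_all proper (solve_critical inp)" "map frac_val (solve_critical inp) = kinks reward_list act_list"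
    using solve_critical_correct[OF d(1-3)] unfolding inp d acts_of_instance by auto
  have "frac_val ` set (solve_critical inp) = {\<alpha>. 0 < \<alpha> \<and> \<alpha> \<le> 1 \<and> kink \<alpha>}"
    using arg_cong[OF L(2), of set] set_kinks by simp
  moreover have "critical_values I T - {1} = {\<alpha>. 0 < \<alpha> \<and> \<alpha> \<le> 1 \<and> kink \<alpha>} - {1}"
    if "tie_breaking_order I T" for T
    using critical_values_subset[of T] critical_below_one[OF that] by force
  ultimately show ?thesis
    unfolding lists_critical_values_def one_critical_iff using L(1) by simp
qed

end

theorem proposition3p3:
  shows "(\<exists>C :: real. \<forall>I T.
            independent_action_model I \<longrightarrow> tie_breaking_order I T \<longrightarrow>
              finite (critical_values I T) \<and>
              real (card (critical_values I T))
                \<le> C * (real (num_actions I))\<^sup>2 * real (num_outcomes I)) \<and>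
         poly_time_solvable enc_input (enc_list enc_frac) valid_inputs
           (\<lambda>inp L. \<forall>I. independent_action_model I \<longrightarrow> describes inp I \<longrightarrow>
              lists_critical_values I L)"
proof (rule conjI)
  show "\<exists>C :: real. \<forall>I T. independent_action_model I \<longrightarrow> tie_breaking_order I T \<longrightarrow>
      finite (critical_values I T) \<and>
      real (card (critical_values I T)) \<le> C * (real (num_actions I))\<^sup>2 * real (num_outcomes I)"
  proof (rule exI[of _ 4], intro allI impI)
    fix I T assume "independent_action_model I"
    then interpret independent_instance I by unfold_locales
    show "finite (critical_values I T) \<and>
        real (card (critical_values I T)) \<le> 4 * (real (num_actions I))\<^sup>2 * real (num_outcomes I)"
      by (rule critical_values_bound)
  qed
next
  have correct: "lists_critical_values I (solve_critical inp)" if "independent_action_model I" "describes inp I" for I inp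
  proof -
    interpret independent_instance I using that(1) by unfold_locales
    show ?thesis by (rule solve_critical_lists_critical_values[OF that(2)])
  qed
  obtain p q where pq: "\<And>x. \<exists>t. runs p (enc_input x) (enc_list enc_frac (solve_critical x)) t \<and> t \<le> poly q (vsize (enc_input x))"
    using solve_critical_poly_time by blast
  show "poly_time_solvable enc_input (enc_list enc_frac) valid_inputs
      (\<lambda>inp L. \<forall>I. independent_action_model I \<longrightarrow> describes inp I \<longrightarrow> lists_critical_values I L)"
    unfolding poly_time_solvable_def
  proof (rule exI[of _ p], rule exI[of _ q], rule ballI)
    fix x
    obtain t where "runs p (enc_input x) (enc_list enc_frac (solve_critical x)) t" "t \<le> poly q (vsize (enc_input x))"
      using pq by blast
    then show "\<exists>y t. (\<forall>I. independent_action_model I \<longrightarrow> describes x I \<longrightarrow> lists_critical_values I y) \<and>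
        runs p (enc_input x) (enc_list enc_frac y) t \<and> t \<le> poly q (vsize (enc_input x))"
      using correct by blast
  qed
qed

end
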